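(* Let $S=\{q\in J^+(q_0)\mid d(q)=1\}$ be the unit sub-Lorentzian sphere. (1) $S$ is a regular real-analytic manifold diffeomorphic to $\mathbb R^2$. (2) Let $q=\operatorname{Exp}(\psi,c,1)\in S$, $(\psi,c)\in\mathbb R^2$. Then the tangent space is $$T_qS=\Big\{v=\sum_{i=1}^3v_iX_i(q)\ \Big|\ -v_1\cosh(\psi+c)+v_2\sinh(\psi+c)+v_3c=0\Big\}.$$ (3) $S$ is the graph of the function $x=\sqrt{y^2+f(z)}$, where $f(z)=e\circ k(z)$, $e(w)=\frac{\sinh^2w}{w^2}$, $k(z)=b(z)/2$, $b=a^{-1}$, $a(c)=\frac{\sinh c-c}{2c^2}$. (4) The function $f(z)$ is real-analytic, even, strictly convex, and unboundedly and strictly increasing for $z\ge0$. It has a Taylor decomposition $f(z)=1+12z^2+O(z^4)$ as $z\to0$ and an asymptote $4|z|$ as $z\to\infty$: $\lim_{z\to\infty}(f(z)-4|z|)=0$. (5) The function $f(z)$ satisfies the bounds $4|z|<f(z)<4|z|+1$ for $z\ne0$. (6) A section of $S$ by a plane $\{z=\mathrm{const}\}$ is a branch of the hyperbola $x^2-y^2=f(z)$, $x>0$. A section of $S$ by a plane $\{x=\mathrm{const}>1\}$ is a strictly convex curve $y^2+f(z)=x^2$ diffeomorphic to the circle $S^1$. (7) The sub-Lorentzian distance from $q_0$ to a point $q=(x,y,z)\in I^+(q_0)$ may be expressed as $d(q)=R$, where $R>0$ satisfies $x^2-y^2=R^2f(z/R^2)$. (8) The sub-Lorentzian ball $B=\{q\in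 J^+(q_0)\mid d(q)\le1\}$ has infinite volume in the coordinates $x,y,z$.
   Context: $M=\mathbb R^3_{x,y,z}$ is the Heisenberg group with product $(x_1,y_1,z_1)\cdot(x_2,y_2,z_2)=(x_1+x_2,\,y_1+y_2,\,z_1+z_2+(x_1y_2-x_2y_1)/2)$, $q_0=(0,0,0)$, $X_1=\frac{\partial}{\partial x}-\frac y2\frac{\partial}{\partial z}$, $X_2=\frac{\partial}{\partial y}+\frac x2\frac{\partial}{\partial z}$, $X_3=\frac{\partial}{\partial z}$. Admissible trajectories are Lipschitz curves $q:[0,t_1]\to M$ with $\dot q=u_1X_1(q)+u_2X_2(q)$, $u_1\ge|u_2|$ a.e.; their length is $l(q(\cdot))=\int_0^{t_1}\sqrt{u_1^2-u_2^2}\,dt$. The causal future $J^+(q_0)$ is the set of points reachable from $q_0$ (in nonnegative time) by admissible trajectories, and the chronological future $I^+(q_0)$ is the set of points reachable in positive time by trajectories with $u_1>|u_2|$ a.e. It is known that $J^+(q_0)=\{-x^2+y^2+4|z|\le0,\ x\ge0\}$ and $I^+(q_0)=\{-x^2+y^2+4|z|<0,\ x>0\}$. For $q\in J^+(q_0)$ the sub-Lorentzian distance $d(q)=d(q_0,q)$ is the supremum of $l$ over all admissible trajectories from $q_0$ to $q$ ($d(q_0)=0$); $d$ is not defined outside $J^+(q_0)$. The exponential mapping is $\operatorname{Exp}(\psi,c,t)=(x,y,z)$ for $(\psi,c)\in\mathbb R^2$, $t>0$, with: if $c=0$, $x=t\cosh\psi$, $y=t\sinh\psi$, $z=0$; if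 $c\neq0$, $x=\frac{\sinh(\psi+ct)-\sinh\psi}{c}$, $y=\frac{\cosh(\psi+ct)-\cosh\psi}{c}$, $z=\frac{\sinh(ct)-ct}{2c^2}$. One has $S=\{\operatorname{Exp}(\psi,c,1)\mid(\psi,c)\in\mathbb R^2\}$. The functions $a$ and $e$ are extended by continuity: $a(0)=0$, $e(0)=1$; $a:\mathbb R\to\mathbb R$ is a diffeomorphism. *)

theory Defs
  imports "HOL-Analysis.Analysis" "HOL-Library.Landau_Symbols"
begin

section \<open>Real-analytic maps and submanifolds of Euclidean spaces\<close>

text \<open>Multi-indices are the functions in \<open>Basis \<rightarrow>\<^sub>E UNIV\<close>; the power series converges
  unconditionally on a ball around \<open>p\<close>.\<close>

definition real_analytic_at :: "('a::euclidean_space \<Rightarrow> 'b::euclidean_space) \<Rightarrow> 'a \<Rightarrow> bool" where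
  "real_analytic_at F p \<longleftrightarrow>
     (\<exists>r>0. \<exists>C. \<forall>h. norm h < r \<longrightarrow>
        ((\<lambda>\<alpha>. (\<Prod>i\<in>Basis. (h \<bullet> i) ^ \<alpha> i) *\<^sub>R C \<alpha>) has_sum F (p + h))
          (Basis \<rightarrow>\<^sub>E (UNIV :: nat set)))"

text \<open>The set \<open>A\<close> need not be open: as usual for maps defined on submanifolds, \<open>F\<close> is required
  to have local analytic extensions to open sets of the ambient space.\<close>

definition real_analytic_on :: "('a::euclidean_space \<Rightarrow> 'b::euclidean_space) \<Rightarrow> 'a set \<Rightarrow> bool" where
  "real_analytic_on F A \<longleftrightarrow>
     (\<forall>p\<in>A. \<exists>U G. open U \<and> p \<in> U \<and> (\<forall>x\<in>U. real_analytic_at G x) \<and> (\<forall>x\<in>U \<inter> A. G x = F x))"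

definition analytic_diffeomorphism ::
    "'a::euclidean_space set \<Rightarrow> 'b::euclidean_space set \<Rightarrow> ('a \<Rightarrow> 'b) \<Rightarrow> bool" where
  "analytic_diffeomorphism A B F \<longleftrightarrow>
     bij_betw F A B \<and> real_analytic_on F A \<and> real_analytic_on (inv_into A F) B"

definition analytic_diffeomorphic ::
    "'a::euclidean_space set \<Rightarrow> 'b::euclidean_space set \<Rightarrow> bool" where
  "analytic_diffeomorphic A B \<longleftrightarrow> (\<exists>F. analytic_diffeomorphism A B F)"

text \<open>Regular (that is, embedded) analytic submanifolds of dimension \<open>d\<close>: the set is locally
  straightened to a linear subspace by an analytic change of coordinates of the ambient space.\<close>

definition regular_analytic_submanifold :: "nat \<Rightarrow> 'a::euclidean_space set \<Rightarrow> bool" where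
  "regular_analytic_submanifold d A \<longleftrightarrow>
     (\<forall>p\<in>A. \<exists>U V L. \<exists>\<Phi> :: 'a \<Rightarrow> 'a. open U \<and> p \<in> U \<and> open V \<and> analytic_diffeomorphism U V \<Phi> \<and>
        subspace L \<and> dim L = d \<and> \<Phi> ` (U \<inter> A) = V \<inter> L)"

definition tangent_space :: "'a::euclidean_space set \<Rightarrow> 'a \<Rightarrow> 'a set" where
  "tangent_space A p =
     {v. \<exists>\<gamma> \<epsilon>. \<epsilon> > 0 \<and> \<gamma> C1_differentiable_on {-\<epsilon><..<\<epsilon>} \<and> \<gamma> ` {-\<epsilon><..<\<epsilon>} \<subseteq> A \<and>
        \<gamma> 0 = p \<and> (\<gamma> has_vector_derivative v) (at 0)}"

section \<open>Strict convexity\<close>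

definition strictly_convex_on :: "'a::real_vector set \<Rightarrow> ('a \<Rightarrow> real) \<Rightarrow> bool" where
  "strictly_convex_on A g \<longleftrightarrow> convex A \<and>
     (\<forall>x\<in>A. \<forall>y\<in>A. \<forall>t. x \<noteq> y \<and> 0 < t \<and> t < 1 \<longrightarrow>
        g ((1 - t) *\<^sub>R x + t *\<^sub>R y) < (1 - t) * g x + t * g y)"

definition strictly_convex_set :: "'a::euclidean_space set \<Rightarrow> bool" where
  "strictly_convex_set K \<longleftrightarrow> (\<forall>x\<in>K. \<forall>y\<in>K. x \<noteq> y \<longrightarrow> open_segment x y \<subseteq> interior K)"

definition strictly_convex_closed_curve :: "(real \<times> real) set \<Rightarrow> bool" where
  "strictly_convex_closed_curve \<Gamma> \<longleftrightarrow>
     (\<exists>K. compact K \<and> interior K \<noteq> {} \<and> strictly_convex_set K \<and> \<Gamma> = frontier K)"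

section \<open>The sub-Lorentzian problem on the Heisenberg group\<close>

definition q\<^sub>0 :: "real \<times> real \<times> real" where
  "q\<^sub>0 = (0, 0, 0)"

definition X\<^sub>1 :: "real \<times> real \<times> real \<Rightarrow> real \<times> real \<times> real" where
  "X\<^sub>1 = (\<lambda>(x, y, z). (1, 0, - y / 2))"

definition X\<^sub>2 :: "real \<times> real \<times> real \<Rightarrow> real \<times> real \<times> real" where
  "X\<^sub>2 = (\<lambda>(x, y, z). (0, 1, x / 2))"

definition X\<^sub>3 :: "real \<times> real \<times> real \<Rightarrow> real \<times> real \<times> real" where
  "X\<^sub>3 = (\<lambda>(x, y, z). (0, 0, 1))"

text \<open>Measurability and essential boundedness of the controls need not be required: they are the
  first two components of the almost everywhere derivative of a Lipschitz curve.\<close>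

definition horizontal ::
    "real \<Rightarrow> (real \<Rightarrow> real \<times> real \<times> real) \<Rightarrow> (real \<Rightarrow> real) \<Rightarrow> (real \<Rightarrow> real) \<Rightarrow> bool" where
  "horizontal T q u\<^sub>1 u\<^sub>2 \<longleftrightarrow> 0 \<le> T \<and> (\<exists>C. C-lipschitz_on {0..T} q) \<and>
     (AE t in lebesgue_on {0..T}.
        (q has_vector_derivative (u\<^sub>1 t *\<^sub>R X\<^sub>1 (q t) + u\<^sub>2 t *\<^sub>R X\<^sub>2 (q t))) (at t within {0..T}))"

definition admissible ::
    "real \<Rightarrow> (real \<Rightarrow> real \<times> real \<times> real) \<Rightarrow> (real \<Rightarrow> real) \<Rightarrow> (real \<Rightarrow> real) \<Rightarrow> bool" where
  "admissible T q u\<^sub>1 u\<^sub>2 \<longleftrightarrow>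
     horizontal T q u\<^sub>1 u\<^sub>2 \<and> (AE t in lebesgue_on {0..T}. u\<^sub>1 t \<ge> \<bar>u\<^sub>2 t\<bar>)"

definition timelike ::
    "real \<Rightarrow> (real \<Rightarrow> real \<times> real \<times> real) \<Rightarrow> (real \<Rightarrow> real) \<Rightarrow> (real \<Rightarrow> real) \<Rightarrow> bool" where
  "timelike T q u\<^sub>1 u\<^sub>2 \<longleftrightarrow>
     horizontal T q u\<^sub>1 u\<^sub>2 \<and> (AE t in lebesgue_on {0..T}. u\<^sub>1 t > \<bar>u\<^sub>2 t\<bar>)"

definition sl_length :: "real \<Rightarrow> (real \<Rightarrow> real) \<Rightarrow> (real \<Rightarrow> real) \<Rightarrow> real" where
  "sl_length T u\<^sub>1 u\<^sub>2 = (LINT t|lebesgue_on {0..T}. sqrt ((u\<^sub>1 t)\<^sup>2 - (u\<^sub>2 t)\<^sup>2))"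

definition causal_future :: "real \<times> real \<times> real \<Rightarrow> (real \<times> real \<times> real) set" where
  "causal_future p = {p'. \<exists>T q u\<^sub>1 u\<^sub>2. admissible T q u\<^sub>1 u\<^sub>2 \<and> q 0 = p \<and> q T = p'}"

definition chronological_future :: "real \<times> real \<times> real \<Rightarrow> (real \<times> real \<times> real) set" where
  "chronological_future p = {p'. \<exists>T q u\<^sub>1 u\<^sub>2. 0 < T \<and> timelike T q u\<^sub>1 u\<^sub>2 \<and> q 0 = p \<and> q T = p'}"

text \<open>The supremum is taken in the extended reals, so that an equation \<open>sl_dist p p' = ereal R\<close>
  includes the claim that the lengths are bounded. The value outside the causal future of \<open>p\<close>
  (the supremum of the empty set) is meaningless and is never used.\<close>

definition sl_dist :: "real \<times> real \<times> real \<Rightarrow> real \<times> real \<times> real \<Rightarrow> ereal" where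
  "sl_dist p p' = Sup {ereal (sl_length T u\<^sub>1 u\<^sub>2) |T q u\<^sub>1 u\<^sub>2.
     admissible T q u\<^sub>1 u\<^sub>2 \<and> q 0 = p \<and> q T = p'}"

definition unit_sphere :: "(real \<times> real \<times> real) set" where
  "unit_sphere = {q \<in> causal_future q\<^sub>0. sl_dist q\<^sub>0 q = 1}"

definition unit_ball :: "(real \<times> real \<times> real) set" where
  "unit_ball = {q \<in> causal_future q\<^sub>0. sl_dist q\<^sub>0 q \<le> 1}"

definition Exp :: "real \<Rightarrow> real \<Rightarrow> real \<Rightarrow> real \<times> real \<times> real" where
  "Exp \<psi> c t =
     (if c = 0 then (t * cosh \<psi>, t * sinh \<psi>, 0)
      else ((sinh (\<psi> + c * t) - sinh \<psi>) / c,
            (cosh (\<psi> + c * t) - cosh \<psi>) / c,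
            (sinh (c * t) - c * t) / (2 * c\<^sup>2)))"

section \<open>The profile function of the sphere\<close>

text \<open>The values of \<open>a_fun\<close> and \<open>e_fun\<close> at \<open>0\<close> are the continuous extensions; \<open>a_fun\<close> is a
  bijection of the real line, so \<open>inv\<close> is its genuine inverse.\<close>

definition a_fun :: "real \<Rightarrow> real" where
  "a_fun c = (if c = 0 then 0 else (sinh c - c) / (2 * c\<^sup>2))"

definition b_fun :: "real \<Rightarrow> real" where
  "b_fun = inv a_fun"

definition k_fun :: "real \<Rightarrow> real" where
  "k_fun z = b_fun z / 2"

definition e_fun :: "real \<Rightarrow> real" where
  "e_fun w = (if w = 0 then 1 else (sinh w)\<^sup>2 / w\<^sup>2)"

definition f_fun :: "real \<Rightarrow> real" where
  "f_fun = e_fun \<circ> k_fun"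

end

theory Submission
  imports Defs "HOL-Complex_Analysis.Conformal_Mappings"
begin

text \<open>
  The function \<open>f_fun\<close> is the maximum over \<open>w\<close> of the affine functions
  \<open>z \<mapsto> 4 * z * tanh w + tanh w / w\<close>, attained exactly at \<open>w = k_fun z\<close>; convexity, monotonicity and
  the formula for the derivative follow from this representation. It also makes
  \<open>x\<^sup>2 - y\<^sup>2 = R\<^sup>2 * f_fun (z / R\<^sup>2)\<close> equivalent to
  \<open>R\<^sup>2 = min\<^sub>w (x\<^sup>2 - y\<^sup>2 - 4 * z * tanh w) * (w / tanh w)\<close>. Along an admissible curve each of the
  functions \<open>x\<^sup>2 - y\<^sup>2 - 4 * z * tanh w\<close> is nondecreasing, hence so is \<open>R\<close>, and differentiating the
  function of the currently minimal \<open>w\<close> shows by AM-GM that \<open>R\<close> grows at least as fast as the length.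
  So \<open>R\<close> bounds the length of all curves from the origin, and dilated curves of \<open>Exp\<close> attain it.
  Analytic inverses are obtained from the holomorphic inverse function theorem. The volume of the
  ball is infinite because its slices of bounded \<open>z\<close> contain disjoint boxes with volumes of
  harmonic order.
\<close>

section \<open>Real-analytic functions of several variables\<close>

text \<open>The curves are merely Lipschitz, and \<open>R\<close> along a curve is a priori only
  monotone, so the fundamental theorem of calculus is not at hand for it. Its growth is read off
  left difference quotients instead: freezing the minimiser w of time t overestimates
  \<open>R\<close> at earlier times and is exact at t. Fatou's lemma then turns pointwise growth
  into an integral bound, with the right sign, since jumps and singular parts of a monotone function
  only add to its increment. The same device proves that the coordinates and the functions
  \<open>x\<^sup>2 - y\<^sup>2 - 4 * z * tanh w\<close> are monotone. AM-GM is an equality along the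
  curves of \<open>Exp\<close>, which makes the bound sharp. At the origin \<open>R\<close> is 0 and
  w is undetermined, so the estimate is first made for curves that start inside the cone. The
  natural parameter is w = c / 2, in which the slopes of the tangent lines of the profile are 4 tanh
  w. Quotients with a removable singularity at 0 are written as power series with nonnegative
  coefficients, which yields analyticity, monotonicity and lower bounds together.\<close>

definition multi_monomial :: "'a::euclidean_space \<Rightarrow> ('a \<Rightarrow> nat) \<Rightarrow> real" where
  "multi_monomial h \<alpha> = (\<Prod>i\<in>Basis. (h \<bullet> i) ^ \<alpha> i)"

definition multi_degree :: "('a::euclidean_space \<Rightarrow> nat) \<Rightarrow> nat" where
  "multi_degree \<alpha> = (\<Sum>i\<in>Basis. \<alpha> i)"

text \<open>This is the multi-index of the product of the monomials in the list. Restricting to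
  \<open>Basis\<close> keeps it in the extensional index set.\<close>

definition multi_sum :: "('a::euclidean_space \<Rightarrow> nat) list \<Rightarrow> 'a \<Rightarrow> nat" where
  "multi_sum \<alpha>s = (\<lambda>i\<in>Basis. \<Sum>\<alpha>\<leftarrow>\<alpha>s. \<alpha> i)"

abbreviation multi_indices :: "('a::euclidean_space \<Rightarrow> nat) set" where
  "multi_indices \<equiv> Basis \<rightarrow>\<^sub>E UNIV"

lemma real_analytic_at_alt:
  "real_analytic_at F p \<longleftrightarrow>
     (\<exists>r>0. \<exists>C. \<forall>h. norm h < r \<longrightarrow>
        ((\<lambda>\<alpha>. multi_monomial h \<alpha> *\<^sub>R C \<alpha>) has_sum F (p + h)) multi_indices)"
  by (simp add: real_analytic_at_def multi_monomial_def)

lemma real_analytic_atI: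
  assumes "r > 0" "\<And>h. norm h < r \<Longrightarrow>
    ((\<lambda>\<alpha>. multi_monomial h \<alpha> *\<^sub>R C \<alpha>) has_sum F (p + h)) multi_indices"
  shows "real_analytic_at F p"
  using assms unfolding real_analytic_at_alt
  by (intro exI[of _ r] conjI exI[of _ C]) auto

lemma multi_sum_mem [simp]: "multi_sum \<alpha>s \<in> multi_indices"
  by (simp add: multi_sum_def)

lemma multi_monomial_multi_sum:
  "multi_monomial h (multi_sum \<alpha>s) = prod_list (map (multi_monomial h) \<alpha>s)"
proof (induction \<alpha>s)
  case Nil
  then show ?case by (simp add: multi_monomial_def multi_sum_def)
next
  case (Cons \<alpha> \<alpha>s)
  have "multi_monomial h (multi_sum (\<alpha> # \<alpha>s)) = multi_monomial h \<alpha> * multi_monomial h (multi_sum \<alpha>s)"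
    by (simp add: multi_monomial_def multi_sum_def power_add prod.distrib)
  then show ?case using Cons by simp
qed

lemma abs_multi_monomial_le:
  assumes "norm h \<le> \<rho>"
  shows "\<bar>multi_monomial h \<alpha>\<bar> \<le> \<rho> ^ multi_degree \<alpha>"
proof -
  have "\<bar>multi_monomial h \<alpha>\<bar> = (\<Prod>i\<in>Basis. \<bar>h \<bullet> i\<bar> ^ \<alpha> i)"
    by (simp add: multi_monomial_def abs_prod power_abs)
  also have "\<dots> \<le> (\<Prod>i\<in>Basis. \<rho> ^ \<alpha> i)"
    using assms by (intro prod_mono) (auto intro!: power_mono order_trans[OF Basis_le_norm])
  also have "\<dots> = \<rho> ^ multi_degree \<alpha>"
    by (simp add: multi_degree_def power_sum)
  finally show ?thesis .
qed

text \<open>At a diagonal point all monomials of one degree agree, so summability there is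
  summability of the coefficients against powers of a single radius.\<close>

lemma multi_monomial_One: "multi_monomial (\<rho> *\<^sub>R One) \<alpha> = \<rho> ^ multi_degree \<alpha>"
  by (simp add: multi_monomial_def multi_degree_def power_sum)

lemma multi_degree_pos:
  assumes "\<alpha> \<in> multi_indices" "\<alpha> \<noteq> (\<lambda>i\<in>Basis. 0)"
  shows "multi_degree \<alpha> > 0"
proof (rule ccontr)
  assume "\<not> multi_degree \<alpha> > 0"
  then have "\<forall>i\<in>Basis. \<alpha> i = 0" unfolding multi_degree_def by (metis finite_Basis neq0_conv sum_eq_0_iff)
  then have "\<alpha> = (\<lambda>i\<in>Basis. 0)" using assms(1) by (auto simp: PiE_def extensional_def)
  with assms show False by simp
qed

lemma multi_monomial_0:
  assumes "\<alpha> \<in> multi_indices" "\<alpha> \<noteq> (\<lambda>i\<in>Basis. 0)"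
  shows "multi_monomial 0 \<alpha> = 0"
proof -
  obtain i where "i \<in> Basis" "\<alpha> i \<noteq> 0"
    using multi_degree_pos[OF assms] unfolding multi_degree_def by (metis less_irrefl sum.neutral)
  then show ?thesis by (auto simp: multi_monomial_def)
qed

lemma real_analytic_at_add:
  assumes "real_analytic_at F p" "real_analytic_at G p"
  shows "real_analytic_at (\<lambda>x. F x + G x) p"
proof -
  obtain r C where 1: "r > 0" "\<And>h. norm h < r \<Longrightarrow>
        ((\<lambda>\<alpha>. multi_monomial h \<alpha> *\<^sub>R C \<alpha>) has_sum F (p + h)) multi_indices"
    using assms(1) unfolding real_analytic_at_alt by blast
  obtain s D where 2: "s > 0" "\<And>h. norm h < s \<Longrightarrow>
        ((\<lambda>\<alpha>. multi_monomial h \<alpha> *\<^sub>R D \<alpha>) has_sum G (p + h)) multi_indices"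
    using assms(2) unfolding real_analytic_at_alt by blast
  have "((\<lambda>\<alpha>. multi_monomial h \<alpha> *\<^sub>R (C \<alpha> + D \<alpha>)) has_sum F (p + h) + G (p + h)) multi_indices"
    if "norm h < min r s" for h
    using has_sum_add[OF 1(2)[of h] 2(2)[of h]] that by (simp add: scaleR_add_right)
  moreover have "min r s > 0" using 1 2 by simp
  ultimately show ?thesis by (rule real_analytic_atI[rotated])
qed

lemma real_analytic_at_bounded_linear:
  assumes "real_analytic_at F p" "bounded_linear L"
  shows "real_analytic_at (\<lambda>x. L (F x)) p"
proof -
  obtain r C where 1: "r > 0" "\<And>h. norm h < r \<Longrightarrow>
        ((\<lambda>\<alpha>. multi_monomial h \<alpha> *\<^sub>R C \<alpha>) has_sum F (p + h)) multi_indices"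
    using assms(1) unfolding real_analytic_at_alt by blast
  have "((\<lambda>\<alpha>. multi_monomial h \<alpha> *\<^sub>R L (C \<alpha>)) has_sum L (F (p + h))) multi_indices"
    if "norm h < r" for h
    using has_sum_bounded_linear[OF assms(2) 1(2)[OF that]]
    by (simp add: o_def linear_simps[OF assms(2)])
  with 1(1) show ?thesis by (rule real_analytic_atI)
qed

lemma real_analytic_at_const: "real_analytic_at (\<lambda>_. c) p"
  unfolding real_analytic_at_alt
proof (intro exI[of _ 1] conjI exI[of _ "\<lambda>\<alpha>. if \<alpha> = (\<lambda>i\<in>Basis. 0) then c else 0"] allI impI)
  show "((\<lambda>\<alpha>. multi_monomial h \<alpha> *\<^sub>R (if \<alpha> = (\<lambda>i\<in>Basis. 0) then c else 0)) has_sum c) multi_indices"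
    for h :: 'a
    by (rule has_sum_finite_neutralI[of "{\<lambda>i\<in>Basis. 0}"]) (auto simp: multi_monomial_def)
qed simp

lemma real_analytic_at_inner_Basis:
  fixes p :: "'a::euclidean_space"
  assumes "b \<in> Basis"
  shows "real_analytic_at (\<lambda>x. x \<bullet> b) p"
proof -
  define \<delta> where "\<delta> = (\<lambda>i\<in>Basis. if i = b then 1 else (0::nat))"
  have mm: "multi_monomial h \<delta> = h \<bullet> b" for h
  proof -
    have "multi_monomial h \<delta> = (\<Prod>i\<in>Basis. if i = b then h \<bullet> i else 1)"
      unfolding multi_monomial_def \<delta>_def by (rule prod.cong) auto
    then show ?thesis using assms by simp
  qed
  have "real_analytic_at (\<lambda>x. (x - p) \<bullet> b) p"
    unfolding real_analytic_at_alt
  proof (intro exI[of _ 1] conjI exI[of _ "\<lambda>\<alpha>. if \<alpha> = \<delta> then 1 else 0"] allI impI)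
    show "((\<lambda>\<alpha>. multi_monomial h \<alpha> *\<^sub>R (if \<alpha> = \<delta> then 1 else 0)) has_sum (p + h - p) \<bullet> b) multi_indices"
      for h :: 'a
      by (rule has_sum_finite_neutralI[of "{\<delta>}"]) (auto simp: mm, auto simp: \<delta>_def)
  qed simp
  from real_analytic_at_add[OF this real_analytic_at_const[of "p \<bullet> b"]]
  show ?thesis by (simp add: inner_diff_left)
qed

lemma real_analytic_at_sum:
  assumes "finite I" "\<And>i. i \<in> I \<Longrightarrow> real_analytic_at (F i) p"
  shows "real_analytic_at (\<lambda>x. \<Sum>i\<in>I. F i x) p"
  using assms by induction (auto intro: real_analytic_at_const real_analytic_at_add)

lemma real_analytic_at_componentwise:
  assumes "\<And>b. b \<in> Basis \<Longrightarrow> real_analytic_at (\<lambda>x. F x \<bullet> b) p"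
  shows "real_analytic_at F p"
proof -
  have "real_analytic_at (\<lambda>x. \<Sum>b\<in>Basis. (F x \<bullet> b) *\<^sub>R b) p"
    by (intro real_analytic_at_sum finite_Basis real_analytic_at_bounded_linear[OF assms]
        bounded_linear_scaleR_left)
  then show ?thesis by (simp add: euclidean_representation)
qed

lemma real_analytic_at_linear:
  assumes "bounded_linear L"
  shows "real_analytic_at L p"
proof -
  have "real_analytic_at (\<lambda>x. x) p"
    by (rule real_analytic_at_componentwise) (rule real_analytic_at_inner_Basis)
  from real_analytic_at_bounded_linear[OF this assms] show ?thesis .
qed

section \<open>Composition with a power series\<close>

lemma has_sum_imp_norm_summable_real:
  fixes g :: "'a \<Rightarrow> real"
  assumes "(g has_sum y) A"
  shows "(\<lambda>x. norm (g x)) summable_on A"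
  using has_sum_imp_summable[OF assms] by (subst (asm) summable_on_iff_abs_summable_on_real)

text \<open>The power is multiplied out over words instead of multi-indices: every product then
  occurs exactly once and no multinomial coefficients have to be counted.\<close>

lemma has_sum_lists_of_length:
  fixes g :: "'a \<Rightarrow> real"
  assumes "(g has_sum y) J"
  shows "((\<lambda>xs. prod_list (map g xs)) has_sum y ^ n) {xs \<in> lists J. length xs = n}"
proof (induction n)
  case 0
  have "{xs \<in> lists J. length xs = 0} = {[]}" by auto
  then show ?case using has_sum_finite[of "{[]}" "\<lambda>xs. prod_list (map g xs)"] by (simp only:) simp
next
  case (Suc n)
  let ?L = "\<lambda>n. {xs \<in> lists J. length xs = n}"
  have bij: "bij_betw (\<lambda>(a, xs). a # xs) (J \<times> ?L n) (?L (Suc n))"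
    by (rule bij_betw_byWitness[where f' = "\<lambda>xs. (hd xs, tl xs)"]) (auto simp: length_Suc_conv)
  have abs: "(\<lambda>x. norm (g x)) summable_on J" "(\<lambda>xs. norm (prod_list (map g xs))) summable_on ?L n"
    using has_sum_imp_norm_summable_real[OF assms] has_sum_imp_norm_summable_real[OF Suc] by auto
  have "((\<lambda>(a, xs). g a * prod_list (map g xs)) has_sum y * y ^ n) (J \<times> ?L n)"
  proof (rule has_sum_SigmaI)
    show "((\<lambda>xs. case (a, xs) of (a, xs) \<Rightarrow> g a * prod_list (map g xs)) has_sum g a * y ^ n) (?L n)" for a
      using has_sum_cmult_right[OF Suc] by simp
    show "((\<lambda>a. g a * y ^ n) has_sum y * y ^ n) J"
      by (rule has_sum_cmult_left[OF assms])
    show "(\<lambda>(a, xs). g a * prod_list (map g xs)) summable_on J \<times> ?L n"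
    proof (rule Infinite_Sum.abs_summable_summable, subst Infinite_Sum.abs_summable_on_Sigma_iff, intro conjI ballI)
      show "(\<lambda>xs. norm (case (a, xs) of (a, xs) \<Rightarrow> g a * prod_list (map g xs))) summable_on ?L n" for a
        using summable_on_cmult_right[OF abs(2), of "\<bar>g a\<bar>"] by (simp add: abs_mult)
      show "(\<lambda>a. norm (\<Sum>\<^sub>\<infinity>xs\<in>?L n. norm (case (a, xs) of (a, xs) \<Rightarrow> g a * prod_list (map g xs)))) summable_on J"
        using summable_on_cmult_left[OF abs(1)] by (simp add: abs_mult infsum_cmult_right')
    qed
  qed
  then show ?case
    by (subst has_sum_reindex_bij_betw[OF bij, symmetric]) (simp add: case_prod_unfold)
qed

definition power_series_at :: "(real \<Rightarrow> real) \<Rightarrow> real \<Rightarrow> bool" where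
  "power_series_at \<phi> x \<longleftrightarrow> (\<exists>r>0. \<exists>b. \<forall>h. \<bar>h\<bar> < r \<longrightarrow> (\<lambda>n. b n * h ^ n) sums \<phi> (x + h))"

text \<open>Substituting the series of \<open>F\<close> into the series of \<open>\<phi>\<close> gives a family indexed by the finite
  lists of nonzero multi-indices; it is absolutely summable on a small ball and is then regrouped
  according to the sums of the lists.\<close>

lemma real_analytic_at_compose:
  fixes F :: "'a::euclidean_space \<Rightarrow> real"
  assumes "real_analytic_at F p" "power_series_at \<phi> (F p)"
  shows "real_analytic_at (\<lambda>x. \<phi> (F x)) p"
proof -
  obtain r C where r: "r > 0" and C: "\<And>h. norm h < r \<Longrightarrow>
        ((\<lambda>\<alpha>. multi_monomial h \<alpha> * C \<alpha>) has_sum F (p + h)) multi_indices"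
    using assms(1) unfolding real_analytic_at_alt by auto
  obtain r1 b where r1: "r1 > 0" and b: "\<And>h. \<bar>h\<bar> < r1 \<Longrightarrow> (\<lambda>n. b n * h ^ n) sums \<phi> (F p + h)"
    using assms(2) unfolding power_series_at_def by blast
  define I0 :: "'a \<Rightarrow> nat" where "I0 = (\<lambda>i\<in>Basis. 0)"
  define J where "J = multi_indices - {I0}"
  have I0: "I0 \<in> multi_indices" by (simp add: I0_def)
  \<comment> \<open>The extra 1 in the denominator places the diagonal point strictly inside the
    ball of convergence of \<open>F\<close>.\<close>
  define \<rho>0 where "\<rho>0 = r / (1 + norm (One::'a))"
  have \<rho>0: "\<rho>0 > 0" "norm (\<rho>0 *\<^sub>R (One::'a)) < r"
    using r by (auto simp: \<rho>0_def field_simps add_pos_nonneg)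
  define M where "M = (\<Sum>\<^sub>\<infinity>\<alpha>\<in>J. \<bar>C \<alpha>\<bar> * \<rho>0 ^ multi_degree \<alpha>)"
  have sumM: "(\<lambda>\<alpha>. \<bar>C \<alpha>\<bar> * \<rho>0 ^ multi_degree \<alpha>) summable_on J"
  proof -
    have "(\<lambda>\<alpha>. norm (multi_monomial (\<rho>0 *\<^sub>R One) \<alpha> * C \<alpha>)) summable_on multi_indices"
      using C[OF \<rho>0(2)] by (rule has_sum_imp_norm_summable_real)
    then have "(\<lambda>\<alpha>. \<bar>C \<alpha>\<bar> * \<rho>0 ^ multi_degree \<alpha>) summable_on multi_indices"
      using \<rho>0(1) by (simp add: multi_monomial_One abs_mult mult.commute)
    then show ?thesis by (rule summable_on_subset_banach) (auto simp: J_def)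
  qed
  have M0: "M \<ge> 0" unfolding M_def using \<rho>0 by (intro infsum_nonneg) auto
  \<comment> \<open>Indices in \<open>J\<close> have positive degree, so shrinking the radius by
    \<open>t <= 1\<close> shrinks the absolute sum over \<open>J\<close> at least by the factor
    \<open>t\<close>. The choice brings this sum below \<open>r1\<close>, where the series of \<phi>
    converges.\<close>
  define t where "t = min 1 (r1 / (2 * (M + 1)))"
  have t: "0 < t" "t \<le> 1" "t * M < r1"
  proof -
    show "0 < t" "t \<le> 1" using r1 M0 by (auto simp: t_def)
    have "t * M \<le> r1 / (2 * (M + 1)) * M" using M0 by (intro mult_right_mono) (auto simp: t_def)
    also have "\<dots> < r1" using r1 M0 by (simp add: field_simps) (smt (verit) mult_nonneg_nonneg)
    finally show "t * M < r1" .
  qed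
  define \<rho> where "\<rho> = t * \<rho>0"
  have \<rho>: "\<rho> > 0" using t \<rho>0 by (simp add: \<rho>_def)
  have \<rho>r: "\<rho> \<le> r"
  proof -
    have "\<rho> \<le> \<rho>0" using t \<rho>0 by (simp add: \<rho>_def mult_left_le_one_le)
    also have "\<rho>0 \<le> r"
      using r frac_le[of r r 1 "1 + norm (One::'a)"] by (simp add: \<rho>0_def)
    finally show ?thesis .
  qed
  have Fp: "F p = C I0"
  proof -
    have "((\<lambda>\<alpha>. multi_monomial 0 \<alpha> * C \<alpha>) has_sum C I0) multi_indices"
    proof (rule has_sum_finite_neutralI[of "{I0}"])
      show "multi_monomial 0 \<alpha> * C \<alpha> = 0" if "\<alpha> \<in> multi_indices - {I0}" for \<alpha>
        using multi_monomial_0[of \<alpha>] that by (simp add: I0_def)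
      have "multi_monomial 0 I0 = 1" by (simp add: multi_monomial_def I0_def)
      then show "C I0 = (\<Sum>\<alpha>\<in>{I0}. multi_monomial 0 \<alpha> * C \<alpha>)" by simp
    qed (use I0 in auto)
    with C[of 0] r show ?thesis by (auto dest: has_sum_unique)
  qed
  \<comment> \<open>These will be the coefficients of the composite. They do not involve h, because
    the monomials of a word multiply to the monomial of its sum.\<close>
  define K where "K \<beta> = (\<Sum>\<^sub>\<infinity>xs\<in>{xs\<in>lists J. multi_sum xs = \<beta>}. b (length xs) * prod_list (map C xs))" for \<beta>
  have main: "((\<lambda>\<beta>. multi_monomial h \<beta> * K \<beta>) has_sum \<phi> (F (p + h))) multi_indices"
    if h: "norm h < \<rho>" for h
  proof -
    define g where "g = (\<lambda>\<alpha>. multi_monomial h \<alpha> * C \<alpha>)"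
    define y where "y = F (p + h) - F p"
    have gy: "(g has_sum y) J"
    proof -
      have "(g has_sum F (p + h)) multi_indices" using C[of h] h \<rho>r by (simp add: g_def)
      moreover have "g I0 = F p" by (simp add: g_def Fp multi_monomial_def I0_def)
      moreover have "(g has_sum g I0) {I0}" by (rule has_sum_finiteI) auto
      ultimately have "(g has_sum F (p + h) - g I0) (multi_indices - {I0})"
        by (intro has_sum_Diff) (use I0 in auto)
      then show ?thesis using \<open>g I0 = F p\<close> by (simp add: y_def J_def)
    qed
    have gle: "\<bar>g \<alpha>\<bar> \<le> t * (\<bar>C \<alpha>\<bar> * \<rho>0 ^ multi_degree \<alpha>)" if "\<alpha> \<in> J" for \<alpha>
    proof -
      have "multi_degree \<alpha> > 0" using multi_degree_pos that by (auto simp: J_def I0_def)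
      then have "t ^ multi_degree \<alpha> \<le> t ^ 1" using t by (intro power_decreasing) auto
      then have "\<rho> ^ multi_degree \<alpha> \<le> t * \<rho>0 ^ multi_degree \<alpha>"
        using \<rho>0 by (simp add: \<rho>_def power_mult_distrib mult_right_mono)
      moreover have "\<bar>multi_monomial h \<alpha>\<bar> \<le> \<rho> ^ multi_degree \<alpha>"
        using h by (intro abs_multi_monomial_le) auto
      ultimately have "\<bar>multi_monomial h \<alpha>\<bar> * \<bar>C \<alpha>\<bar> \<le> t * \<rho>0 ^ multi_degree \<alpha> * \<bar>C \<alpha>\<bar>"
        by (intro mult_right_mono) auto
      then show ?thesis by (simp add: g_def abs_mult algebra_simps)
    qed
    define s where "s = (\<Sum>\<^sub>\<infinity>\<alpha>\<in>J. \<bar>g \<alpha>\<bar>)"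
    have sg: "(\<lambda>\<alpha>. \<bar>g \<alpha>\<bar>) summable_on J"
      using has_sum_imp_norm_summable_real[OF gy] by simp
    then have sg': "((\<lambda>\<alpha>. \<bar>g \<alpha>\<bar>) has_sum s) J" by (simp add: s_def)
    have "s \<le> (\<Sum>\<^sub>\<infinity>\<alpha>\<in>J. t * (\<bar>C \<alpha>\<bar> * \<rho>0 ^ multi_degree \<alpha>))"
      unfolding s_def by (intro infsum_mono sg summable_on_cmult_right sumM gle)
    also have "\<dots> = t * M" by (simp add: infsum_cmult_right' M_def)
    finally have s: "s < r1" using t by simp
    have s0: "s \<ge> 0" unfolding s_def by (intro infsum_nonneg) auto
    have "\<bar>y\<bar> \<le> s"
      using norm_has_sum_bound[of g J s y] sg' gy by simp
    define L where "L n = {xs \<in> lists J. length xs = n}" for n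
    define G where "G = (\<lambda>xs. b (length xs) * prod_list (map g xs))"
    have sums: "(\<lambda>n. \<bar>b n\<bar> * s ^ n) summable_on UNIV"
    proof -
      have "summable (\<lambda>n. b n * ((s + r1)/2) ^ n)" using b[of "(s + r1)/2"] s s0 by (auto simp: sums_iff)
      from powser_insidea[OF this, of s] have "summable (\<lambda>n. norm (b n * s ^ n))" using s s0 by simp
      then show ?thesis
        by (subst summable_on_UNIV_nonneg_real_iff) (use s0 in \<open>auto simp: abs_mult power_abs\<close>)
    qed
    have Ln: "((\<lambda>xs. \<bar>G xs\<bar>) has_sum \<bar>b n\<bar> * s ^ n) (L n)" for n
    proof -
      have "((\<lambda>xs. \<bar>b n\<bar> * prod_list (map (\<lambda>\<alpha>. \<bar>g \<alpha>\<bar>) xs)) has_sum \<bar>b n\<bar> * s ^ n) (L n)"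
        unfolding L_def by (intro has_sum_cmult_right has_sum_lists_of_length sg')
      also have "?this \<longleftrightarrow> ?thesis"
      proof (rule has_sum_cong)
        fix xs assume "xs \<in> L n"
        have "prod_list (map (\<lambda>\<alpha>. \<bar>g \<alpha>\<bar>) xs) = \<bar>prod_list (map g xs)\<bar>"
          by (induction xs) (auto simp: abs_mult)
        then show "\<bar>b n\<bar> * prod_list (map (\<lambda>\<alpha>. \<bar>g \<alpha>\<bar>) xs) = \<bar>G xs\<bar>"
          using \<open>xs \<in> L n\<close> by (simp add: G_def abs_mult L_def)
      qed
      finally show ?thesis .
    qed
    have Gsum: "(\<lambda>(n, xs). G xs) summable_on (SIGMA n:UNIV. L n)"
    proof (rule Infinite_Sum.abs_summable_summable, subst Infinite_Sum.abs_summable_on_Sigma_iff, intro conjI ballI)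
      show "(\<lambda>xs. norm (case (n, xs) of (n, xs) \<Rightarrow> G xs)) summable_on L n" for n
        using Ln[of n] by (auto simp: summable_on_def)
      have "(\<Sum>\<^sub>\<infinity>xs\<in>L n. \<bar>G xs\<bar>) = \<bar>b n\<bar> * s ^ n" for n
        using Ln by (simp add: infsumI)
      then show "(\<lambda>n. norm (\<Sum>\<^sub>\<infinity>xs\<in>L n. norm (case (n, xs) of (n, xs) \<Rightarrow> G xs))) summable_on UNIV"
        using sums s0 by (simp add: abs_mult power_abs)
    qed
    have Gn: "((\<lambda>xs. G xs) has_sum b n * y ^ n) (L n)" for n
    proof -
      have "((\<lambda>xs. b n * prod_list (map g xs)) has_sum b n * y ^ n) (L n)"
        unfolding L_def by (rule has_sum_cmult_right[OF has_sum_lists_of_length[OF gy]])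
      also have "?this \<longleftrightarrow> ?thesis" by (rule has_sum_cong) (simp add: G_def L_def)
      finally show ?thesis .
    qed
    have "((\<lambda>n. b n * y ^ n) has_sum \<phi> (F (p + h))) UNIV"
    proof (rule norm_summable_imp_has_sum)
      show "(\<lambda>n. b n * y ^ n) sums \<phi> (F (p + h))"
        using b[of y] \<open>\<bar>y\<bar> \<le> s\<close> s by (simp add: y_def)
      have "summable (\<lambda>n. \<bar>b n\<bar> * s ^ n)"
        using sums s0 by (subst (asm) summable_on_UNIV_nonneg_real_iff) auto
      then show "summable (\<lambda>n. norm (b n * y ^ n))"
        by (rule summable_comparison_test'[where N = 0])
          (use \<open>\<bar>y\<bar> \<le> s\<close> in \<open>auto simp: abs_mult power_abs intro!: mult_left_mono power_mono\<close>)
    qed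
    with Gn Gsum have GS: "((\<lambda>(n, xs). G xs) has_sum \<phi> (F (p + h))) (SIGMA n:UNIV. L n)"
      by (intro has_sum_SigmaI[where g = "\<lambda>n. b n * y ^ n"]) auto
    \<comment> \<open>The same absolutely summable family of words is fibred twice: by length, which
      gives the value of the composite, and by sum, which gives its expansion.\<close>
    have bij1: "bij_betw (\<lambda>xs. (length xs, xs)) (lists J) (SIGMA n:UNIV. L n)"
      by (rule bij_betw_byWitness[where f' = snd]) (auto simp: L_def)
    have bij2: "bij_betw (\<lambda>(\<beta>, xs). xs) (SIGMA \<beta>:multi_indices. {xs\<in>lists J. multi_sum xs = \<beta>}) (lists J)"
    proof (rule bij_betw_byWitness[where f' = "\<lambda>xs. (multi_sum xs, xs)"])
      show "(\<lambda>xs. (multi_sum xs, xs)) ` lists J \<subseteq> (SIGMA \<beta>:multi_indices. {xs\<in>lists J. multi_sum xs = \<beta>})"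
        by (intro image_subsetI) simp
    qed auto
    have Glists: "(G has_sum \<phi> (F (p + h))) (lists J)"
      using has_sum_reindex_bij_betw[OF bij1, of "\<lambda>(n, xs). G xs" "\<phi> (F (p + h))"] GS
      by (simp only: prod.case)
    show ?thesis
    proof (rule has_sum_SigmaD)
      show "((\<lambda>(\<beta>, xs). G xs) has_sum \<phi> (F (p + h))) (SIGMA \<beta>:multi_indices. {xs\<in>lists J. multi_sum xs = \<beta>})"
        using has_sum_reindex_bij_betw[OF bij2, of G "\<phi> (F (p + h))"] Glists
        by (simp only: case_prod_unfold)
      fix \<beta> :: "'a \<Rightarrow> nat"
      let ?A = "{xs\<in>lists J. multi_sum xs = \<beta>}"
      have "G summable_on lists J" using Glists by (auto simp: summable_on_def)
      then have "(G has_sum infsum G ?A) ?A"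
        by (intro has_sum_infsum) (rule summable_on_subset_banach, auto)
      moreover have "infsum G ?A = multi_monomial h \<beta> * K \<beta>"
      proof -
        have "infsum G ?A = (\<Sum>\<^sub>\<infinity>xs\<in>?A. multi_monomial h \<beta> * (b (length xs) * prod_list (map C xs)))"
        proof (rule infsum_cong)
          fix xs assume "xs \<in> ?A"
          have "prod_list (map g xs) = multi_monomial h (multi_sum xs) * prod_list (map C xs)"
            unfolding multi_monomial_multi_sum by (induction xs) (auto simp: g_def)
          then show "G xs = multi_monomial h \<beta> * (b (length xs) * prod_list (map C xs))"
            using \<open>xs \<in> ?A\<close> by (simp add: G_def)
        qed
        then show ?thesis by (simp add: infsum_cmult_right' K_def)
      qed
      ultimately show "((\<lambda>xs. case (\<beta>, xs) of (\<beta>, xs) \<Rightarrow> G xs) has_sum multi_monomial h \<beta> * K \<beta>) ?A" by simp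
    qed
  qed
  show ?thesis unfolding real_analytic_at_alt
    using \<rho> main by auto
qed

lemma real_analytic_onI:
  assumes "open U" "A \<subseteq> U" "\<And>x. x \<in> U \<Longrightarrow> real_analytic_at G x" "\<And>x. x \<in> A \<Longrightarrow> G x = F x"
  shows "real_analytic_on F A"
  unfolding real_analytic_on_def
proof
  fix p assume "p \<in> A"
  then show "\<exists>U G. open U \<and> p \<in> U \<and> (\<forall>x\<in>U. real_analytic_at G x) \<and> (\<forall>x\<in>U \<inter> A. G x = F x)"
    using assms by (intro exI[of _ U] exI[of _ G]) auto
qed

lemma analytic_diffeomorphismI:
  assumes "real_analytic_on F A" "real_analytic_on G B"
    and "\<And>x. x \<in> A \<Longrightarrow> F x \<in> B" "\<And>x. x \<in> A \<Longrightarrow> G (F x) = x"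
    and "\<And>y. y \<in> B \<Longrightarrow> G y \<in> A" "\<And>y. y \<in> B \<Longrightarrow> F (G y) = y"
  shows "analytic_diffeomorphism A B F"
proof -
  have bij: "bij_betw F A B" by (rule bij_betw_byWitness[where f' = G]) (use assms in auto)
  have "inv_into A F y = G y" if "y \<in> B" for y
    using assms that bij by (metis bij_betw_def inv_into_f_f)
  then have "real_analytic_on (inv_into A F) B"
    using assms(2) unfolding real_analytic_on_def by fastforce
  with bij assms(1) show ?thesis by (simp add: analytic_diffeomorphism_def)
qed

section \<open>Real-analytic functions of one variable\<close>

text \<open>Real analyticity is expressed by a local holomorphic extension, so that analytic inverses come
  from complex analysis.\<close>

definition analytic_germ :: "(real \<Rightarrow> real) \<Rightarrow> real \<Rightarrow> bool" where
  "analytic_germ \<phi> x \<longleftrightarrow>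
     (\<exists>\<Phi>. \<Phi> analytic_on {complex_of_real x} \<and>
          (\<forall>\<^sub>F y in nhds x. \<Phi> (complex_of_real y) = complex_of_real (\<phi> y)))"

lemma analytic_germI:
  assumes "\<Phi> analytic_on {complex_of_real x}" "\<And>y. \<Phi> (complex_of_real y) = complex_of_real (\<phi> y)"
  shows "analytic_germ \<phi> x"
  unfolding analytic_germ_def using assms by auto

lemma analytic_germ_ident: "analytic_germ (\<lambda>y. y) x"
  by (rule analytic_germI[of "\<lambda>z. z"]) (auto intro: analytic_intros)

lemma analytic_germ_const: "analytic_germ (\<lambda>y. c) x"
  by (rule analytic_germI[of "\<lambda>z. of_real c"]) (auto intro: analytic_intros)

lemma analytic_germ_add:
  assumes "analytic_germ f x" "analytic_germ g x"
  shows "analytic_germ (\<lambda>y. f y + g y) x"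
proof -
  obtain F G where F: "F analytic_on {complex_of_real x}" "\<forall>\<^sub>F y in nhds x. F (complex_of_real y) = complex_of_real (f y)"
    and G: "G analytic_on {complex_of_real x}" "\<forall>\<^sub>F y in nhds x. G (complex_of_real y) = complex_of_real (g y)"
    using assms unfolding analytic_germ_def by blast
  have "(\<lambda>z. F z + G z) analytic_on {complex_of_real x}" using F(1) G(1) by (rule analytic_on_add)
  moreover have "\<forall>\<^sub>F y in nhds x. F (complex_of_real y) + G (complex_of_real y) = complex_of_real (f y + g y)"
    using F(2) G(2) by eventually_elim simp
  ultimately show ?thesis unfolding analytic_germ_def by blast
qed

lemma analytic_germ_mult:
  assumes "analytic_germ f x" "analytic_germ g x"
  shows "analytic_germ (\<lambda>y. f y * g y) x"
proof -
  obtain F G where F: "F analytic_on {complex_of_real x}" "\<forall>\<^sub>F y in nhds x. F (complex_of_real y) = complex_of_real (f y)"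
    and G: "G analytic_on {complex_of_real x}" "\<forall>\<^sub>F y in nhds x. G (complex_of_real y) = complex_of_real (g y)"
    using assms unfolding analytic_germ_def by blast
  have "(\<lambda>z. F z * G z) analytic_on {complex_of_real x}" using F(1) G(1) by (rule analytic_on_mult)
  moreover have "\<forall>\<^sub>F y in nhds x. F (complex_of_real y) * G (complex_of_real y) = complex_of_real (f y * g y)"
    using F(2) G(2) by eventually_elim simp
  ultimately show ?thesis unfolding analytic_germ_def by blast
qed

lemma analytic_germ_power: "analytic_germ f x \<Longrightarrow> analytic_germ (\<lambda>y. f y ^ n) x"
  by (induction n) (auto intro: analytic_germ_const analytic_germ_mult)

lemma analytic_germ_sqrt:
  assumes "x > 0"
  shows "analytic_germ sqrt x"
  unfolding analytic_germ_def
proof (intro exI conjI)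
  have "complex_of_real x \<notin> \<real>\<^sub>\<le>\<^sub>0" using assms by simp
  then show "csqrt analytic_on {complex_of_real x}"
    by (intro analytic_on_csqrt analytic_intros) auto
  show "\<forall>\<^sub>F y in nhds x. csqrt (complex_of_real y) = complex_of_real (sqrt y)"
    using eventually_nhds_in_open[of "{0<..}" x] assms
    by (auto elim!: eventually_mono)
qed

text \<open>An extension restricted to the real axis has its complex derivative as real derivative.
  The third part carries a nonzero real derivative over to the extension, as the holomorphic inverse
  function theorem requires.\<close>

lemma analytic_germ_imp_continuous_differentiable:
  assumes "analytic_germ \<phi> x"
  shows "\<exists>d. DERIV \<phi> x :> d" and "isCont \<phi> x"
    and "\<And>\<Phi> d. \<Phi> analytic_on {complex_of_real x} \<Longrightarrow>
       (\<forall>\<^sub>F y in nhds x. \<Phi> (complex_of_real y) = complex_of_real (\<phi> y)) \<Longrightarrow>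
       DERIV \<phi> x :> d \<Longrightarrow> deriv \<Phi> (complex_of_real x) = complex_of_real d"
proof -
  have vec: "((\<lambda>y. complex_of_real (\<phi> y)) has_vector_derivative deriv \<Phi> (complex_of_real x)) (at x)"
    if "\<Phi> analytic_on {complex_of_real x}" "\<forall>\<^sub>F y in nhds x. \<Phi> (complex_of_real y) = complex_of_real (\<phi> y)" for \<Phi>
  proof -
    have "(\<Phi> has_field_derivative deriv \<Phi> (complex_of_real x)) (at (complex_of_real x))"
      using that(1) analytic_on_imp_differentiable_at field_differentiable_derivI by blast
    then have "((\<lambda>y. \<Phi> (complex_of_real y)) has_vector_derivative deriv \<Phi> (complex_of_real x)) (at x)"
      by (rule has_vector_derivative_real_field)
    moreover have "\<forall>\<^sub>F y in at x. \<Phi> (complex_of_real y) = complex_of_real (\<phi> y)"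
      using that(2) by (simp add: eventually_at_filter eventually_mono)
    moreover have "\<Phi> (complex_of_real x) = complex_of_real (\<phi> x)"
      using that(2) by (rule eventually_nhds_x_imp_x)
    ultimately show ?thesis
      unfolding has_vector_derivative_def
      by (rule has_derivative_transform_eventually) simp
  qed
  obtain \<Phi> where \<Phi>: "\<Phi> analytic_on {complex_of_real x}" "\<forall>\<^sub>F y in nhds x. \<Phi> (complex_of_real y) = complex_of_real (\<phi> y)"
    using assms unfolding analytic_germ_def by blast
  have "((\<lambda>y. Re (complex_of_real (\<phi> y))) has_vector_derivative Re (deriv \<Phi> (complex_of_real x))) (at x)"
    by (rule bounded_linear.has_vector_derivative[OF bounded_linear_Re vec[OF \<Phi>]])
  then show 1: "\<exists>d. DERIV \<phi> x :> d"
    by (auto simp: has_real_derivative_iff_has_vector_derivative)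
  then show "isCont \<phi> x" using DERIV_isCont by blast
  show "deriv \<Phi> (complex_of_real x) = complex_of_real d"
    if "\<Phi> analytic_on {complex_of_real x}" "\<forall>\<^sub>F y in nhds x. \<Phi> (complex_of_real y) = complex_of_real (\<phi> y)"
      "DERIV \<phi> x :> d" for \<Phi> d
  proof -
    have "((\<lambda>y. complex_of_real (\<phi> y)) has_vector_derivative complex_of_real d) (at x)"
      using that(3) by (intro has_vector_derivative_of_real)
        (simp add: has_real_derivative_iff_has_vector_derivative)
    with vec[OF that(1,2)] show ?thesis by (rule vector_derivative_unique_at)
  qed
qed

lemma analytic_germ_compose:
  assumes "analytic_germ f x" "analytic_germ g (f x)"
  shows "analytic_germ (\<lambda>y. g (f y)) x"
proof -
  obtain F G where F: "F analytic_on {complex_of_real x}" "\<forall>\<^sub>F y in nhds x. F (complex_of_real y) = complex_of_real (f y)"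
    and G: "G analytic_on {complex_of_real (f x)}" "\<forall>\<^sub>F y in nhds (f x). G (complex_of_real y) = complex_of_real (g y)"
    using assms unfolding analytic_germ_def by blast
  have "F (complex_of_real x) = complex_of_real (f x)"
    using F(2) by (rule eventually_nhds_x_imp_x)
  then have "(G \<circ> F) analytic_on {complex_of_real x}"
    by (intro analytic_on_compose F) (use G in auto)
  moreover have "filterlim f (nhds (f x)) (nhds x)"
    using analytic_germ_imp_continuous_differentiable(2)[OF assms(1)]
    by (simp add: isCont_def tendsto_at_iff_tendsto_nhds)
  then have "\<forall>\<^sub>F y in nhds x. G (complex_of_real (f y)) = complex_of_real (g (f y))"
    by (rule eventually_compose_filterlim[OF G(2)])
  then have "\<forall>\<^sub>F y in nhds x. (G \<circ> F) (complex_of_real y) = complex_of_real (g (f y))"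
    using F(2) by eventually_elim simp
  ultimately show ?thesis unfolding analytic_germ_def by blast
qed

text \<open>Real coefficients arise by taking real parts, term by term, in the Taylor series of the
  extension at a real increment.\<close>

lemma analytic_germ_imp_power_series_at:
  assumes "analytic_germ \<phi> x"
  shows "power_series_at \<phi> x"
proof -
  obtain \<Phi> where \<Phi>: "\<Phi> analytic_on {complex_of_real x}" "\<forall>\<^sub>F y in nhds x. \<Phi> (complex_of_real y) = complex_of_real (\<phi> y)"
    using assms unfolding analytic_germ_def by blast
  obtain e where e: "e > 0" "\<Phi> holomorphic_on ball (complex_of_real x) e"
    using \<Phi>(1) unfolding analytic_on_def by blast
  obtain d where d: "d > 0" "\<And>y. dist y x < d \<Longrightarrow> \<Phi> (complex_of_real y) = complex_of_real (\<phi> y)"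
    using \<Phi>(2) unfolding eventually_nhds_metric by blast
  define c where "c n = (deriv ^^ n) \<Phi> (complex_of_real x) / fact n" for n
  have "(\<lambda>n. Re (c n) * h ^ n) sums \<phi> (x + h)" if "\<bar>h\<bar> < min d e" for h
  proof -
    have "complex_of_real (x + h) \<in> ball (complex_of_real x) e"
      using that by (simp add: dist_norm)
    from holomorphic_power_series[OF e(2) this]
    have "(\<lambda>n. c n * of_real (h ^ n)) sums \<Phi> (complex_of_real (x + h))"
      by (simp add: c_def)
    also have "\<Phi> (complex_of_real (x + h)) = complex_of_real (\<phi> (x + h))"
      using that by (intro d) (simp add: dist_norm)
    finally have "(\<lambda>n. Re (c n * of_real (h ^ n))) sums Re (complex_of_real (\<phi> (x + h)))"
      by (rule sums_Re)
    then show ?thesis by simp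
  qed
  moreover have "min d e > 0" using d e by simp
  ultimately show ?thesis unfolding power_series_at_def
    by (intro exI[of _ "min d e"] conjI exI[of _ "\<lambda>n. Re (c n)"]) auto
qed

lemma real_analytic_at_germ_compose:
  assumes "real_analytic_at F p" "analytic_germ \<phi> (F p)"
  shows "real_analytic_at (\<lambda>x. \<phi> (F x)) p"
  by (rule real_analytic_at_compose[OF assms(1) analytic_germ_imp_power_series_at[OF assms(2)]])

lemma real_analytic_at_power:
  fixes F :: "'a::euclidean_space \<Rightarrow> real"
  assumes "real_analytic_at F p"
  shows "real_analytic_at (\<lambda>x. F x ^ n) p"
  using real_analytic_at_germ_compose[OF assms analytic_germ_power[OF analytic_germ_ident]] .

section \<open>Analytic inverse functions\<close>

text \<open>By continuity \<kappa> stays near w, inside the disc on which the extension is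
  injective; there the holomorphic local inverse must agree with \<kappa>.\<close>

lemma analytic_germ_inverse:
  assumes "analytic_germ \<phi> w" "DERIV \<phi> w :> d" "d \<noteq> 0"
    and "isCont \<kappa> (\<phi> w)" "\<kappa> (\<phi> w) = w" "\<And>z. \<phi> (\<kappa> z) = z"
  shows "analytic_germ \<kappa> (\<phi> w)"
proof -
  obtain \<Phi> where \<Phi>: "\<Phi> analytic_on {complex_of_real w}" "\<forall>\<^sub>F y in nhds w. \<Phi> (complex_of_real y) = complex_of_real (\<phi> y)"
    using assms unfolding analytic_germ_def by blast
  have "deriv \<Phi> (complex_of_real w) = complex_of_real d"
    by (rule analytic_germ_imp_continuous_differentiable(3)[OF assms(1) \<Phi> assms(2)])
  then have nz: "deriv \<Phi> (complex_of_real w) \<noteq> 0" using assms(3) by simp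
  obtain e where e: "e > 0" "\<Phi> holomorphic_on ball (complex_of_real w) e"
    using \<Phi>(1) unfolding analytic_on_def by blast
  obtain r where r: "r > 0" "ball (complex_of_real w) r \<subseteq> ball (complex_of_real w) e"
      "inj_on \<Phi> (ball (complex_of_real w) r)"
    using has_complex_derivative_locally_injective[OF e(2) _ _ nz] e(1) by auto
  define B where "B = ball (complex_of_real w) r"
  have hol: "\<Phi> holomorphic_on B" using e r unfolding B_def by (blast intro: holomorphic_on_subset)
  have B: "open B" "inj_on \<Phi> B" using r(3) by (auto simp: B_def)
  from holomorphic_has_inverse[OF hol B]
  obtain \<Psi> where \<Psi>: "\<Psi> holomorphic_on (\<Phi> ` B)" "\<And>z. z \<in> B \<Longrightarrow> \<Psi> (\<Phi> z) = z"
    by metis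
  have "open (\<Phi> ` B)" by (rule open_mapping_thm3[OF hol B])
  moreover have "\<Phi> (complex_of_real w) = complex_of_real (\<phi> w)"
    using \<Phi>(2) by (rule eventually_nhds_x_imp_x)
  moreover have "complex_of_real w \<in> B" using r by (simp add: B_def)
  ultimately have "\<Psi> analytic_on {complex_of_real (\<phi> w)}"
    using \<Psi>(1) by (metis analytic_on_open analytic_on_subset empty_subsetI image_eqI insert_subset)
  moreover have "\<forall>\<^sub>F z in nhds (\<phi> w). \<Psi> (complex_of_real z) = complex_of_real (\<kappa> z)"
  proof -
    have "\<forall>\<^sub>F y in nhds w. complex_of_real y \<in> B"
      unfolding eventually_nhds_metric B_def using r(1) by (auto intro!: exI[of _ r] simp: dist_commute)
    with \<Phi>(2) have "\<forall>\<^sub>F y in nhds w. \<Psi> (complex_of_real (\<phi> y)) = complex_of_real y"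
      by eventually_elim (metis \<Psi>(2))
    moreover have "filterlim \<kappa> (nhds w) (nhds (\<phi> w))"
      using assms(4,5) unfolding isCont_def tendsto_at_iff_tendsto_nhds by simp
    ultimately have "\<forall>\<^sub>F z in nhds (\<phi> w). \<Psi> (complex_of_real (\<phi> (\<kappa> z))) = complex_of_real (\<kappa> z)"
      by (auto simp: filterlim_iff)
    then show ?thesis by (simp add: assms(6))
  qed
  ultimately show ?thesis unfolding analytic_germ_def by blast
qed

text \<open>Uniform expansion serves four purposes: injectivity, surjectivity through the
  intermediate value theorem, a Lipschitz and hence continuous inverse, and a derivative bounded
  below by \<open>c > 0\<close>.\<close>

lemma expanding_analytic_inverse:
  assumes germ: "\<And>x. analytic_germ \<phi> x" and c: "c > 0"
    and expanding: "\<And>x y. x \<le> y \<Longrightarrow> c * (y - x) \<le> \<phi> y - \<phi> x"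
  shows "bij \<phi>" and "analytic_germ (inv \<phi>) z"
proof -
  have cont: "isCont \<phi> x" for x
    by (rule analytic_germ_imp_continuous_differentiable(2)[OF germ])
  have le: "c * \<bar>y - x\<bar> \<le> \<bar>\<phi> y - \<phi> x\<bar>" for x y
    using expanding[of x y] expanding[of y x] by (cases "x \<le> y") (auto simp: abs_if)
  have inj: "inj \<phi>"
  proof (rule injI)
    fix x y assume "\<phi> x = \<phi> y"
    then show "x = y" using le[of y x] c by (simp add: mult_le_0_iff)
  qed
  have surj: "surj \<phi>"
    unfolding surj_def
  proof
    fix z
    \<comment> \<open>By expansion from 0, \<phi> has left the interval between -|z| and |z| at the
      points \<open>-a\<close> and \<open>a\<close>.\<close>
    define a where "a = (\<bar>z\<bar> + \<bar>\<phi> 0\<bar>) / c"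
    have a: "a \<ge> 0" "c * a = \<bar>z\<bar> + \<bar>\<phi> 0\<bar>" using c by (auto simp: a_def)
    have "\<phi> (- a) \<le> z" "z \<le> \<phi> a"
      using expanding[of 0 a] expanding[of "-a" 0] a by auto
    then show "\<exists>x. z = \<phi> x"
      using IVT[of \<phi> "-a" z a] cont a by auto
  qed
  show bij: "bij \<phi>" using inj surj by (simp add: bij_def)
  have inv: "\<phi> (inv \<phi> z) = z" for z using surj by (rule surj_f_inv_f)
  have "(1 / c)-lipschitz_on UNIV (inv \<phi>)"
  proof (rule lipschitz_onI)
    show "dist (inv \<phi> x) (inv \<phi> y) \<le> 1 / c * dist x y" for x y
      using le[of "inv \<phi> x" "inv \<phi> y"] c by (simp add: inv dist_real_def field_simps)
  qed (use c in auto)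
  then have cinv: "isCont (inv \<phi>) z" for z
    using lipschitz_on_continuous_on continuous_on_eq_continuous_at by blast
  obtain d where d: "DERIV \<phi> (inv \<phi> z) :> d"
    using analytic_germ_imp_continuous_differentiable(1)[OF germ] by blast
  have "d \<ge> c"
  proof -
    have "((\<lambda>h. (\<phi> (inv \<phi> z + h) - \<phi> (inv \<phi> z)) / h) \<longlongrightarrow> d) (at_right 0)"
      using d unfolding DERIV_def by (rule tendsto_mono[OF at_le, rotated]) simp
    moreover have "\<forall>\<^sub>F h in at_right 0. c \<le> (\<phi> (inv \<phi> z + h) - \<phi> (inv \<phi> z)) / h"
      using eventually_at_right_less[of 0]
    proof eventually_elim
      case (elim h)
      then show ?case using expanding[of "inv \<phi> z" "inv \<phi> z + h"] by (simp add: pos_le_divide_eq)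
    qed
    ultimately show ?thesis by (rule tendsto_lowerbound) simp
  qed
  then have "analytic_germ (inv \<phi>) (\<phi> (inv \<phi> z))"
    using c by (intro analytic_germ_inverse[OF germ d]) (auto simp: inv cinv)
  then show "analytic_germ (inv \<phi>) z" by (simp add: inv)
qed

text \<open>Absolute convergence at the real point \<open>norm z\<close> gives convergence at the
  complex point z, so the same series is an entire extension.\<close>

lemma analytic_germ_power_series:
  fixes c :: "nat \<Rightarrow> real"
  assumes "\<And>x::real. summable (\<lambda>n. norm (c n * x ^ n))"
  shows "analytic_germ (\<lambda>x. \<Sum>n. c n * x ^ n) x"
proof (rule analytic_germI)
  have *: "summable (\<lambda>n. complex_of_real (c n) * z ^ n)" for z
    using assms[of "norm z"]
    by - (rule summable_norm_cancel, simp add: norm_mult norm_power abs_mult)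
  have "(\<lambda>z. \<Sum>n. complex_of_real (c n) * z ^ n) holomorphic_on UNIV"
    using termdiffs_strong_converges_everywhere[OF *]
    by (auto simp: holomorphic_on_def field_differentiable_def)
  then show "(\<lambda>z. \<Sum>n. complex_of_real (c n) * z ^ n) analytic_on {complex_of_real x}"
    by (metis analytic_on_open analytic_on_subset open_UNIV subset_UNIV)
  show "(\<Sum>n. complex_of_real (c n) * complex_of_real y ^ n) = complex_of_real (\<Sum>n. c n * y ^ n)" for y
    using suminf_of_real[OF summable_norm_cancel[OF assms[of y]], where 'a = complex] by simp
qed

section \<open>The profile function\<close>

text \<open>\<open>sinh_tail k x\<close> is \<open>sinh x\<close> minus its Taylor polynomial of degree less than \<open>k\<close>, divided
  by \<open>x ^ k\<close>, with the singularity at \<open>0\<close> removed.\<close>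

definition sinh_coeff :: "nat \<Rightarrow> real" where
  "sinh_coeff n = (if odd n then 1 / fact n else 0)"

definition sinh_tail :: "nat \<Rightarrow> real \<Rightarrow> real" where
  "sinh_tail k x = (\<Sum>n. sinh_coeff (n + k) * x ^ n)"

lemma sinh_coeff_nonneg: "sinh_coeff n \<ge> 0"
  by (simp add: sinh_coeff_def)

lemma summable_norm_sinh_tail: "summable (\<lambda>n. norm (sinh_coeff (n + k) * x ^ n))"
proof (rule summable_comparison_test'[where N = 0])
  show "summable (\<lambda>n. inverse (fact n) * \<bar>x\<bar> ^ n)" by (rule summable_exp)
  fix n
  have "sinh_coeff (n + k) \<le> inverse (fact n)"
    by (auto simp: sinh_coeff_def field_simps fact_mono)
  then show "norm (norm (sinh_coeff (n + k) * x ^ n)) \<le> inverse (fact n) * \<bar>x\<bar> ^ n"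
    using sinh_coeff_nonneg by (simp add: abs_mult power_abs mult_right_mono)
qed

lemma summable_sinh_tail: "summable (\<lambda>n. sinh_coeff (n + k) * x ^ n)"
  by (rule summable_norm_cancel[OF summable_norm_sinh_tail])

lemma analytic_germ_sinh_tail: "analytic_germ (sinh_tail k) x"
  using analytic_germ_power_series[OF summable_norm_sinh_tail, of k x]
  by (simp add: sinh_tail_def[abs_def])

lemma isCont_sinh_tail: "isCont (sinh_tail k) x"
  by (rule analytic_germ_imp_continuous_differentiable(2)[OF analytic_germ_sinh_tail])

lemma sinh_tail_0: "sinh_tail 0 x = sinh x"
proof -
  have "(\<lambda>n. sinh_coeff (n + 0) * x ^ n) = (\<lambda>n. if even n then 0 else x ^ n /\<^sub>R fact n)"
    by (auto simp: sinh_coeff_def divide_simps)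
  then show ?thesis using sinh_converges[of x] by (simp add: sinh_tail_def sums_iff)
qed

lemma sinh_tail_rec: "sinh_tail k x = sinh_coeff k + x * sinh_tail (Suc k) x"
  using powser_split_head(1)[OF summable_sinh_tail[of k x]]
  by (simp add: sinh_tail_def mult.commute)

lemma sinh_coeff_numerals:
  "sinh_coeff 0 = 0" "sinh_coeff (Suc 0) = 1" "sinh_coeff 1 = 1" "sinh_coeff 2 = 0"
  "sinh_coeff 3 = 1 / 6" "sinh_coeff 4 = 0"
  by (auto simp: sinh_coeff_def fact_numeral)

lemma sinh_tail_1: "sinh_tail 1 x = 1 + x\<^sup>2 * sinh_tail 3 x"
proof -
  have "sinh_tail 1 x = sinh_coeff 1 + x * sinh_tail 2 x" "sinh_tail 2 x = sinh_coeff 2 + x * sinh_tail 3 x"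
    using sinh_tail_rec[of 1 x] sinh_tail_rec[of 2 x] by (simp_all add: numeral_2_eq_2 numeral_3_eq_3)
  then show ?thesis unfolding sinh_coeff_numerals by (simp add: power2_eq_square)
qed

lemma sinh_tail_3: "sinh_tail 3 x = 1 / 6 + x\<^sup>2 * sinh_tail 5 x"
proof -
  have "sinh_tail 3 x = sinh_coeff 3 + x * sinh_tail 4 x" "sinh_tail 4 x = sinh_coeff 4 + x * sinh_tail 5 x"
    using sinh_tail_rec[of 3 x] sinh_tail_rec[of 4 x] by (simp_all add: eval_nat_numeral)
  then show ?thesis unfolding sinh_coeff_numerals by (simp add: power2_eq_square)
qed

lemma sinh_conv_tail: "sinh x = x * sinh_tail 1 x"
  using sinh_tail_rec[of 0 x] by (simp add: sinh_tail_0 sinh_coeff_numerals)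

lemma sinh_tail_at_0 [simp]: "sinh_tail 1 0 = 1" "sinh_tail (Suc 0) 0 = 1" "sinh_tail 3 0 = 1 / 6"
  using sinh_tail_1[of 0] sinh_tail_3[of 0] by simp_all

lemma sinh_tail_even:
  assumes "odd k"
  shows "sinh_tail k (- x) = sinh_tail k x"
  unfolding sinh_tail_def
  by (rule suminf_cong) (use assms in \<open>auto simp: sinh_coeff_def\<close>)

lemma sinh_tail_mono:
  assumes "0 \<le> x" "x \<le> y"
  shows "sinh_tail k x \<le> sinh_tail k y"
  unfolding sinh_tail_def
  by (intro suminf_le summable_sinh_tail mult_left_mono power_mono assms sinh_coeff_nonneg)

text \<open>For odd k only even powers occur, with nonnegative coefficients, so the minimum is the
  value at 0.\<close>

lemma sinh_tail_ge:
  assumes "odd k"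
  shows "sinh_coeff k \<le> sinh_tail k x"
proof -
  have "sinh_tail k 0 \<le> sinh_tail k \<bar>x\<bar>" by (rule sinh_tail_mono) auto
  moreover have "sinh_tail k \<bar>x\<bar> = sinh_tail k x"
    using sinh_tail_even[OF assms, of x] by (cases "x \<ge> 0") auto
  ultimately show ?thesis using sinh_tail_rec[of k 0] by simp
qed

lemma sinh_tail_1_ge: "sinh_tail 1 x \<ge> 1"
  using sinh_tail_ge[of 1 x] by (simp add: sinh_coeff_numerals)

lemma sinh_tail_3_ge: "sinh_tail 3 x \<ge> 1 / 6"
  using sinh_tail_ge[of 3 x] by (simp add: sinh_coeff_numerals)

section \<open>The function a in half the parameter, and its inverse\<close>

text \<open>This is a(2 w), written so that no case distinction at 0 remains; its inverse is
  \<open>k_fun\<close> itself.\<close>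

definition alpha :: "real \<Rightarrow> real" where
  "alpha w = w * sinh_tail 3 (2 * w)"

lemma alpha_0 [simp]: "alpha 0 = 0"
  by (simp add: alpha_def)

lemma alpha_minus: "alpha (- w) = - alpha w"
  using sinh_tail_even[of 3 "2 * w"] by (simp add: alpha_def)

lemma analytic_germ_alpha: "analytic_germ alpha w"
proof -
  have "analytic_germ (\<lambda>w. 2 * w) w"
    by (intro analytic_germ_mult analytic_germ_const analytic_germ_ident)
  from analytic_germ_compose[OF this analytic_germ_sinh_tail]
  have "analytic_germ (\<lambda>w. w * sinh_tail 3 (2 * w)) w"
    by (intro analytic_germ_mult analytic_germ_ident)
  then show ?thesis by (simp add: alpha_def[abs_def])
qed

text \<open>The power series is odd with nonnegative coefficients, so each term is nondecreasing.
  Only the linear term is kept; its coefficient 1/6 is that of the cube in the series of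
  sinh.\<close>

lemma alpha_expanding:
  assumes "x \<le> y"
  shows "1 / 6 * (y - x) \<le> alpha y - alpha x"
proof -
  define d where "d n = sinh_coeff (n + 3) * 2 ^ n" for n
  have sums: "(\<lambda>n. d n * w ^ Suc n) sums alpha w" for w
  proof -
    have "(\<lambda>n. sinh_coeff (n + 3) * (2 * w) ^ n) sums sinh_tail 3 (2 * w)"
      unfolding sinh_tail_def by (rule summable_sums[OF summable_sinh_tail])
    from sums_mult[OF this, of w] show ?thesis
      by (simp add: alpha_def d_def power_mult_distrib algebra_simps)
  qed
  have diff: "(\<lambda>n. d n * y ^ Suc n - d n * x ^ Suc n) sums (alpha y - alpha x)"
    by (intro sums_diff sums)
  have "0 \<le> d n * y ^ Suc n - d n * x ^ Suc n" for n
  proof (cases "even n")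
    case True
    then have "x ^ Suc n \<le> y ^ Suc n" using assms by (intro power_mono_odd) auto
    then show ?thesis
      using sinh_coeff_nonneg[of "n + 3"] mult_left_mono[of "x ^ Suc n" "y ^ Suc n" "d n"] by (simp add: d_def)
  next
    case False
    then show ?thesis by (simp add: d_def sinh_coeff_def)
  qed
  then have "(\<Sum>n<1. d n * y ^ Suc n - d n * x ^ Suc n) \<le> alpha y - alpha x"
    using sum_le_suminf[OF sums_summable[OF diff], of "{..<1}"] sums_unique[OF diff] by auto
  then show ?thesis by (simp add: d_def sinh_coeff_numerals)
qed

lemma alpha_less_iff: "alpha x < alpha y \<longleftrightarrow> x < y"
proof (cases "x < y")
  case True
  then show ?thesis using alpha_expanding[of x y] by simp
next
  case False
  then show ?thesis using alpha_expanding[of y x] by simp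
qed

lemma alpha_eq: "w \<noteq> 0 \<Longrightarrow> alpha w = (sinh w * cosh w - w) / (4 * w\<^sup>2)"
proof -
  assume w: "w \<noteq> 0"
  have "2 * sinh w * cosh w = 2 * w * (1 + (2 * w)\<^sup>2 * sinh_tail 3 (2 * w))"
    by (metis sinh_double sinh_conv_tail sinh_tail_1)
  then have "2 * sinh w * cosh w = 2 * w + 8 * w\<^sup>2 * alpha w"
    by (simp add: alpha_def power2_eq_square algebra_simps)
  then show ?thesis using w by (simp add: field_simps)
qed

lemma a_fun_eq_alpha: "a_fun c = alpha (c / 2)"
proof (cases "c = 0")
  case False
  have "sinh c = 2 * sinh (c / 2) * cosh (c / 2)" using sinh_double[of "c / 2"] by simp
  then show ?thesis using False alpha_eq[of "c / 2"] by (simp add: a_fun_def field_simps power2_eq_square)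
qed (simp add: a_fun_def)

lemma bij_alpha: "bij alpha"
  by (rule expanding_analytic_inverse(1)[OF analytic_germ_alpha _ alpha_expanding]) simp

lemma k_fun_eq: "k_fun z = inv alpha z"
proof -
  have "inj a_fun"
    using bij_alpha unfolding a_fun_eq_alpha[abs_def] bij_def inj_def by fastforce
  moreover have "a_fun (2 * inv alpha z) = z"
    using bij_alpha by (simp add: a_fun_eq_alpha bij_is_surj surj_f_inv_f)
  ultimately have "inv a_fun z = 2 * inv alpha z" by (rule inv_f_eq)
  then show ?thesis by (simp add: k_fun_def b_fun_def)
qed

lemma alpha_k_fun [simp]: "alpha (k_fun z) = z"
  using bij_alpha by (simp add: k_fun_eq bij_is_surj surj_f_inv_f)

lemma k_fun_alpha [simp]: "k_fun (alpha w) = w"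
  using bij_alpha by (simp add: k_fun_eq bij_is_inj)

lemma analytic_germ_k_fun: "analytic_germ k_fun z"
  using expanding_analytic_inverse(2)[OF analytic_germ_alpha _ alpha_expanding, of z]
  by (simp add: k_fun_eq[abs_def])

lemma k_fun_minus: "k_fun (- z) = - k_fun z"
  by (metis alpha_k_fun alpha_minus k_fun_alpha)

lemma k_fun_less_iff: "k_fun x < k_fun y \<longleftrightarrow> x < y"
  using alpha_less_iff[of "k_fun x" "k_fun y"] by simp

lemma k_fun_0 [simp]: "k_fun 0 = 0"
  using k_fun_alpha[of 0] by simp

lemma f_fun_eq: "f_fun z = (sinh_tail 1 (k_fun z))\<^sup>2"
  using sinh_conv_tail[of "k_fun z"] by (auto simp: f_fun_def e_fun_def power_mult_distrib)

lemma analytic_germ_f_fun: "analytic_germ f_fun z"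
proof -
  have "analytic_germ (\<lambda>z. (sinh_tail 1 (k_fun z))\<^sup>2) z"
    by (intro analytic_germ_power analytic_germ_compose[OF analytic_germ_k_fun analytic_germ_sinh_tail])
  then show ?thesis by (simp add: f_fun_eq[abs_def])
qed

lemma isCont_f_fun: "isCont f_fun z"
  by (rule analytic_germ_imp_continuous_differentiable(2)[OF analytic_germ_f_fun])

lemma f_fun_0 [simp]: "f_fun 0 = 1"
  by (simp add: f_fun_eq)

lemma f_fun_minus: "f_fun (- z) = f_fun z"
  using sinh_tail_even[of 1 "k_fun z"] by (simp add: f_fun_eq k_fun_minus)

lemma f_fun_ge_1: "f_fun z \<ge> 1"
  using sinh_tail_1_ge[of "k_fun z"] by (simp add: f_fun_eq)

section \<open>The profile as an envelope of its tangent lines\<close>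

definition tanhc :: "real \<Rightarrow> real" where
  "tanhc w = (if w = 0 then 1 else tanh w / w)"

lemma tanhc_eq: "tanhc w = sinh_tail 1 w / cosh w"
  using sinh_conv_tail[of w] by (auto simp: tanhc_def tanh_def)

lemma tanhc_pos: "tanhc w > 0"
  using sinh_tail_1_ge[of w] cosh_real_pos[of w] by (simp add: tanhc_eq)

lemma tanhc_minus: "tanhc (- w) = tanhc w"
  by (simp add: tanhc_def)

lemma isCont_tanhc: "isCont tanhc w"
  unfolding tanhc_eq[abs_def] by (intro continuous_intros isCont_sinh_tail) (simp add: cosh_real_nonzero)

text \<open>The affine functions \<open>z \<mapsto> profile_line z w\<close> turn out to be the tangent lines of \<open>f_fun\<close>,
  the one of parameter \<open>w\<close> touching the graph at \<open>k_fun z = w\<close>.\<close>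

definition profile_line :: "real \<Rightarrow> real \<Rightarrow> real" where
  "profile_line z w = 4 * z * tanh w + tanhc w"

lemma profile_line_touches: "profile_line z (k_fun z) = f_fun z"
proof (cases "k_fun z = 0")
  case True
  then show ?thesis by (simp add: profile_line_def tanhc_def f_fun_eq)
next
  case False
  define w where "w = k_fun z"
  have w: "w \<noteq> 0" using False by (simp add: w_def)
  have z: "z = (sinh w * cosh w - w) / (4 * w\<^sup>2)" using alpha_eq[OF w] by (simp add: w_def)
  have "4 * z * tanh w + tanh w / w = (sinh w)\<^sup>2 / w\<^sup>2"
    unfolding z tanh_def using w cosh_real_pos[of w]
    by (simp add: field_simps power2_eq_square)
  moreover have "f_fun z = (sinh w)\<^sup>2 / w\<^sup>2"
    using w by (simp add: f_fun_def e_fun_def w_def)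
  ultimately show ?thesis using w by (simp add: profile_line_def tanhc_def w_def[symmetric])
qed

lemma one_minus_tanh_square: "1 - (tanh w)\<^sup>2 = 1 / (cosh w)\<^sup>2" for w :: real
proof -
  have "1 - (tanh w)\<^sup>2 = ((cosh w)\<^sup>2 - (sinh w)\<^sup>2) / (cosh w)\<^sup>2"
    using cosh_real_nonzero[of w] by (simp add: tanh_def power_divide diff_divide_distrib)
  then show ?thesis by (simp add: cosh_square_eq)
qed

text \<open>The factor \<open>z - alpha w\<close> changes sign once, at \<open>w = k_fun z\<close>,
  which makes this the only maximum in w. The quotient tanh w / w restricts the computation to
  nonzero w.\<close>

lemma profile_line_deriv:
  assumes "w \<noteq> 0"
  shows "(profile_line z has_real_derivative 4 * (1 - (tanh w)\<^sup>2) * (z - alpha w)) (at w)"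
proof -
  have ch: "cosh w \<noteq> 0" by (simp add: cosh_real_nonzero)
  have "((\<lambda>w. 4 * z * tanh w + tanh w / w) has_real_derivative
      4 * z * (1 - (tanh w)\<^sup>2) + ((1 - (tanh w)\<^sup>2) * w - tanh w) / (w * w)) (at w)"
    using assms ch by (auto intro!: derivative_eq_intros)
  moreover have "4 * z * (1 - (tanh w)\<^sup>2) + ((1 - (tanh w)\<^sup>2) * w - tanh w) / (w * w)
     = 4 * (1 - (tanh w)\<^sup>2) * (z - alpha w)"
  proof -
    note one_minus_tanh_square[of w]
    moreover have "4 * alpha w * w\<^sup>2 = sinh w * cosh w - w" using assms by (simp add: alpha_eq)
    moreover have "tanh w * (cosh w)\<^sup>2 = sinh w * cosh w" using ch by (simp add: tanh_def power2_eq_square)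
    ultimately show ?thesis
      using assms ch by (simp add: field_simps power2_eq_square) algebra
  qed
  ultimately have "((\<lambda>w. 4 * z * tanh w + tanh w / w) has_real_derivative
      4 * (1 - (tanh w)\<^sup>2) * (z - alpha w)) (at w)" by simp
  moreover have "\<forall>\<^sub>F v in nhds w. v \<noteq> 0"
    using assms t1_space_nhds by blast
  then have "\<forall>\<^sub>F v in nhds w. 4 * z * tanh v + tanh v / v = profile_line z v"
    by eventually_elim (simp add: profile_line_def tanhc_def)
  ultimately show ?thesis by (subst DERIV_cong_ev[OF refl _ refl, symmetric])
qed

lemma profile_line_minus: "profile_line (- z) (- w) = profile_line z w"
  by (simp add: profile_line_def tanhc_minus)

text \<open>The derivative formula fails to cover w = 0, hence the condition on the open interval;
  an interval across 0 is cut there, and continuity at the endpoints joins the pieces.\<close>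

lemma profile_line_increasing:
  assumes "a < b" "b \<le> k_fun z" "0 \<notin> {a<..<b}"
  shows "profile_line z a < profile_line z b"
proof (rule DERIV_pos_imp_increasing_open[OF assms(1)])
  fix w assume w: "a < w" "w < b"
  have "alpha w < z" using alpha_less_iff[of w "k_fun z"] w assms by simp
  moreover have "(tanh w)\<^sup>2 < 1"
    using tanh_real_bounds[of w] by (simp add: abs_square_less_1 abs_if)
  ultimately have "0 < 4 * (1 - (tanh w)\<^sup>2) * (z - alpha w)" by simp
  then show "\<exists>y. DERIV (profile_line z) w :> y \<and> 0 < y"
    using profile_line_deriv[of w z] w assms by (metis greaterThanLessThan_iff)
next
  show "continuous_on {a..b} (profile_line z)"
    unfolding profile_line_def[abs_def]
    by (intro continuous_intros continuous_at_imp_continuous_on ballI isCont_tanhc)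
      (simp add: cosh_real_nonzero)
qed

lemma profile_line_less_left:
  assumes "w < k_fun z"
  shows "profile_line z w < f_fun z"
proof (cases "w < 0 \<and> 0 < k_fun z")
  case True
  then have "profile_line z w < profile_line z 0" "profile_line z 0 < profile_line z (k_fun z)"
    by (auto intro!: profile_line_increasing)
  then show ?thesis by (simp add: profile_line_touches)
next
  case False
  with assms have "profile_line z w < profile_line z (k_fun z)"
    by (intro profile_line_increasing) auto
  then show ?thesis by (simp add: profile_line_touches)
qed

lemma profile_line_less:
  assumes "w \<noteq> k_fun z"
  shows "profile_line z w < f_fun z"
proof (cases "w < k_fun z")
  case False
  then have "- w < k_fun (- z)" using assms by (simp add: k_fun_minus)
  from profile_line_less_left[OF this] show ?thesis
    by (simp add: profile_line_minus f_fun_minus)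
qed (rule profile_line_less_left)

lemma profile_line_le: "profile_line z w \<le> f_fun z"
  using profile_line_less[of w z] profile_line_touches[of z] by (cases "w = k_fun z") auto

text \<open>The line with parameter \<open>k_fun x\<close> touches the graph at x; at y another
  parameter is the maximiser, and maximisers are unique, so the inequality is strict.\<close>

lemma f_fun_above_tangent:
  assumes "x \<noteq> y"
  shows "f_fun x + 4 * (y - x) * tanh (k_fun x) < f_fun y"
proof -
  have "k_fun x \<noteq> k_fun y" using assms by (metis alpha_k_fun)
  then have "profile_line y (k_fun x) < f_fun y" by (rule profile_line_less)
  moreover have "profile_line y (k_fun x) = f_fun x + 4 * (y - x) * tanh (k_fun x)"
    by (simp add: profile_line_touches[of x, symmetric]) (simp add: profile_line_def algebra_simps)
  ultimately show ?thesis by simp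
qed

text \<open>Analyticity already gives some derivative. Subtracting the supporting line leaves a
  function with a minimum at z, which forces the derivative to be the slope.\<close>

lemma f_fun_deriv: "(f_fun has_real_derivative 4 * tanh (k_fun z)) (at z)"
proof -
  obtain d where d: "DERIV f_fun z :> d"
    using analytic_germ_imp_continuous_differentiable(1)[OF analytic_germ_f_fun] by blast
  have D: "DERIV (\<lambda>y. f_fun y - 4 * y * tanh (k_fun z)) z :> d - 4 * tanh (k_fun z)"
    by (auto intro!: derivative_eq_intros d)
  have "f_fun z - 4 * z * tanh (k_fun z) \<le> f_fun y - 4 * y * tanh (k_fun z)" for y
    using f_fun_above_tangent[of z y] by (cases "y = z") (auto simp: algebra_simps)
  then have "d - 4 * tanh (k_fun z) = 0"
    by (intro DERIV_local_min[OF D, of 1]) auto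
  with d show ?thesis by simp
qed

text \<open>The weighted average of the supporting-line bounds taken at the intermediate point: the
  slope terms cancel.\<close>

lemma strictly_convex_f_fun: "strictly_convex_on UNIV f_fun"
  unfolding strictly_convex_on_def
proof (intro conjI ballI allI impI convex_UNIV)
  fix x y t :: real assume *: "x \<noteq> y \<and> 0 < t \<and> t < 1"
  define u where "u = (1 - t) *\<^sub>R x + t *\<^sub>R y"
  define \<tau> where "\<tau> = 4 * tanh (k_fun u)"
  have u: "x - u = t * (x - y)" "y - u = (1 - t) * (y - x)" by (auto simp: u_def algebra_simps)
  with * have "x \<noteq> u" "y \<noteq> u" by (metis diff_self mult_eq_0_iff right_minus_eq less_irrefl)+
  then have 1: "f_fun u + (x - u) * \<tau> < f_fun x" "f_fun u + (y - u) * \<tau> < f_fun y"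
    using f_fun_above_tangent[of u x] f_fun_above_tangent[of u y] by (auto simp: \<tau>_def algebra_simps)
  have "(1 - t) * (f_fun u + (x - u) * \<tau>) + t * (f_fun u + (y - u) * \<tau>) < (1 - t) * f_fun x + t * f_fun y"
    using 1 * by (intro add_strict_mono mult_strict_left_mono) auto
  moreover have "(1 - t) * (f_fun u + (x - u) * \<tau>) + t * (f_fun u + (y - u) * \<tau>) = f_fun u"
    unfolding u by (simp add: algebra_simps)
  ultimately show "f_fun ((1 - t) *\<^sub>R x + t *\<^sub>R y) < (1 - t) * f_fun x + t * f_fun y"
    by (simp add: u_def)
qed

lemma strict_mono_f_fun: "strict_mono_on {0..} f_fun"
proof (rule strict_mono_onI)
  fix x y :: real assume "x \<in> {0..}" "y \<in> {0..}" "x < y"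
  moreover have "tanh (k_fun x) \<ge> 0" using k_fun_less_iff[of x 0] \<open>x \<in> {0..}\<close> by simp
  ultimately have "0 \<le> 4 * (y - x) * tanh (k_fun x)" by simp
  then show "f_fun x < f_fun y" using f_fun_above_tangent[of x y] \<open>x < y\<close> by simp
qed

section \<open>Asymptote, bounds and Taylor expansion\<close>

text \<open>The exponentially large parts of sinh^2 and sinh cosh cancel, since sinh - cosh =
  -exp(-w).\<close>

lemma f_fun_minus_asymptote:
  assumes "z > 0"
  defines "w \<equiv> k_fun z"
  shows "w > 0" and "f_fun z - 4 * z = (w - (1 - exp (- 2 * w)) / 2) / w\<^sup>2"
proof -
  show w: "w > 0" using k_fun_less_iff[of 0 z] assms by simp
  have z: "4 * z = (sinh w * cosh w - w) / w\<^sup>2" using alpha_eq[of w] w by (simp add: w_def)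
  have "f_fun z = (sinh w)\<^sup>2 / w\<^sup>2"
    using w by (simp add: f_fun_def e_fun_def w_def)
  then have "f_fun z - 4 * z = ((sinh w)\<^sup>2 - sinh w * cosh w + w) / w\<^sup>2"
    unfolding z by (simp add: diff_divide_distrib add_divide_distrib)
  also have "(sinh w)\<^sup>2 - sinh w * cosh w = - ((1 - exp (- 2 * w)) / 2)"
  proof -
    have "exp (- 2 * w) = exp (- w) * exp (- w)" "exp w * exp (- w) = 1" by (simp_all flip: exp_add)
    then show ?thesis by (simp add: sinh_def cosh_def power2_eq_square field_simps)
  qed
  finally show "f_fun z - 4 * z = (w - (1 - exp (- 2 * w)) / 2) / w\<^sup>2" by simp
qed

lemma f_fun_abs: "f_fun \<bar>z\<bar> = f_fun z"
  using f_fun_minus[of z] by (cases "z \<ge> 0") auto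

lemma exp_minus_less_quadratic:
  fixes x :: real
  assumes "x > 0"
  shows "exp (- x) < 1 - x + x\<^sup>2 / 2"
proof -
  define h where "h x = 1 - x + x\<^sup>2 / 2 - exp (- x)" for x :: real
  have "h 0 < h x"
  proof (rule DERIV_pos_imp_increasing_open[OF assms])
    fix t :: real assume "0 < t" "t < x"
    then have "- 1 + t + exp (- t) > 0" using exp_minus_greater[of t] by simp
    moreover have "DERIV h t :> - 1 + t + exp (- t)"
      unfolding h_def by (auto intro!: derivative_eq_intros)
    ultimately show "\<exists>y. DERIV h t :> y \<and> 0 < y" by blast
  qed (auto simp: h_def intro!: continuous_intros)
  then show ?thesis by (simp add: h_def)
qed

text \<open>All three bounds estimate exp(-2 w) in the explicit difference: from below by 1 - 2 w,
  from above by the quadratic Taylor polynomial, and from above by 1 for the third. The third bound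
  drives the asymptote, as \<open>k_fun\<close> is unbounded.\<close>

lemma f_fun_bounds:
  assumes "z \<noteq> 0"
  shows "4 * \<bar>z\<bar> < f_fun z" "f_fun z < 4 * \<bar>z\<bar> + 1" "f_fun z < 4 * \<bar>z\<bar> + 1 / \<bar>k_fun z\<bar>"
proof -
  define w where "w = k_fun \<bar>z\<bar>"
  have w: "w > 0" and eq: "f_fun z - 4 * \<bar>z\<bar> = (w - (1 - exp (- 2 * w)) / 2) / w\<^sup>2"
    using f_fun_minus_asymptote[of "\<bar>z\<bar>"] assms by (auto simp: f_fun_abs w_def)
  have kz: "\<bar>k_fun z\<bar> = w"
    using w k_fun_minus[of z] unfolding w_def by (cases "z \<ge> 0") auto
  have "1 - exp (- 2 * w) < 2 * w" using w exp_minus_greater[of "2 * w"] by simp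
  then have "(w - (1 - exp (- 2 * w)) / 2) / w\<^sup>2 > 0" using w by (intro divide_pos_pos) auto
  with eq show "4 * \<bar>z\<bar> < f_fun z" by simp
  have "w - (1 - exp (- 2 * w)) / 2 < w\<^sup>2"
  proof -
    have "exp (- 2 * w) < 1 - 2 * w + 2 * w\<^sup>2"
      using w exp_minus_less_quadratic[of "2 * w"] by (simp add: power_mult_distrib)
    then show ?thesis by (simp add: field_simps)
  qed
  then have "(w - (1 - exp (- 2 * w)) / 2) / w\<^sup>2 < 1" using w by simp
  with eq show "f_fun z < 4 * \<bar>z\<bar> + 1" by simp
  have "(w - (1 - exp (- 2 * w)) / 2) / w\<^sup>2 < w / w\<^sup>2"
    using w by (intro divide_strict_right_mono) auto
  then show "f_fun z < 4 * \<bar>z\<bar> + 1 / \<bar>k_fun z\<bar>" using eq kz w by (simp add: power2_eq_square)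
qed

lemma f_fun_greater: "4 * \<bar>z\<bar> < f_fun z"
  using f_fun_bounds(1)[of z] by (cases "z = 0") auto

lemma f_fun_le_asymptote: "f_fun z \<le> 4 * \<bar>z\<bar> + 1"
  using f_fun_bounds(2)[of z] by (cases "z = 0") auto

lemma f_fun_unbounded: "\<not> bdd_above (f_fun ` {0..})"
proof
  assume "bdd_above (f_fun ` {0..})"
  then obtain M where M: "\<And>z. z \<ge> 0 \<Longrightarrow> f_fun z \<le> M" unfolding bdd_above_def by fastforce
  show False using M[of "\<bar>M\<bar>"] f_fun_greater[of "\<bar>M\<bar>"] by simp
qed

lemma k_fun_at_infinity: "filterlim (\<lambda>z. \<bar>k_fun z\<bar>) at_top at_infinity"
  unfolding filterlim_at_top
proof
  fix B :: real
  have "B \<le> \<bar>k_fun z\<bar>" if "\<bar>z\<bar> \<ge> alpha \<bar>B\<bar>" for z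
  proof -
    have "\<not> k_fun \<bar>z\<bar> < k_fun (alpha \<bar>B\<bar>)" using that by (subst k_fun_less_iff) simp
    then show ?thesis using k_fun_minus[of z] by (cases "z \<ge> 0") auto
  qed
  then show "\<forall>\<^sub>F z in at_infinity. B \<le> \<bar>k_fun z\<bar>"
    unfolding eventually_at_infinity by (intro exI[of _ "alpha \<bar>B\<bar>"]) auto
qed

lemma f_fun_asymptote: "((\<lambda>z. f_fun z - 4 * \<bar>z\<bar>) \<longlongrightarrow> 0) at_infinity"
proof (rule tendsto_sandwich)
  have ev: "\<forall>\<^sub>F z::real in at_infinity. z \<noteq> 0"
    unfolding eventually_at_infinity by (intro exI[of _ 1]) auto
  show "\<forall>\<^sub>F z in at_infinity. 0 \<le> f_fun z - 4 * \<bar>z\<bar>"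
    using f_fun_greater by (intro always_eventually) (simp add: less_imp_le)
  show "\<forall>\<^sub>F z in at_infinity. f_fun z - 4 * \<bar>z\<bar> \<le> inverse \<bar>k_fun z\<bar>"
    using ev by eventually_elim (use f_fun_bounds(3) in \<open>force simp: inverse_eq_divide\<close>)
  show "((\<lambda>z. inverse \<bar>k_fun z\<bar>) \<longlongrightarrow> 0) at_infinity"
    by (rule filterlim_compose[OF tendsto_inverse_0_at_top[OF filterlim_ident] k_fun_at_infinity])
qed auto

lemma f_fun_taylor: "(\<lambda>z. f_fun z - (1 + 12 * z\<^sup>2)) \<in> O[at 0](\<lambda>z. z ^ 4)"
proof -
  \<comment> \<open>The exact quotient of the remainder by w^4, for w = \<open>k_fun z\<close>.
    Expanding both \<open>f_fun z\<close> and 12 z^2 in w gives the same quadratic term w^2 / 3,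
    which cancels; the rest contains w^4.\<close>
  define Q where "Q w = 2 * sinh_tail 5 w + (sinh_tail 3 w)\<^sup>2
     - 12 * (4 / 3 * sinh_tail 5 (2 * w) + 16 * w\<^sup>2 * (sinh_tail 5 (2 * w))\<^sup>2)" for w
  have eq: "f_fun z - (1 + 12 * z\<^sup>2) = k_fun z ^ 4 * Q (k_fun z)" for z
  proof -
    define w where "w = k_fun z"
    have z: "z = w * (1 / 6 + (2 * w)\<^sup>2 * sinh_tail 5 (2 * w))"
      using alpha_k_fun[of z] unfolding alpha_def w_def[symmetric] sinh_tail_3[of "2 * w"] by simp
    have "f_fun z = (1 + w\<^sup>2 * sinh_tail 3 w)\<^sup>2" by (simp only: f_fun_eq w_def sinh_tail_1)
    also have "\<dots> = 1 + 2 * w\<^sup>2 * (1 / 6 + w\<^sup>2 * sinh_tail 5 w) + w ^ 4 * (sinh_tail 3 w)\<^sup>2"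
      unfolding sinh_tail_3[of w, symmetric] by algebra
    finally show ?thesis
      unfolding w_def[symmetric]
      by (subst (2) z, simp only: Q_def) (simp add: field_simps power2_eq_square power4_eq_xxxx)
  qed
  have "isCont Q 0"
    unfolding Q_def by (intro continuous_intros isCont_o2[OF _ isCont_sinh_tail] isCont_sinh_tail)
  then have "isCont (\<lambda>z. Q (k_fun z)) 0"
    by (intro isCont_o2[of 0 k_fun Q] analytic_germ_imp_continuous_differentiable(2)[OF analytic_germ_k_fun]) simp
  then have "((\<lambda>z. \<bar>Q (k_fun z)\<bar>) \<longlongrightarrow> \<bar>Q (k_fun 0)\<bar>) (at 0)"
    by (intro tendsto_rabs) (simp add: isCont_def)
  then have "\<forall>\<^sub>F z in at 0. \<bar>Q (k_fun z)\<bar> < \<bar>Q (k_fun 0)\<bar> + 1"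
    by (rule order_tendstoD) simp
  then have "\<forall>\<^sub>F z in at 0. norm (f_fun z - (1 + 12 * z\<^sup>2)) \<le> (6 ^ 4 * (\<bar>Q (k_fun 0)\<bar> + 1)) * norm (z ^ 4)"
  proof eventually_elim
    case (elim z)
    have "\<bar>k_fun z\<bar> \<le> 6 * \<bar>z\<bar>"
      using alpha_expanding[of 0 "k_fun z"] alpha_expanding[of "k_fun z" 0]
      by (cases "k_fun z \<ge> 0") auto
    then have "\<bar>k_fun z\<bar> ^ 4 \<le> (6 * \<bar>z\<bar>) ^ 4" by (intro power_mono) auto
    then have "\<bar>k_fun z\<bar> ^ 4 * \<bar>Q (k_fun z)\<bar> \<le> (6 * \<bar>z\<bar>) ^ 4 * (\<bar>Q (k_fun 0)\<bar> + 1)"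
      using elim by (intro mult_mono) auto
    then show ?case
      unfolding eq by (simp add: abs_mult power_abs power_mult_distrib algebra_simps)
  qed
  then show ?thesis by (rule bigoI)
qed

section \<open>The dilated profile\<close>

text \<open>In this homogeneous form z enters linearly and R only through its square, so that points
  with different R can be compared with one and the same w.\<close>

lemma f_fun_scaled_ge:
  assumes "R > 0"
  shows "4 * z * tanh w + R\<^sup>2 * tanhc w \<le> R\<^sup>2 * f_fun (z / R\<^sup>2)"
  using mult_left_mono[OF profile_line_le[of "z / R\<^sup>2" w], of "R\<^sup>2"] assms
  by (simp add: profile_line_def distrib_left)

lemma f_fun_scaled_eq:
  fixes R z :: real
  assumes "R > 0"
  defines "w \<equiv> k_fun (z / R\<^sup>2)"
  shows "R\<^sup>2 * f_fun (z / R\<^sup>2) = 4 * z * tanh w + R\<^sup>2 * tanhc w"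
  using assms unfolding w_def profile_line_touches[symmetric]
  by (simp add: profile_line_def distrib_left)

lemma f_fun_scaled_greater:
  assumes "R > 0"
  shows "4 * \<bar>z\<bar> < R\<^sup>2 * f_fun (z / R\<^sup>2)"
  using mult_strict_left_mono[OF f_fun_greater[of "z / R\<^sup>2"], of "R\<^sup>2"] assms by simp

lemma f_fun_scaled_surj:
  assumes "4 * \<bar>z\<bar> < P"
  shows "\<exists>R>0. P = R\<^sup>2 * f_fun (z / R\<^sup>2)"
proof -
  \<comment> \<open>With f <= 4|z| + 1 the value at \<open>r\<close> is at most 4|z| + r^2, the
    midpoint between 4|z| and \<open>P\<close>.\<close>
  define r where "r = sqrt ((P - 4 * \<bar>z\<bar>) / 2)"
  have r: "r > 0" "r\<^sup>2 = (P - 4 * \<bar>z\<bar>) / 2" using assms by (auto simp: r_def)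
  have "r\<^sup>2 * f_fun (z / r\<^sup>2) \<le> r\<^sup>2 * (4 * \<bar>z / r\<^sup>2\<bar> + 1)"
    by (intro mult_left_mono f_fun_le_asymptote) auto
  also have "\<dots> = 4 * \<bar>z\<bar> + r\<^sup>2" using r(1) by (simp add: distrib_left)
  also have "\<dots> \<le> P" using assms unfolding r(2) by (simp add: field_simps)
  finally have low: "r\<^sup>2 * f_fun (z / r\<^sup>2) \<le> P" .
  \<comment> \<open>Since f >= 1, the value at \<open>R\<close> is at least
    \<open>R\<^sup>2 >= P\<close>; the summand \<open>r\<close> only secures
    \<open>r <= R\<close>.\<close>
  define R where "R = r + sqrt P"
  have "P \<ge> 0" using assms by simp
  then have "(sqrt P)\<^sup>2 \<le> R\<^sup>2" unfolding R_def using r by (intro power_mono) auto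
  also have "R\<^sup>2 \<le> R\<^sup>2 * f_fun (z / R\<^sup>2)"
    using mult_left_mono[OF f_fun_ge_1, of "R\<^sup>2" "z / R\<^sup>2"] by simp
  finally have high: "P \<le> R\<^sup>2 * f_fun (z / R\<^sup>2)" using \<open>P \<ge> 0\<close> by simp
  have "continuous_on {r..R} (\<lambda>s. s\<^sup>2 * f_fun (z / s\<^sup>2))"
    using r by (intro continuous_at_imp_continuous_on ballI continuous_intros isCont_o2[OF _ isCont_f_fun]) auto
  then obtain s where "r \<le> s" "s\<^sup>2 * f_fun (z / s\<^sup>2) = P"
    using IVT'[of "\<lambda>s. s\<^sup>2 * f_fun (z / s\<^sup>2)", OF low high] \<open>P \<ge> 0\<close> by (auto simp: R_def)
  then show ?thesis using r by (intro exI[of _ s]) auto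
qed

section \<open>An analytic square root of f - 1\<close>

text \<open>With S = sinh w / w one has f - 1 = (S - 1)(S + 1), and S - 1 contains the factor w^2.
  Taking w out of the root leaves a positive radicand, so the root is odd and analytic across 0. It
  serves to turn the sections by x = const into circles.\<close>

definition gamma_root :: "real \<Rightarrow> real" where
  "gamma_root w = w * sqrt (sinh_tail 3 w * (sinh_tail 1 w + 1))"

lemma gamma_root_radicand: "sinh_tail 3 w * (sinh_tail 1 w + 1) \<ge> 1 / 3"
  using mult_mono[OF sinh_tail_3_ge[of w], of 2 "sinh_tail 1 w + 1"] sinh_tail_1_ge[of w] sinh_tail_3_ge[of w]
  by simp

lemma f_fun_eq_gamma_root: "f_fun z = 1 + (gamma_root (k_fun z))\<^sup>2"
proof -
  define w where "w = k_fun z"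
  have "sinh_tail 3 w * (sinh_tail 1 w + 1) \<ge> 0" using gamma_root_radicand[of w] by simp
  then have "(gamma_root w)\<^sup>2 = (w\<^sup>2 * sinh_tail 3 w) * (sinh_tail 1 w + 1)"
    by (simp add: gamma_root_def power_mult_distrib)
  also have "\<dots> = (sinh_tail 1 w)\<^sup>2 - 1"
    using sinh_tail_1[of w] by (simp add: power2_eq_square algebra_simps)
  finally show ?thesis by (simp only: f_fun_eq w_def)
qed

lemma analytic_germ_gamma_root: "analytic_germ gamma_root w"
proof -
  have *: "analytic_germ (\<lambda>w. sinh_tail 3 w * (sinh_tail 1 w + 1)) w"
    by (intro analytic_germ_mult analytic_germ_add analytic_germ_const analytic_germ_sinh_tail)
  have "sinh_tail 3 w * (sinh_tail 1 w + 1) > 0" using gamma_root_radicand[of w] by simp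
  from analytic_germ_compose[OF * analytic_germ_sqrt[OF this]]
  show ?thesis unfolding gamma_root_def[abs_def]
    by (intro analytic_germ_mult analytic_germ_ident)
qed

lemma gamma_root_minus: "gamma_root (- w) = - gamma_root w"
  using sinh_tail_even[of 3 w] sinh_tail_even[of 1 w] by (simp add: gamma_root_def)

text \<open>For w >= 0 the root is w times a nondecreasing factor that is at least 1/2, because its
  square is at least 1/3. Oddness gives w <= 0, and mixed signs are joined through 0.\<close>

lemma gamma_root_expanding:
  assumes "x \<le> y"
  shows "1 / 2 * (y - x) \<le> gamma_root y - gamma_root x"
proof -
  define s where "s w = sqrt (sinh_tail 3 w * (sinh_tail 1 w + 1))" for w
  have s: "s w \<ge> 1 / 2" for w
    unfolding s_def using gamma_root_radicand[of w] by (intro real_le_rsqrt) (simp add: power2_eq_square)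
  have pos: "1 / 2 * (b - a) \<le> gamma_root b - gamma_root a" if "0 \<le> a" "a \<le> b" for a b
  proof -
    have "s a \<le> s b"
      unfolding s_def using that sinh_tail_1_ge[of a] sinh_tail_3_ge[of b]
      by (intro real_sqrt_le_mono mult_mono add_right_mono sinh_tail_mono) auto
    then have "b * s a \<le> b * s b" using that by (intro mult_left_mono) auto
    moreover have "(b - a) * (1 / 2) \<le> (b - a) * s a" using that s by (intro mult_left_mono) auto
    moreover have "gamma_root b - gamma_root a = b * s b - a * s a" by (simp add: gamma_root_def s_def)
    ultimately show ?thesis by (simp add: algebra_simps)
  qed
  consider "0 \<le> x" | "y \<le> 0" | "x \<le> 0" "0 \<le> y" by linarith
  then show ?thesis
  proof cases
    case 1
    then show ?thesis using pos assms by blast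
  next
    case 2
    then show ?thesis using pos[of "- y" "- x"] assms by (simp add: gamma_root_minus)
  next
    case 3
    have "gamma_root 0 = 0" by (simp add: gamma_root_def)
    then show ?thesis using pos[of 0 "- x"] pos[of 0 y] 3 by (simp add: gamma_root_minus)
  qed
qed

lemma bij_gamma_root: "bij gamma_root"
  by (rule expanding_analytic_inverse(1)[OF analytic_germ_gamma_root _ gamma_root_expanding]) simp

lemma analytic_germ_inv_gamma_root: "analytic_germ (inv gamma_root) v"
  by (rule expanding_analytic_inverse(2)[OF analytic_germ_gamma_root _ gamma_root_expanding]) simp

section \<open>The length estimate\<close>

lemma AE_lebesgue_on_iff:
  fixes a b :: real
  shows "(AE t in lebesgue_on {a..b}. P t) \<longleftrightarrow> (AE t in lebesgue. t \<in> {a..b} \<longrightarrow> P t)"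
  by (rule AE_restrict_space_iff) simp

lemma AE_lebesgue_on_subset:
  fixes a b c d :: real
  assumes "AE t in lebesgue_on {a..b}. P t" "{c..d} \<subseteq> {a..b}"
  shows "AE t in lebesgue_on {c..d}. P t"
  using assms unfolding AE_lebesgue_on_iff by (auto elim!: eventually_mono)

lemma AE_lebesgue_on_neq:
  fixes a b c :: real
  shows "AE t in lebesgue_on {a..b}. t \<noteq> c"
proof -
  have "AE t in lebesgue. t \<noteq> c"
    by (rule AE_I[of _ _ "{c}"]) (auto simp: emeasure_lborel_singleton)
  then show ?thesis unfolding AE_lebesgue_on_iff by (auto elim: eventually_mono)
qed

text \<open>Left quotients are the ones that a minimum over w bounds from below: the minimiser of
  time t overestimates the minimum at the earlier time.\<close>

lemma left_difference_quotient:
  fixes F :: "real \<Rightarrow> real"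
  assumes "(F has_real_derivative d) (at t within {a..b})" "a < t" "t \<le> b"
  shows "((\<lambda>h. (F t - F (t - h)) / h) \<longlongrightarrow> d) (at_right 0)"
proof -
  have "((\<lambda>y. (F y - F t) / (y - t)) \<longlongrightarrow> d) (at t within {a..b})"
    using assms(1) by (simp add: has_field_derivative_iff)
  moreover have "filterlim (\<lambda>h. t - h) (at t within {a..b}) (at_right 0)"
    unfolding filterlim_at
  proof
    show "\<forall>\<^sub>F h in at_right 0. t - h \<in> {a..b} \<and> t - h \<noteq> t"
    proof -
      have "\<forall>\<^sub>F h in at_right 0. h \<in> {0<..<t - a}"
        using assms by (intro eventually_at_right_real) simp
      then show ?thesis by eventually_elim (use assms in auto)
    qed
    show "((\<lambda>h. t - h) \<longlongrightarrow> t) (at_right 0)"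
      by (auto intro!: tendsto_eq_intros)
  qed
  ultimately have "((\<lambda>h. (F (t - h) - F t) / (t - h - t)) \<longlongrightarrow> d) (at_right 0)"
    by (rule filterlim_compose)
  then show ?thesis by (simp add: minus_divide_left)
qed

text \<open>Fatou's lemma applied to the left difference quotients of \<open>V\<close>, whose integrals telescope.\<close>

lemma integral_le_increment:
  fixes V \<omega> :: "real \<Rightarrow> real"
  assumes "a \<le> b" and mono: "mono_on {a..b} V"
    and nonneg: "AE t in lebesgue_on {a..b}. 0 \<le> \<omega> t"
    and lower: "AE t in lebesgue_on {a..b}. \<forall>c<\<omega> t. \<forall>\<^sub>F h in at_right 0. c \<le> (V t - V (t - h)) / h"
  shows "(LINT t|lebesgue_on {a..b}. \<omega> t) \<le> V b - V a"
proof -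
  let ?M = "lebesgue_on {a..b}"
  \<comment> \<open>Extending \<open>V\<close> by its end values keeps it monotone and makes the
    shifted function available on the whole interval.\<close>
  define V0 where "V0 t = V (max a (min b t))" for t
  define \<delta> where "\<delta> n = 1 / real (Suc n)" for n
  define U where "U n t = (V0 t - V0 (t - \<delta> n)) / \<delta> n" for n t
  have \<delta>: "\<delta> n > 0" for n by (simp add: \<delta>_def)
  have mono0: "mono V0"
    by (rule monoI) (use mono \<open>a \<le> b\<close> in \<open>auto simp: V0_def intro!: mono_onD[OF mono]\<close>)
  have mshift: "mono (\<lambda>t. V0 (t - h))" for h
    using mono0 by (simp add: mono_def)
  have int: "(\<lambda>t. V0 (t - h)) integrable_on {c..d}" for h c d
    by (intro integrable_on_mono_on) (use mshift[of h] in \<open>auto simp: mono_def monotone_on_def\<close>)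
  have int0: "V0 integrable_on {c..d}" for c d using int[of 0] by simp
  have U0: "U n t \<ge> 0" for n t
    unfolding U_def using mono0 \<delta>[of n] by (intro divide_nonneg_pos) (auto simp: mono_def)
  have intU: "integrable ?M (U n)" for n
    unfolding U_def using mono0 mshift[of "\<delta> n"]
    by (intro Bochner_Integration.integrable_divide Bochner_Integration.integrable_diff integrable_mono_on)
      (auto simp: mono_def monotone_on_def)
  \<comment> \<open>After the shift only two end intervals of length \<delta> n survive. On the
    right one \<open>V0\<close> is at most \<open>V b\<close>, on the left one it is at least
    \<open>V a\<close>.\<close>
  have IU: "integral {a..b} (U n) \<le> V b - V a" for n
  proof -
    let ?h = "\<delta> n"
    have "integral {a..b} (\<lambda>t. V0 (t - ?h)) = integral {a - ?h..b - ?h} V0"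
    proof -
      have "integral {a..b} (V0 \<circ> (+) (- ?h)) = integral {a + - ?h..b + - ?h} V0"
        by (rule integral_shift_Icc_real)
      moreover have "V0 \<circ> (+) (- ?h) = (\<lambda>t. V0 (t - ?h))" by (simp add: fun_eq_iff)
      ultimately show ?thesis by simp
    qed
    moreover have "integral {a - ?h..a} V0 + integral {a..b} V0 = integral {a - ?h..b} V0"
      using \<delta>[of n] \<open>a \<le> b\<close> by (intro Henstock_Kurzweil_Integration.integral_combine int0) auto
    moreover have "integral {a - ?h..b - ?h} V0 + integral {b - ?h..b} V0 = integral {a - ?h..b} V0"
      using \<delta>[of n] \<open>a \<le> b\<close> by (intro Henstock_Kurzweil_Integration.integral_combine int0) auto
    moreover have "integral {b - ?h..b} V0 \<le> integral {b - ?h..b} (\<lambda>_. V b)"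
      by (intro integral_le int0) (use \<open>a \<le> b\<close> in \<open>auto simp: V0_def intro!: mono_onD[OF mono]\<close>)
    moreover have "integral {a - ?h..a} (\<lambda>_. V a) \<le> integral {a - ?h..a} V0"
      by (intro integral_le int0) (use \<open>a \<le> b\<close> in \<open>auto simp: V0_def intro!: mono_onD[OF mono]\<close>)
    ultimately have "integral {a..b} V0 - integral {a..b} (\<lambda>t. V0 (t - ?h)) \<le> ?h * (V b - V a)"
      using \<delta>[of n] by (simp add: algebra_simps)
    moreover have "integral {a..b} (U n) = (integral {a..b} V0 - integral {a..b} (\<lambda>t. V0 (t - ?h))) / ?h"
      unfolding U_def by (simp add: Henstock_Kurzweil_Integration.integral_diff[OF int0 int])
    ultimately show ?thesis using \<delta>[of n] by (simp add: pos_divide_le_eq mult.commute)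
  qed
  have nnU: "(\<integral>\<^sup>+t. ennreal (U n t) \<partial>?M) \<le> ennreal (V b - V a)" for n
    using IU[of n] lebesgue_integral_eq_integral[OF intU[of n]] U0
    by (subst nn_integral_eq_integral[OF intU]) (auto intro!: ennreal_leI)
  have "AE t in ?M. t \<in> {a..b} \<and> t \<noteq> a"
    using AE_lebesgue_on_neq[where a = a and b = b and c = a] AE_space[of ?M] by eventually_elim simp
  with lower have "AE t in ?M. ennreal (\<omega> t) \<le> liminf (\<lambda>n. ennreal (U n t))"
  proof eventually_elim
    case (elim t)
    have "filterlim \<delta> (at_right 0) sequentially"
      unfolding filterlim_at using \<delta> LIMSEQ_Suc[OF lim_1_over_n]
      by (auto simp: \<delta>_def[abs_def])
    then have ev: "\<forall>\<^sub>F n in sequentially. P (\<delta> n)" if "\<forall>\<^sub>F h in at_right 0. P h" for P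
      using that by (simp add: filterlim_iff)
    have "\<forall>\<^sub>F h in at_right 0. h < t - a"
      using eventually_at_right_real[of 0 "t - a"] elim by (auto elim: eventually_mono)
    from ev[OF this] have inside: "\<forall>\<^sub>F n in sequentially. \<delta> n < t - a" .
    have lim: "ennreal c \<le> liminf (\<lambda>n. ennreal (U n t))" if "c < \<omega> t" for c
    proof (rule Liminf_bounded)
      have "\<forall>\<^sub>F h in at_right 0. c \<le> (V t - V (t - h)) / h" using elim that by blast
      from ev[OF this] inside show "\<forall>\<^sub>F n in sequentially. ennreal c \<le> ennreal (U n t)"
      proof eventually_elim
        case (elim n)
        have "V0 t = V t" "V0 (t - \<delta> n) = V (t - \<delta> n)"
          using \<open>t \<in> {a..b} \<and> t \<noteq> a\<close> \<delta>[of n] elim(2) by (auto simp: V0_def max_def min_def)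
        then show ?case using elim(1) by (intro ennreal_leI) (simp add: U_def)
      qed
    qed
    \<comment> \<open>The quotients are bounded below by each \<open>c < \<omega> t\<close> only
      from some index on that depends on c; the limit of c from the left recovers \<omega>
      t.\<close>
    show ?case
    proof (rule tendsto_upperbound)
      show "((\<lambda>c. ennreal c) \<longlongrightarrow> ennreal (\<omega> t)) (at_left (\<omega> t))"
        by (intro tendsto_ennrealI tendsto_ident_at)
      show "\<forall>\<^sub>F c in at_left (\<omega> t). ennreal c \<le> liminf (\<lambda>n. ennreal (U n t))"
        unfolding eventually_at_filter using lim by (auto intro!: always_eventually)
    qed simp
  qed
  then have "(\<integral>\<^sup>+t. ennreal (\<omega> t) \<partial>?M) \<le> (\<integral>\<^sup>+t. liminf (\<lambda>n. ennreal (U n t)) \<partial>?M)"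
    by (rule nn_integral_mono_AE)
  also have "\<dots> \<le> liminf (\<lambda>n. \<integral>\<^sup>+t. ennreal (U n t) \<partial>?M)"
    using intU by (intro nn_integral_liminf measurable_compose[OF _ measurable_ennreal]) (rule borel_measurable_integrable)
  also have "\<dots> \<le> limsup (\<lambda>n. \<integral>\<^sup>+t. ennreal (U n t) \<partial>?M)"
    by (rule Liminf_le_Limsup) simp
  also have "\<dots> \<le> ennreal (V b - V a)"
    by (rule Limsup_bounded) (simp add: nnU)
  finally have le: "(\<integral>\<^sup>+t. ennreal (\<omega> t) \<partial>?M) \<le> ennreal (V b - V a)" .
  have Vab: "V a \<le> V b" using \<open>a \<le> b\<close> by (intro mono_onD[OF mono]) auto
  show ?thesis
  proof (cases "integrable ?M \<omega>")
    case True
    then have "integral\<^sup>L ?M \<omega> = enn2real (\<integral>\<^sup>+t. ennreal (\<omega> t) \<partial>?M)"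
      by (intro integral_eq_nn_integral borel_measurable_integrable nonneg)
    then show ?thesis using le Vab by (simp add: enn2real_leI)
  next
    \<comment> \<open>The integral of a function that is not integrable is 0 by convention, so
      monotonicity of \<open>V\<close> suffices.\<close>
    case False
    then show ?thesis using Vab by (simp add: not_integrable_integral_eq)
  qed
qed

text \<open>The one-sided bound excludes downward jumps and Cantor-like descent: it makes
  \<open>\<lambda>t. F t + C * t\<close> nondecreasing.\<close>

lemma nondecreasing_if_AE_deriv_nonneg:
  fixes F :: "real \<Rightarrow> real"
  assumes der: "AE t in lebesgue_on {a..b}. \<exists>d\<ge>0. (F has_real_derivative d) (at t within {a..b})"
    and one_sided: "\<And>s t. a \<le> s \<Longrightarrow> s \<le> t \<Longrightarrow> t \<le> b \<Longrightarrow> - C * (t - s) \<le> F t - F s"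
    and "C \<ge> 0" "a \<le> s" "s \<le> t" "t \<le> b"
  shows "F s \<le> F t"
proof -
  define V where "V t = F t + C * t" for t
  \<comment> \<open>Almost everywhere the derivative of \<open>V\<close> is at least
    \<open>C\<close>; the resulting bound C (t - s) <= V t - V s is the claim once the linear term
    is cancelled.\<close>
  have "(LINT x|lebesgue_on {s..t}. C) \<le> V t - V s"
  proof (rule integral_le_increment[OF \<open>s \<le> t\<close>])
    show "mono_on {s..t} V"
      unfolding V_def using assms by (intro mono_onI) (smt (verit) atLeastAtMost_iff one_sided right_diff_distrib mult_minus_left)
    show "AE x in lebesgue_on {s..t}. 0 \<le> C" using \<open>C \<ge> 0\<close> by simp
    have "AE x in lebesgue_on {a..b}. \<forall>c<C. \<forall>\<^sub>F h in at_right 0. c \<le> (V x - V (x - h)) / h"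
      using der AE_space[of "lebesgue_on {a..b}"] AE_lebesgue_on_neq[where a = a and b = b and c = a]
    proof eventually_elim
      case (elim x)
      then have "a < x" by simp
      show ?case
      proof (intro impI allI)
        fix c assume "c < C"
        obtain d where d: "d \<ge> 0" "(F has_real_derivative d) (at x within {a..b})" using elim by blast
        have "(V has_real_derivative d + C) (at x within {a..b})"
          unfolding V_def by (auto intro!: derivative_eq_intros d)
        from left_difference_quotient[OF this \<open>a < x\<close>] elim
        have "((\<lambda>h. (V x - V (x - h)) / h) \<longlongrightarrow> d + C) (at_right 0)" by simp
        then have "\<forall>\<^sub>F h in at_right 0. c < (V x - V (x - h)) / h"
          by (rule order_tendstoD) (use d \<open>c < C\<close> in simp)
        then show "\<forall>\<^sub>F h in at_right 0. c \<le> (V x - V (x - h)) / h" by eventually_elim simp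
      qed
    qed
    then show "AE x in lebesgue_on {s..t}. \<forall>c<C. \<forall>\<^sub>F h in at_right 0. c \<le> (V x - V (x - h)) / h"
      by (rule AE_lebesgue_on_subset) (use assms in auto)
  qed
  then show ?thesis using \<open>s \<le> t\<close> by (simp add: V_def measure_restrict_space algebra_simps)
qed

text \<open>In the null coordinates \<open>p = x + y\<close> and \<open>m = x - y\<close> the control constraint reads
  \<open>dp, dm \<ge> 0\<close>, the length element is \<open>sqrt (dp * dm)\<close>, and \<open>4 * dz = m * dp - p * dm\<close>.\<close>

locale causal_curve =
  fixes T C :: real and p m z dp dm :: "real \<Rightarrow> real"
  assumes T: "0 \<le> T" and C: "0 \<le> C"
    and lip: "\<And>s t. 0 \<le> s \<Longrightarrow> s \<le> t \<Longrightarrow> t \<le> T \<Longrightarrow>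
      \<bar>p t - p s\<bar> \<le> C * (t - s) \<and> \<bar>m t - m s\<bar> \<le> C * (t - s) \<and> \<bar>z t - z s\<bar> \<le> C * (t - s)"
    and der: "AE t in lebesgue_on {0..T}. 0 \<le> dp t \<and> 0 \<le> dm t \<and>
      (p has_real_derivative dp t) (at t within {0..T}) \<and>
      (m has_real_derivative dm t) (at t within {0..T}) \<and>
      (z has_real_derivative (m t * dp t - p t * dm t) / 4) (at t within {0..T})"
    and start: "0 \<le> p 0" "0 \<le> m 0"
begin

section \<open>Monotone quantities along causal curves\<close>

lemma p_mono: "0 \<le> s \<Longrightarrow> s \<le> t \<Longrightarrow> t \<le> T \<Longrightarrow> p s \<le> p t"
proof (rule nondecreasing_if_AE_deriv_nonneg[where a = 0 and b = T and F = p and C = C])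
  show "AE t in lebesgue_on {0..T}. \<exists>d\<ge>0. (p has_real_derivative d) (at t within {0..T})"
    using der by eventually_elim auto
  show "- C * (t - s) \<le> p t - p s" if "0 \<le> s" "s \<le> t" "t \<le> T" for s t
    using lip[OF that] by (auto simp: abs_le_iff)
qed (use C in auto)

lemma m_mono: "0 \<le> s \<Longrightarrow> s \<le> t \<Longrightarrow> t \<le> T \<Longrightarrow> m s \<le> m t"
proof (rule nondecreasing_if_AE_deriv_nonneg[where a = 0 and b = T and F = m and C = C])
  show "AE t in lebesgue_on {0..T}. \<exists>d\<ge>0. (m has_real_derivative d) (at t within {0..T})"
    using der by eventually_elim auto
  show "- C * (t - s) \<le> m t - m s" if "0 \<le> s" "s \<le> t" "t \<le> T" for s t
    using lip[OF that] by (auto simp: abs_le_iff)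
qed (use C in auto)

lemma pm_nonneg: "t \<in> {0..T} \<Longrightarrow> 0 \<le> p t \<and> 0 \<le> m t"
  using p_mono[of 0 t] m_mono[of 0 t] start by auto

text \<open>The product p m is x^2 - y^2, and \<tau> stands for tanh w. Both summands of the
  derivative are nonnegative when |\<tau>| <= 1 and p, m >= 0.\<close>

lemma theta_deriv:
  assumes "(p has_real_derivative dp t) (at t within {0..T})"
    "(m has_real_derivative dm t) (at t within {0..T})"
    "(z has_real_derivative (m t * dp t - p t * dm t) / 4) (at t within {0..T})"
  shows "((\<lambda>t. p t * m t - 4 * z t * \<tau>) has_real_derivative
    (1 - \<tau>) * (m t * dp t) + (1 + \<tau>) * (p t * dm t)) (at t within {0..T})"
  using assms by (auto intro!: derivative_eq_intros simp: field_simps)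

text \<open>Only the z term can decrease, since p m is a product of nonnegative nondecreasing
  functions; hence the one-sided constant 4 C. The extreme values \<tau> = 1 and \<tau> = -1 give
  the cone inequality, \<tau> = tanh w the length bound.\<close>

lemma theta_mono:
  assumes \<tau>: "\<bar>\<tau>\<bar> \<le> 1" and st: "0 \<le> s" "s \<le> t" "t \<le> T"
  shows "p s * m s - 4 * z s * \<tau> \<le> p t * m t - 4 * z t * \<tau>"
proof (rule nondecreasing_if_AE_deriv_nonneg[where a = 0 and b = T and C = "4 * C" and F = "\<lambda>t. p t * m t - 4 * z t * \<tau>"])
  show "AE t in lebesgue_on {0..T}. \<exists>d\<ge>0. ((\<lambda>t. p t * m t - 4 * z t * \<tau>) has_real_derivative d) (at t within {0..T})"
    using der AE_space[of "lebesgue_on {0..T}"]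
  proof eventually_elim
    case (elim t)
    then have "0 \<le> m t * dp t" "0 \<le> p t * dm t" using pm_nonneg[of t] by auto
    moreover have "0 \<le> 1 - \<tau>" "0 \<le> 1 + \<tau>" using \<tau> by auto
    ultimately have "0 \<le> (1 - \<tau>) * (m t * dp t) + (1 + \<tau>) * (p t * dm t)" by simp
    with theta_deriv[of t \<tau>] elim show ?case by blast
  qed
  fix s t assume *: "0 \<le> s" "s \<le> t" "t \<le> T"
  have "p s * m s \<le> p t * m t"
    using p_mono[OF *] m_mono[OF *] pm_nonneg[of s] pm_nonneg[of t] * by (intro mult_mono) auto
  moreover have "(z t - z s) * \<tau> \<le> C * (t - s)"
  proof -
    have "(z t - z s) * \<tau> \<le> \<bar>z t - z s\<bar> * \<bar>\<tau>\<bar>" by (metis abs_ge_self abs_mult)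
    also have "\<dots> \<le> \<bar>z t - z s\<bar> * 1" using \<tau> by (intro mult_left_mono) auto
    also have "\<dots> \<le> C * (t - s)" using lip[OF *] by simp
    finally show ?thesis .
  qed
  ultimately show "- (4 * C) * (t - s) \<le> p t * m t - 4 * z t * \<tau> - (p s * m s - 4 * z s * \<tau>)"
    by (simp add: algebra_simps)
qed (use C st in auto)

end

lemma (in causal_curve) length_estimate_positive_start:
  assumes pos: "0 < p 0" "0 < m 0" "z 0 = 0"
  shows "(LINT t|lebesgue_on {0..T}. sqrt (dp t * dm t))\<^sup>2 * tanhc w \<le> p T * m T - 4 * z T * tanh w"
proof -
  \<comment> \<open>Monotonicity for \<tau> = 1 and \<tau> = -1 preserves the initial distance
    \<open>p 0 * m 0\<close> from the boundary of the cone, so \<open>D\<close> exists and is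
    positive all along the curve.\<close>
  have inside: "4 * \<bar>z t\<bar> < p t * m t" if t: "t \<in> {0..T}" for t
  proof -
    have "p 0 * m 0 \<le> p t * m t - 4 * z t * \<tau>" if "\<bar>\<tau>\<bar> \<le> 1" for \<tau>
      using theta_mono[OF that, of 0 t] t pos by simp
    from this[of 1] this[of "-1"] have "p 0 * m 0 \<le> p t * m t - 4 * \<bar>z t\<bar>" by (auto simp: abs_if)
    with pos show ?thesis by (smt (verit) mult_pos_pos)
  qed
  have "\<forall>t\<in>{0..T}. \<exists>R>0. p t * m t = R\<^sup>2 * f_fun (z t / R\<^sup>2)"
    using inside f_fun_scaled_surj by blast
  then obtain D where D: "\<And>t. t \<in> {0..T} \<Longrightarrow> 0 < D t"
      "\<And>t. t \<in> {0..T} \<Longrightarrow> p t * m t = (D t)\<^sup>2 * f_fun (z t / (D t)\<^sup>2)"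
    by metis
  define W where "W t = k_fun (z t / (D t)\<^sup>2)" for t
  have eqW: "p t * m t - 4 * z t * tanh (W t) = (D t)\<^sup>2 * tanhc (W t)" if "t \<in> {0..T}" for t
    using f_fun_scaled_eq[OF D(1)[OF that], of "z t"] D(2)[OF that] by (simp add: W_def)
  have geW: "(D t)\<^sup>2 * tanhc w \<le> p t * m t - 4 * z t * tanh w" if "t \<in> {0..T}" for t w
    using f_fun_scaled_ge[OF D(1)[OF that], of "z t" w] D(2)[OF that] by simp
  have tanh1: "\<bar>tanh w\<bar> \<le> 1" for w :: real
    using tanh_real_bounds[of w] by (auto simp: abs_le_iff)
  have Dmono: "mono_on {0..T} D"
  proof (rule mono_onI)
    fix s t assume *: "s \<in> {0..T}" "t \<in> {0..T}" "s \<le> t"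
    have "(D s)\<^sup>2 * tanhc (W t) \<le> p s * m s - 4 * z s * tanh (W t)" using geW * by blast
    also have "\<dots> \<le> p t * m t - 4 * z t * tanh (W t)" using theta_mono[OF tanh1, of s t] * by auto
    also have "\<dots> = (D t)\<^sup>2 * tanhc (W t)" using eqW * by blast
    finally have "(D s)\<^sup>2 \<le> (D t)\<^sup>2" using tanhc_pos[of "W t"] by simp
    then show "D s \<le> D t" by (rule power2_le_imp_le) (use D(1)[OF *(2)] in simp)
  qed
  have "(LINT t|lebesgue_on {0..T}. sqrt (dp t * dm t)) \<le> D T - D 0"
  proof (rule integral_le_increment[OF T Dmono])
    show "AE t in lebesgue_on {0..T}. 0 \<le> sqrt (dp t * dm t)"
      using der by eventually_elim auto
    show "AE t in lebesgue_on {0..T}. \<forall>c<sqrt (dp t * dm t). \<forall>\<^sub>F h in at_right 0. c \<le> (D t - D (t - h)) / h"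
      using der AE_space[of "lebesgue_on {0..T}"] AE_lebesgue_on_neq[where a = 0 and b = T and c = 0]
    proof eventually_elim
      case (elim t)
      then have t: "t \<in> {0..T}" "0 < t" "t \<le> T" by auto
      define \<tau> K where "\<tau> = tanh (W t)" and "K = tanhc (W t)"
      define \<Theta> where "\<Theta> s = p s * m s - 4 * z s * \<tau>" for s
      define A B where "A = (1 - \<tau>) * (m t * dp t)" and "B = (1 + \<tau>) * (p t * dm t)"
      have K: "K > 0" by (simp add: K_def tanhc_pos)
      have Dt: "D t > 0" using D(1) t by blast
      have lim: "((\<lambda>h. (\<Theta> t - \<Theta> (t - h)) / h) \<longlongrightarrow> A + B) (at_right 0)"
        unfolding \<Theta>_def A_def B_def
        by (rule left_difference_quotient[OF theta_deriv t(2,3)]) (use elim in auto)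
      have AB: "A \<ge> 0" "B \<ge> 0"
        unfolding A_def B_def using elim pm_nonneg[OF t(1)] tanh1[of "W t"]
        by (auto simp: \<tau>_def abs_le_iff intro!: mult_nonneg_nonneg)
      \<comment> \<open>AM-GM for A and B. Their product is (D K)^2 dp dm exactly because the
        parameter is the minimiser: there p m = (D sinh w / w)^2, while 1 - \<tau>^2 = 1 / cosh^2
        w.\<close>
      have "2 * D t * K * sqrt (dp t * dm t) \<le> A + B"
      proof (rule power2_le_imp_le)
        have "p t * m t = (D t)\<^sup>2 * (sinh_tail 1 (W t))\<^sup>2"
          using D(2)[OF t(1)] by (simp only: W_def f_fun_eq)
        moreover have "1 - \<tau>\<^sup>2 = 1 / (cosh (W t))\<^sup>2"
          by (simp add: \<tau>_def one_minus_tanh_square)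
        ultimately have "(1 - \<tau>\<^sup>2) * (p t * m t) = (D t)\<^sup>2 * K\<^sup>2"
          by (simp add: K_def tanhc_eq power_divide)
        moreover have "A * B = (1 - \<tau>\<^sup>2) * (p t * m t) * (dp t * dm t)"
          by (simp add: A_def B_def power2_eq_square algebra_simps)
        ultimately have "4 * (A * B) = (2 * D t * K * sqrt (dp t * dm t))\<^sup>2"
          using elim by (simp add: power_mult_distrib)
        moreover have "4 * (A * B) \<le> (A + B)\<^sup>2"
          using zero_le_power2[of "A - B"] by (simp add: power2_eq_square algebra_simps)
        ultimately show "(2 * D t * K * sqrt (dp t * dm t))\<^sup>2 \<le> (A + B)\<^sup>2" by simp
      qed (use AB in simp)
      then have \<omega>: "sqrt (dp t * dm t) \<le> (A + B) / (2 * D t * K)"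
        using K Dt by (simp add: pos_le_divide_eq mult_ac)
      \<comment> \<open>The inequality for \<Theta> compares squares of \<open>D\<close>; the
        difference of squares is divided by D t + D (t - h), which monotonicity bounds by 2 D
        t.\<close>
      have quot: "(\<Theta> t - \<Theta> (t - h)) / h / (2 * D t * K) \<le> (D t - D (t - h)) / h" if "h \<in> {0<..<t}" for h
      proof -
        have h: "t - h \<in> {0..T}" "t - h \<le> t" "h > 0" using that t by auto
        have le: "D (t - h) \<le> D t" using Dmono h t by (auto simp: monotone_on_def)
        have "(D (t - h))\<^sup>2 * K \<le> \<Theta> (t - h)" using geW[OF h(1)] by (simp add: \<Theta>_def \<tau>_def K_def)
        moreover have "\<Theta> t = (D t)\<^sup>2 * K" using eqW[OF t(1)] by (simp add: \<Theta>_def \<tau>_def K_def)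
        ultimately have "\<Theta> t - \<Theta> (t - h) \<le> (D t - D (t - h)) * (D t + D (t - h)) * K"
          by (simp add: algebra_simps power2_eq_square)
        also have "\<dots> \<le> (D t - D (t - h)) * (2 * D t) * K"
          using le K by (intro mult_right_mono mult_left_mono) auto
        finally have "(\<Theta> t - \<Theta> (t - h)) / (2 * D t * K) \<le> D t - D (t - h)"
          using K Dt by (simp add: pos_divide_le_eq mult_ac)
        from divide_right_mono[OF this, of h] h show ?thesis by (simp add: mult_ac)
      qed
      show ?case
      proof (intro allI impI)
        fix c assume "c < sqrt (dp t * dm t)"
        then have "c < (A + B) / (2 * D t * K)" using \<omega> by simp
        moreover have "((\<lambda>h. (\<Theta> t - \<Theta> (t - h)) / h / (2 * D t * K)) \<longlongrightarrow> (A + B) / (2 * D t * K)) (at_right 0)"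
          using K Dt by (intro tendsto_divide lim tendsto_const) auto
        ultimately have "\<forall>\<^sub>F h in at_right 0. c < (\<Theta> t - \<Theta> (t - h)) / h / (2 * D t * K)"
          by (rule order_tendstoD(1)[rotated])
        moreover have "\<forall>\<^sub>F h in at_right 0. h \<in> {0<..<t}"
          using t by (intro eventually_at_right_real)
        ultimately show "\<forall>\<^sub>F h in at_right 0. c \<le> (D t - D (t - h)) / h"
        proof eventually_elim
          case (elim h)
          then show ?case using quot[of h] by simp
        qed
      qed
    qed
  qed
  also have "\<dots> \<le> D T" using D(1)[of 0] T by simp
  finally have "(LINT t|lebesgue_on {0..T}. sqrt (dp t * dm t)) \<le> D T" .
  moreover have "AE t in lebesgue_on {0..T}. 0 \<le> sqrt (dp t * dm t)"
    using der by eventually_elim auto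
  then have "0 \<le> (LINT t|lebesgue_on {0..T}. sqrt (dp t * dm t))"
    by (rule integral_nonneg_AE)
  ultimately have "(LINT t|lebesgue_on {0..T}. sqrt (dp t * dm t))\<^sup>2 \<le> (D T)\<^sup>2"
    by (intro power_mono)
  then have "(LINT t|lebesgue_on {0..T}. sqrt (dp t * dm t))\<^sup>2 * tanhc w \<le> (D T)\<^sup>2 * tanhc w"
    using tanhc_pos[of w] by (intro mult_right_mono) auto
  also have "\<dots> \<le> p T * m T - 4 * z T * tanh w" using geW T by simp
  finally show ?thesis .
qed

text \<open>A curve starting at the origin is moved into the interior of the cone by the left
  translation by \<open>(\<epsilon>, 0, 0)\<close>.\<close>

lemma (in causal_curve) length_estimate:
  assumes "p 0 = 0" "m 0 = 0" "z 0 = 0"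
  shows "(LINT t|lebesgue_on {0..T}. sqrt (dp t * dm t))\<^sup>2 * tanhc w \<le> p T * m T - 4 * z T * tanh w"
proof -
  let ?L = "LINT t|lebesgue_on {0..T}. sqrt (dp t * dm t)"
  let ?g = "\<lambda>\<epsilon>. (p T + \<epsilon>) * (m T + \<epsilon>) - 4 * (z T + \<epsilon> * (p T - m T) / 4) * tanh w"
  have "?L\<^sup>2 * tanhc w \<le> ?g \<epsilon>" if "\<epsilon> > 0" for \<epsilon>
  proof -
    \<comment> \<open>Since y = (p - m) / 2, the group law adds \<epsilon> y / 2 to z. Left
      invariance leaves the controls, and so the length, unchanged.\<close>
    interpret shifted: causal_curve T "C + \<epsilon> * (C + C) / 4" "\<lambda>t. p t + \<epsilon>" "\<lambda>t. m t + \<epsilon>"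
      "\<lambda>t. z t + \<epsilon> * (p t - m t) / 4" dp dm
    proof
      fix s t assume "0 \<le> s" "s \<le> t" "t \<le> T"
      note L = lip[OF this]
      have nn: "0 \<le> \<epsilon> * (C + C) / 4 * (t - s)" using C that \<open>s \<le> t\<close> by simp
      have "\<bar>(p t - m t) - (p s - m s)\<bar> \<le> (C + C) * (t - s)"
        using L unfolding distrib_right by linarith
      from mult_left_mono[OF this, of "\<epsilon> / 4"] that
      have "\<bar>\<epsilon> / 4 * ((p t - m t) - (p s - m s))\<bar> \<le> \<epsilon> * (C + C) / 4 * (t - s)"
        by (simp add: abs_mult)
      moreover have "z t + \<epsilon> * (p t - m t) / 4 - (z s + \<epsilon> * (p s - m s) / 4)
          = (z t - z s) + \<epsilon> / 4 * ((p t - m t) - (p s - m s))" by (simp add: field_simps)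
      ultimately have "\<bar>z t + \<epsilon> * (p t - m t) / 4 - (z s + \<epsilon> * (p s - m s) / 4)\<bar>
          \<le> C * (t - s) + \<epsilon> * (C + C) / 4 * (t - s)"
        using L by linarith
      then show "\<bar>p t + \<epsilon> - (p s + \<epsilon>)\<bar> \<le> (C + \<epsilon> * (C + C) / 4) * (t - s) \<and>
          \<bar>m t + \<epsilon> - (m s + \<epsilon>)\<bar> \<le> (C + \<epsilon> * (C + C) / 4) * (t - s) \<and>
          \<bar>z t + \<epsilon> * (p t - m t) / 4 - (z s + \<epsilon> * (p s - m s) / 4)\<bar> \<le> (C + \<epsilon> * (C + C) / 4) * (t - s)"
        using L nn unfolding distrib_right[of C] by auto
    next
      show "AE t in lebesgue_on {0..T}. 0 \<le> dp t \<and> 0 \<le> dm t \<and>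
        ((\<lambda>t. p t + \<epsilon>) has_real_derivative dp t) (at t within {0..T}) \<and>
        ((\<lambda>t. m t + \<epsilon>) has_real_derivative dm t) (at t within {0..T}) \<and>
        ((\<lambda>t. z t + \<epsilon> * (p t - m t) / 4) has_real_derivative
          ((m t + \<epsilon>) * dp t - (p t + \<epsilon>) * dm t) / 4) (at t within {0..T})"
        using der
        by eventually_elim (auto intro!: derivative_eq_intros simp: algebra_simps diff_divide_distrib add_divide_distrib)
    qed (use T C that assms in auto)
    show ?thesis
      using shifted.length_estimate_positive_start[of w] that assms by simp
  qed
  \<comment> \<open>The left-hand side is free of \<epsilon>, so the bound survives the limit in
    which the translated curve returns to the original one.\<close>
  then have "\<forall>\<^sub>F \<epsilon> in at_right 0. ?L\<^sup>2 * tanhc w \<le> ?g \<epsilon>"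
    using eventually_at_right_less[of "0::real"] by (auto elim: eventually_mono)
  moreover have "(?g \<longlongrightarrow> (p T + 0) * (m T + 0) - 4 * (z T + 0 * (p T - m T) / 4) * tanh w) (at_right 0)"
    by (intro tendsto_intros) simp
  ultimately have "?L\<^sup>2 * tanhc w \<le> (p T + 0) * (m T + 0) - 4 * (z T + 0 * (p T - m T) / 4) * tanh w"
    by (intro tendsto_lowerbound[where F = "at_right 0"]) auto
  then show ?thesis by simp
qed

section \<open>The sub-Lorentzian distance\<close>

lemma horizontal_direction:
  "u\<^sub>1 *\<^sub>R X\<^sub>1 (x, y, z) + u\<^sub>2 *\<^sub>R X\<^sub>2 (x, y, z) = (u\<^sub>1, u\<^sub>2, (x * u\<^sub>2 - y * u\<^sub>1) / 2)"
  by (simp add: X\<^sub>1_def X\<^sub>2_def field_simps)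

lemma admissible_causal_curve:
  assumes adm: "admissible T q u\<^sub>1 u\<^sub>2" and q0: "q 0 = q\<^sub>0"
  obtains C where "causal_curve T C (\<lambda>t. fst (q t) + fst (snd (q t))) (\<lambda>t. fst (q t) - fst (snd (q t)))
    (\<lambda>t. snd (snd (q t))) (\<lambda>t. u\<^sub>1 t + u\<^sub>2 t) (\<lambda>t. u\<^sub>1 t - u\<^sub>2 t)"
proof -
  obtain C where C: "C-lipschitz_on {0..T} q" and T: "0 \<le> T"
    and der: "AE t in lebesgue_on {0..T}.
        (q has_vector_derivative (u\<^sub>1 t *\<^sub>R X\<^sub>1 (q t) + u\<^sub>2 t *\<^sub>R X\<^sub>2 (q t))) (at t within {0..T})"
    and u: "AE t in lebesgue_on {0..T}. \<bar>u\<^sub>2 t\<bar> \<le> u\<^sub>1 t"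
    using adm unfolding admissible_def horizontal_def by blast
  have "causal_curve T (2 * C) (\<lambda>t. fst (q t) + fst (snd (q t))) (\<lambda>t. fst (q t) - fst (snd (q t)))
    (\<lambda>t. snd (snd (q t))) (\<lambda>t. u\<^sub>1 t + u\<^sub>2 t) (\<lambda>t. u\<^sub>1 t - u\<^sub>2 t)"
  proof
    show "0 \<le> T" "0 \<le> 2 * C" using T lipschitz_on_nonneg[OF C] by auto
  next
    fix s t assume *: "0 \<le> s" "s \<le> t" "t \<le> T"
    have d: "dist (q t) (q s) \<le> C * (t - s)"
      using lipschitz_onD[OF C, of t s] * by (simp add: dist_real_def)
    have "\<bar>fst (q t) - fst (q s)\<bar> \<le> C * (t - s)"
      using order_trans[OF dist_fst_le d] by (simp add: dist_real_def)
    moreover have "\<bar>fst (snd (q t)) - fst (snd (q s))\<bar> \<le> C * (t - s)"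
      using order_trans[OF dist_fst_le order_trans[OF dist_snd_le d]] by (simp add: dist_real_def)
    moreover have "\<bar>snd (snd (q t)) - snd (snd (q s))\<bar> \<le> C * (t - s)"
      using order_trans[OF dist_snd_le order_trans[OF dist_snd_le d]] by (simp add: dist_real_def)
    ultimately show "\<bar>fst (q t) + fst (snd (q t)) - (fst (q s) + fst (snd (q s)))\<bar> \<le> 2 * C * (t - s) \<and>
      \<bar>fst (q t) - fst (snd (q t)) - (fst (q s) - fst (snd (q s)))\<bar> \<le> 2 * C * (t - s) \<and>
      \<bar>snd (snd (q t)) - snd (snd (q s))\<bar> \<le> 2 * C * (t - s)"
      unfolding mult.assoc by (auto simp: abs_le_iff)
  next
    show "AE t in lebesgue_on {0..T}. 0 \<le> u\<^sub>1 t + u\<^sub>2 t \<and> 0 \<le> u\<^sub>1 t - u\<^sub>2 t \<and>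
      ((\<lambda>t. fst (q t) + fst (snd (q t))) has_real_derivative u\<^sub>1 t + u\<^sub>2 t) (at t within {0..T}) \<and>
      ((\<lambda>t. fst (q t) - fst (snd (q t))) has_real_derivative u\<^sub>1 t - u\<^sub>2 t) (at t within {0..T}) \<and>
      ((\<lambda>t. snd (snd (q t))) has_real_derivative
        ((fst (q t) - fst (snd (q t))) * (u\<^sub>1 t + u\<^sub>2 t) - (fst (q t) + fst (snd (q t))) * (u\<^sub>1 t - u\<^sub>2 t)) / 4)
        (at t within {0..T})"
      using der u
    proof eventually_elim
      case (elim t)
      obtain x y z where q: "q t = (x, y, z)" by (cases "q t")
      have v: "(q has_vector_derivative (u\<^sub>1 t, u\<^sub>2 t, (x * u\<^sub>2 t - y * u\<^sub>1 t) / 2)) (at t within {0..T})"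
        using elim(1) unfolding q horizontal_direction .
      from bounded_linear.has_vector_derivative[OF bounded_linear_fst v]
      have 1: "((\<lambda>t. fst (q t)) has_real_derivative u\<^sub>1 t) (at t within {0..T})"
        by (simp add: has_real_derivative_iff_has_vector_derivative)
      note v' = bounded_linear.has_vector_derivative[OF bounded_linear_snd v]
      from bounded_linear.has_vector_derivative[OF bounded_linear_fst v']
      have 2: "((\<lambda>t. fst (snd (q t))) has_real_derivative u\<^sub>2 t) (at t within {0..T})"
        by (simp add: has_real_derivative_iff_has_vector_derivative)
      from bounded_linear.has_vector_derivative[OF bounded_linear_snd v']
      have 3: "((\<lambda>t. snd (snd (q t))) has_real_derivative (x * u\<^sub>2 t - y * u\<^sub>1 t) / 2) (at t within {0..T})"
        by (simp add: has_real_derivative_iff_has_vector_derivative)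
      have "(x * u\<^sub>2 t - y * u\<^sub>1 t) / 2 = ((x - y) * (u\<^sub>1 t + u\<^sub>2 t) - (x + y) * (u\<^sub>1 t - u\<^sub>2 t)) / 4"
        by (simp add: field_simps)
      with 1 2 3 elim(2) show ?case
        by (auto simp: q intro: DERIV_add DERIV_diff)
    qed
  next
    show "0 \<le> fst (q 0) + fst (snd (q 0))" "0 \<le> fst (q 0) - fst (snd (q 0))"
      by (simp_all add: q0 q\<^sub>0_def)
  qed
  then show ?thesis by (rule that)
qed

lemma sl_length_null: "sl_length T u\<^sub>1 u\<^sub>2 = (LINT t|lebesgue_on {0..T}. sqrt ((u\<^sub>1 t + u\<^sub>2 t) * (u\<^sub>1 t - u\<^sub>2 t)))"
  unfolding sl_length_def by (simp add: power2_eq_square algebra_simps)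

lemma admissible_estimates:
  assumes adm: "admissible T q u\<^sub>1 u\<^sub>2" and q0: "q 0 = q\<^sub>0" and qT: "q T = (x, y, z)"
  shows "(sl_length T u\<^sub>1 u\<^sub>2)\<^sup>2 * tanhc w \<le> x\<^sup>2 - y\<^sup>2 - 4 * z * tanh w"
    and "\<bar>y\<bar> \<le> x" and "4 * \<bar>z\<bar> \<le> x\<^sup>2 - y\<^sup>2"
proof -
  obtain C where "causal_curve T C (\<lambda>t. fst (q t) + fst (snd (q t))) (\<lambda>t. fst (q t) - fst (snd (q t)))
    (\<lambda>t. snd (snd (q t))) (\<lambda>t. u\<^sub>1 t + u\<^sub>2 t) (\<lambda>t. u\<^sub>1 t - u\<^sub>2 t)"
    using admissible_causal_curve[OF adm q0] .
  then interpret causal_curve T C "\<lambda>t. fst (q t) + fst (snd (q t))" "\<lambda>t. fst (q t) - fst (snd (q t))"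
    "\<lambda>t. snd (snd (q t))" "\<lambda>t. u\<^sub>1 t + u\<^sub>2 t" "\<lambda>t. u\<^sub>1 t - u\<^sub>2 t" .
  have xy: "x\<^sup>2 - y\<^sup>2 = (x + y) * (x - y)" by (simp add: power2_eq_square algebra_simps)
  show "(sl_length T u\<^sub>1 u\<^sub>2)\<^sup>2 * tanhc w \<le> x\<^sup>2 - y\<^sup>2 - 4 * z * tanh w"
    using length_estimate[of w] unfolding sl_length_null xy by (simp add: q0 q\<^sub>0_def qT)
  show "\<bar>y\<bar> \<le> x" using pm_nonneg[of T] T by (auto simp: qT abs_le_iff)
  show "4 * \<bar>z\<bar> \<le> x\<^sup>2 - y\<^sup>2"
    using theta_mono[of 1 0 T] theta_mono[of "-1" 0 T] T unfolding xy by (auto simp: q0 q\<^sub>0_def qT)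
qed

section \<open>Strictness on the chronological future\<close>

text \<open>Equality at time \<open>T\<close> would make the nondecreasing function with \<tau> = 1
  or -1 vanish identically. Its derivative at a good time t is 2 p dm or 2 m dp, so p or m is 0 at
  t, hence on all of [0, t], which contradicts a positive derivative there.\<close>

lemma (in causal_curve) timelike_strict:
  assumes "0 < T" and zero: "p 0 = 0" "m 0 = 0" "z 0 = 0"
    and pos: "AE t in lebesgue_on {0..T}. 0 < dp t \<and> 0 < dm t"
  shows "4 * \<bar>z T\<bar> < p T * m T"
proof (rule ccontr)
  assume neg: "\<not> 4 * \<bar>z T\<bar> < p T * m T"
  \<comment> \<open>An interval of positive length is not null, so one time exists at which all the
    almost everywhere conditions hold together.\<close>
  have "ae_filter (lebesgue_on {0..T}) \<noteq> bot"
    using \<open>0 < T\<close> by (simp add: ae_filter_eq_bot_iff emeasure_restrict_space)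
  moreover have "AE t in lebesgue_on {0..T}. 0 < t \<and> t \<le> T \<and> 0 < dp t \<and> 0 < dm t \<and>
      (p has_real_derivative dp t) (at t within {0..T}) \<and>
      (m has_real_derivative dm t) (at t within {0..T}) \<and>
      (z has_real_derivative (m t * dp t - p t * dm t) / 4) (at t within {0..T})"
    using der pos AE_space[of "lebesgue_on {0..T}"] AE_lebesgue_on_neq[where a = 0 and b = T and c = 0]
    by eventually_elim auto
  ultimately obtain t where t: "0 < t" "t \<le> T" "0 < dp t" "0 < dm t"
      "(p has_real_derivative dp t) (at t within {0..T})"
      "(m has_real_derivative dm t) (at t within {0..T})"
      "(z has_real_derivative (m t * dp t - p t * dm t) / 4) (at t within {0..T})"
    using eventually_happens' by blast
  have flat: "d = 0" if F: "(F has_real_derivative d) (at t within {0..T})" "\<And>s. 0 \<le> s \<Longrightarrow> s \<le> t \<Longrightarrow> F s = 0" for F d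
  proof -
    have "\<forall>\<^sub>F h in at_right 0. h \<in> {0<..<t}" using t by (intro eventually_at_right_real)
    then have "\<forall>\<^sub>F h in at_right 0. (F t - F (t - h)) / h = 0"
      by eventually_elim (use F(2) t in auto)
    then have "((\<lambda>h. (F t - F (t - h)) / h) \<longlongrightarrow> 0) (at_right 0)" by (rule tendsto_eventually)
    with left_difference_quotient[OF F(1) t(1,2)] show ?thesis
      using tendsto_unique[OF trivial_limit_at_right_real] by blast
  qed
  define \<tau> :: real where "\<tau> = (if z T \<ge> 0 then 1 else - 1)"
  have \<tau>: "\<bar>\<tau>\<bar> \<le> 1" "z T * \<tau> = \<bar>z T\<bar>" by (auto simp: \<tau>_def)
  have "p s * m s - 4 * z s * \<tau> = 0" if "0 \<le> s" "s \<le> t" for s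
    using theta_mono[OF \<tau>(1), of 0 s] theta_mono[OF \<tau>(1), of s T] that t neg zero \<tau>(2) by (simp add: mult.assoc)
  from flat[OF theta_deriv[OF t(5-7)] this]
  have "(1 - \<tau>) * (m t * dp t) + (1 + \<tau>) * (p t * dm t) = 0" .
  then consider "p t = 0" | "m t = 0" using t by (auto simp: \<tau>_def split: if_splits)
  then show False
  proof cases
    case 1
    have "p s = 0" if "0 \<le> s" "s \<le> t" for s
      using p_mono[of s t] pm_nonneg[of s] 1 that t by auto
    from flat[OF t(5) this] t show False by simp
  next
    case 2
    have "m s = 0" if "0 \<le> s" "s \<le> t" for s
      using m_mono[of s t] pm_nonneg[of s] 2 that t by auto
    from flat[OF t(6) this] t show False by simp
  qed
qed

lemma chronological_future_strict:
  assumes "(x, y, z) \<in> chronological_future q\<^sub>0"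
  shows "0 < x" "4 * \<bar>z\<bar> < x\<^sup>2 - y\<^sup>2"
proof -
  obtain T q u\<^sub>1 u\<^sub>2 where Tpos: "0 < T" and tl: "timelike T q u\<^sub>1 u\<^sub>2" and q: "q 0 = q\<^sub>0" "q T = (x, y, z)"
    using assms unfolding chronological_future_def by blast
  have u: "AE t in lebesgue_on {0..T}. u\<^sub>1 t > \<bar>u\<^sub>2 t\<bar>" using tl by (simp add: timelike_def)
  then have "AE t in lebesgue_on {0..T}. u\<^sub>1 t \<ge> \<bar>u\<^sub>2 t\<bar>" by eventually_elim simp
  then have adm: "admissible T q u\<^sub>1 u\<^sub>2" using tl by (simp add: timelike_def admissible_def)
  obtain C where "causal_curve T C (\<lambda>t. fst (q t) + fst (snd (q t))) (\<lambda>t. fst (q t) - fst (snd (q t)))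
    (\<lambda>t. snd (snd (q t))) (\<lambda>t. u\<^sub>1 t + u\<^sub>2 t) (\<lambda>t. u\<^sub>1 t - u\<^sub>2 t)"
    using admissible_causal_curve[OF adm q(1)] .
  then interpret causal_curve T C "\<lambda>t. fst (q t) + fst (snd (q t))" "\<lambda>t. fst (q t) - fst (snd (q t))"
    "\<lambda>t. snd (snd (q t))" "\<lambda>t. u\<^sub>1 t + u\<^sub>2 t" "\<lambda>t. u\<^sub>1 t - u\<^sub>2 t" .
  have pos: "AE t in lebesgue_on {0..T}. 0 < u\<^sub>1 t + u\<^sub>2 t \<and> 0 < u\<^sub>1 t - u\<^sub>2 t"
    using u by eventually_elim auto
  have "4 * \<bar>z\<bar> < (x + y) * (x - y)"
    using timelike_strict[OF Tpos _ _ _ pos] by (simp add: q q\<^sub>0_def)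
  then show 1: "4 * \<bar>z\<bar> < x\<^sup>2 - y\<^sup>2" by (simp add: power2_eq_square algebra_simps)
  have "\<bar>y\<bar> \<le> x" using admissible_estimates(2)[OF adm q] .
  then show "0 < x" using 1 by (cases "x = 0") auto
qed

section \<open>Curves that realise the distance\<close>

lemma C1_curve_lipschitz:
  fixes q :: "real \<Rightarrow> 'a::real_normed_vector"
  assumes "\<And>t. t \<in> {a..b} \<Longrightarrow> (q has_vector_derivative v t) (at t within {a..b})" "continuous_on {a..b} v"
  shows "\<exists>C. C-lipschitz_on {a..b} q"
proof -
  have "bounded (v ` {a..b})" by (intro compact_imp_bounded compact_continuous_image assms compact_Icc)
  then obtain B where B: "B > 0" "\<And>t. t \<in> {a..b} \<Longrightarrow> norm (v t) \<le> B" unfolding bounded_pos by blast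
  have "B-lipschitz_on {a..b} q"
  proof (rule bounded_derivative_imp_lipschitz)
    show "(q has_derivative (\<lambda>h. h *\<^sub>R v t)) (at t within {a..b})" if "t \<in> {a..b}" for t
      using assms(1)[OF that] by (simp add: has_vector_derivative_def)
    show "onorm (\<lambda>h. h *\<^sub>R v t) \<le> B" if "t \<in> {a..b}" for t
    proof (rule onorm_bound)
      show "norm (h *\<^sub>R v t) \<le> B * norm h" for h :: real
        using mult_left_mono[OF B(2)[OF that], of "\<bar>h\<bar>"] by (simp add: mult.commute)
    qed (use B in simp)
  qed (use B in auto)
  then show ?thesis ..
qed

lemma admissible_C1:
  assumes der: "\<And>t. (x has_real_derivative u\<^sub>1 t) (at t)" "\<And>t. (y has_real_derivative u\<^sub>2 t) (at t)"
      "\<And>t. (z has_real_derivative (x t * u\<^sub>2 t - y t * u\<^sub>1 t) / 2) (at t)"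
    and cont: "continuous_on UNIV u\<^sub>1" "continuous_on UNIV u\<^sub>2"
    and le: "\<And>t. \<bar>u\<^sub>2 t\<bar> \<le> u\<^sub>1 t" and "0 \<le> T"
  shows "admissible T (\<lambda>t. (x t, y t, z t)) u\<^sub>1 u\<^sub>2"
proof -
  define v where "v t = (u\<^sub>1 t, u\<^sub>2 t, (x t * u\<^sub>2 t - y t * u\<^sub>1 t) / 2)" for t
  have v: "((\<lambda>t. (x t, y t, z t)) has_vector_derivative v t) (at t within S)" for t S
    unfolding v_def
    by (intro has_vector_derivative_Pair)
      (use der in \<open>auto simp: has_real_derivative_iff_has_vector_derivative intro: has_vector_derivative_at_within\<close>)
  have "continuous_on UNIV x" "continuous_on UNIV y"
    using der by (auto intro!: continuous_at_imp_continuous_on DERIV_isCont)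
  then have "continuous_on {0..T} v"
    unfolding v_def using cont by (intro continuous_intros) (auto intro: continuous_on_subset)
  from C1_curve_lipschitz[OF v this] show ?thesis
    using v le \<open>0 \<le> T\<close> unfolding admissible_def horizontal_def horizontal_direction v_def by auto
qed

text \<open>With the hyperbolic angle taken at the midpoint \<psi> + c / 2 the parameters separate:
  c alone determines z and the hyperbola in that plane, the angle moves the point along it. This
  also absorbs the case c = 0.\<close>

lemma Exp_coordinates:
  "Exp \<psi> c 1 = (sinh_tail 1 (c / 2) * cosh (\<psi> + c / 2), sinh_tail 1 (c / 2) * sinh (\<psi> + c / 2), alpha (c / 2))"
proof (cases "c = 0")
  case False
  have s: "sinh_tail 1 (c / 2) = sinh (c / 2) * 2 / c"
    using sinh_conv_tail[of "c / 2"] False by (simp add: field_simps)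
  have 1: "sinh (\<psi> + c) - sinh \<psi> = 2 * sinh (c / 2) * cosh (\<psi> + c / 2)"
    using sinh_add[of "\<psi> + c / 2" "c / 2"] sinh_diff[of "\<psi> + c / 2" "c / 2"] by (simp add: add.commute)
  have 2: "cosh (\<psi> + c) - cosh \<psi> = 2 * sinh (c / 2) * sinh (\<psi> + c / 2)"
    using cosh_add[of "\<psi> + c / 2" "c / 2"] cosh_diff[of "\<psi> + c / 2" "c / 2"] by (simp add: add.commute)
  show ?thesis
    using False a_fun_eq_alpha[of c] unfolding Exp_def a_fun_def s by (simp add: 1 2)
qed (simp add: Exp_def)

lemma cosh_ge_abs_sinh: "\<bar>sinh x\<bar> \<le> cosh x" for x :: real
  using sinh_less_cosh_real[of x] sinh_less_cosh_real[of "- x"] by (auto simp: abs_le_iff)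

text \<open>The dilation \<open>(x, y, z) \<mapsto> (R * x, R * y, R\<^sup>2 * z)\<close> multiplies lengths by \<open>R\<close>.\<close>

lemma dilated_Exp_reached:
  assumes "R > 0" "Exp \<psi> c 1 = (x, y, z)"
  shows "\<exists>q u\<^sub>1 u\<^sub>2. admissible 1 q u\<^sub>1 u\<^sub>2 \<and> q 0 = q\<^sub>0 \<and> q 1 = (R * x, R * y, R\<^sup>2 * z) \<and> sl_length 1 u\<^sub>1 u\<^sub>2 = R"
proof -
  define u\<^sub>1 u\<^sub>2 where "u\<^sub>1 t = R * cosh (\<psi> + c * t)" and "u\<^sub>2 t = R * sinh (\<psi> + c * t)" for t
  have cont: "continuous_on UNIV u\<^sub>1" "continuous_on UNIV u\<^sub>2"
    unfolding u\<^sub>1_def u\<^sub>2_def by (intro continuous_intros)+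
  have le: "\<bar>u\<^sub>2 t\<bar> \<le> u\<^sub>1 t" for t
    unfolding u\<^sub>1_def u\<^sub>2_def using assms(1) cosh_ge_abs_sinh by (simp add: abs_mult)
  have "(u\<^sub>1 t)\<^sup>2 - (u\<^sub>2 t)\<^sup>2 = R\<^sup>2" for t
    by (simp add: u\<^sub>1_def u\<^sub>2_def power_mult_distrib cosh_square_eq algebra_simps)
  then have len: "sl_length 1 u\<^sub>1 u\<^sub>2 = R"
    using assms(1) by (simp add: sl_length_def measure_restrict_space)
  show ?thesis
  proof (cases "c = 0")
    case True
    have "admissible 1 (\<lambda>t. (R * cosh \<psi> * t, R * sinh \<psi> * t, 0)) u\<^sub>1 u\<^sub>2"
      by (rule admissible_C1[OF _ _ _ cont le])
        (auto intro!: derivative_eq_intros simp: u\<^sub>1_def u\<^sub>2_def True)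
    then show ?thesis using len assms(2) True
      by (intro exI[of _ "\<lambda>t. (R * cosh \<psi> * t, R * sinh \<psi> * t, 0)"] exI[of _ u\<^sub>1] exI[of _ u\<^sub>2])
        (auto simp: Exp_def q\<^sub>0_def)
  next
    case False
    define X Y Z where "X t = R * ((sinh (\<psi> + c * t) - sinh \<psi>) / c)"
      and "Y t = R * ((cosh (\<psi> + c * t) - cosh \<psi>) / c)"
      and "Z t = R\<^sup>2 * ((sinh (c * t) - c * t) / (2 * c\<^sup>2))" for t
    have 1: "(X has_real_derivative u\<^sub>1 t) (at t)" for t
      unfolding X_def u\<^sub>1_def using False by (auto intro!: derivative_eq_intros)
    have 2: "(Y has_real_derivative u\<^sub>2 t) (at t)" for t
      unfolding Y_def u\<^sub>2_def using False by (auto intro!: derivative_eq_intros)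
    have 3: "(Z has_real_derivative (X t * u\<^sub>2 t - Y t * u\<^sub>1 t) / 2) (at t)" for t
    proof -
      have "(Z has_real_derivative R\<^sup>2 * ((cosh (c * t) - 1) / (2 * c))) (at t)"
        unfolding Z_def using False by (auto intro!: derivative_eq_intros simp: power2_eq_square field_simps)
      moreover have bracket: "cosh (c * t) - 1 = (sinh (\<psi> + c * t) - sinh \<psi>) * sinh (\<psi> + c * t)
          - (cosh (\<psi> + c * t) - cosh \<psi>) * cosh (\<psi> + c * t)"
      proof -
        have "cosh (c * t) = cosh (\<psi> + c * t) * cosh \<psi> - sinh (\<psi> + c * t) * sinh \<psi>"
          using cosh_diff[of "\<psi> + c * t" \<psi>] by simp
        then show ?thesis using cosh_square_eq[of "\<psi> + c * t"]
          by (simp add: power2_eq_square algebra_simps)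
      qed
      have "X t * u\<^sub>2 t - Y t * u\<^sub>1 t = R\<^sup>2 * ((cosh (c * t) - 1) / c)"
        unfolding bracket X_def Y_def u\<^sub>1_def u\<^sub>2_def using False
        by (simp add: power2_eq_square field_simps)
      ultimately show ?thesis by (simp add: mult.commute)
    qed
    have "admissible 1 (\<lambda>t. (X t, Y t, Z t)) u\<^sub>1 u\<^sub>2"
      by (rule admissible_C1[OF 1 2 3 cont le]) simp
    then show ?thesis using len assms(2) False
      by (intro exI[of _ "\<lambda>t. (X t, Y t, Z t)"] exI[of _ u\<^sub>1] exI[of _ u\<^sub>2])
        (auto simp: Exp_def q\<^sub>0_def X_def Y_def Z_def)
  qed
qed

lemma profile_point_reached:
  assumes R: "R > 0" and x: "x > 0" and eq: "x\<^sup>2 - y\<^sup>2 = R\<^sup>2 * f_fun (z / R\<^sup>2)"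
  shows "\<exists>q u\<^sub>1 u\<^sub>2. admissible 1 q u\<^sub>1 u\<^sub>2 \<and> q 0 = q\<^sub>0 \<and> q 1 = (x, y, z) \<and> sl_length 1 u\<^sub>1 u\<^sub>2 = R"
proof -
  define w where "w = k_fun (z / R\<^sup>2)"
  define s where "s = sinh_tail 1 w"
  \<comment> \<open>The height fixes w, then y fixes the midpoint angle \<theta>, and
    \<open>x > 0\<close> selects the branch. The starting angle is \<theta> - w, because c = 2
    w.\<close>
  define \<theta> where "\<theta> = arsinh (y / (R * s))"
  have s: "s > 0" using sinh_tail_1_ge[of w] by (simp add: s_def)
  have y: "R * (s * sinh \<theta>) = y" using R s by (simp add: \<theta>_def)
  have "x\<^sup>2 - y\<^sup>2 = R\<^sup>2 * s\<^sup>2" using eq by (simp only: f_fun_eq w_def s_def)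
  moreover have "(R * (s * sinh \<theta>))\<^sup>2 + R\<^sup>2 * s\<^sup>2 = (R * (s * cosh \<theta>))\<^sup>2"
    by (simp only: power_mult_distrib cosh_square_eq) (simp add: algebra_simps)
  ultimately have sq: "(R * (s * cosh \<theta>))\<^sup>2 = x\<^sup>2" unfolding y by linarith
  have "0 < R * (s * cosh \<theta>)" using R s cosh_real_pos[of \<theta>] by simp
  then have x': "R * (s * cosh \<theta>) = x" using sq x by (simp add: power2_eq_iff_nonneg)
  have "Exp (\<theta> - w) (2 * w) 1 = (s * cosh \<theta>, s * sinh \<theta>, z / R\<^sup>2)"
    by (simp add: Exp_coordinates s_def) (simp add: w_def)
  from dilated_Exp_reached[OF R this] show ?thesis using R by (simp add: x' y)
qed

text \<open>For the parameter \<open>k_fun (z / R\<^sup>2)\<close> the length estimate and the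
  equation of the point share the term 4 z tanh w, so L^2 <= R^2 remains. A curve of length
  \<open>R\<close> makes the supremum a maximum.\<close>

lemma sl_dist_eqI:
  assumes R: "R > 0" and x: "x > 0" and eq: "x\<^sup>2 - y\<^sup>2 = R\<^sup>2 * f_fun (z / R\<^sup>2)"
  shows "(x, y, z) \<in> causal_future q\<^sub>0" and "sl_dist q\<^sub>0 (x, y, z) = ereal R"
proof -
  obtain q u\<^sub>1 u\<^sub>2 where q: "admissible 1 q u\<^sub>1 u\<^sub>2" "q 0 = q\<^sub>0" "q 1 = (x, y, z)" "sl_length 1 u\<^sub>1 u\<^sub>2 = R"
    using profile_point_reached[OF assms] by blast
  show "(x, y, z) \<in> causal_future q\<^sub>0" using q unfolding causal_future_def by blast
  have le: "sl_length T v\<^sub>1 v\<^sub>2 \<le> R"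
    if v: "admissible T r v\<^sub>1 v\<^sub>2" "r 0 = q\<^sub>0" "r T = (x, y, z)" for T r v\<^sub>1 v\<^sub>2
  proof -
    have "(sl_length T v\<^sub>1 v\<^sub>2)\<^sup>2 * tanhc (k_fun (z / R\<^sup>2)) \<le> R\<^sup>2 * tanhc (k_fun (z / R\<^sup>2))"
      using admissible_estimates(1)[OF v, of "k_fun (z / R\<^sup>2)"] f_fun_scaled_eq[OF R, of z] eq by simp
    then have "(sl_length T v\<^sub>1 v\<^sub>2)\<^sup>2 \<le> R\<^sup>2" using tanhc_pos by simp
    then show ?thesis by (rule power2_le_imp_le) (use R in simp)
  qed
  show "sl_dist q\<^sub>0 (x, y, z) = ereal R"
    unfolding sl_dist_def
  proof (rule antisym)
    show "Sup {ereal (sl_length T u\<^sub>1 u\<^sub>2) |T q u\<^sub>1 u\<^sub>2. admissible T q u\<^sub>1 u\<^sub>2 \<and> q 0 = q\<^sub>0 \<and> q T = (x, y, z)} \<le> ereal R"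
      by (rule Sup_least) (use le in auto)
    show "ereal R \<le> Sup {ereal (sl_length T u\<^sub>1 u\<^sub>2) |T q u\<^sub>1 u\<^sub>2. admissible T q u\<^sub>1 u\<^sub>2 \<and> q 0 = q\<^sub>0 \<and> q T = (x, y, z)}"
      by (rule Sup_upper) (use q in blast)
  qed
qed

section \<open>Description of the sphere and the ball\<close>

lemma causal_future_q0:
  assumes "(x, y, z) \<in> causal_future q\<^sub>0"
  shows "\<bar>y\<bar> \<le> x" "4 * \<bar>z\<bar> \<le> x\<^sup>2 - y\<^sup>2"
proof -
  obtain T q u\<^sub>1 u\<^sub>2 where "admissible T q u\<^sub>1 u\<^sub>2" "q 0 = q\<^sub>0" "q T = (x, y, z)"
    using assms unfolding causal_future_def by blast
  from admissible_estimates(2,3)[OF this] show "\<bar>y\<bar> \<le> x" "4 * \<bar>z\<bar> \<le> x\<^sup>2 - y\<^sup>2" .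
qed

lemma unit_sphere_eq: "unit_sphere = {(x, y, z). x = sqrt (y\<^sup>2 + f_fun z)}"
proof -
  have "x = sqrt (y\<^sup>2 + f_fun z)" if "(x, y, z) \<in> unit_sphere" for x y z
  proof -
    have J: "(x, y, z) \<in> causal_future q\<^sub>0" and d: "sl_dist q\<^sub>0 (x, y, z) = 1"
      using that by (auto simp: unit_sphere_def)
    \<comment> \<open>Boundary points of the cone must be excluded. Distance 1 provides a curve of
      some positive length L, and 4|z| < L^2 f(z / L^2) <= x^2 - y^2 places the point strictly
      inside.\<close>
    have "0 < sl_dist q\<^sub>0 (x, y, z)" using d by simp
    then obtain T q u\<^sub>1 u\<^sub>2 where q: "admissible T q u\<^sub>1 u\<^sub>2" "q 0 = q\<^sub>0" "q T = (x, y, z)"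
        and "0 < ereal (sl_length T u\<^sub>1 u\<^sub>2)"
      unfolding sl_dist_def less_Sup_iff by blast
    then have L: "0 < sl_length T u\<^sub>1 u\<^sub>2" by simp
    have "4 * \<bar>z\<bar> < (sl_length T u\<^sub>1 u\<^sub>2)\<^sup>2 * f_fun (z / (sl_length T u\<^sub>1 u\<^sub>2)\<^sup>2)"
      by (rule f_fun_scaled_greater[OF L])
    also have "\<dots> \<le> x\<^sup>2 - y\<^sup>2"
      using admissible_estimates(1)[OF q, of "k_fun (z / (sl_length T u\<^sub>1 u\<^sub>2)\<^sup>2)"] f_fun_scaled_eq[OF L, of z] by simp
    finally have strict: "4 * \<bar>z\<bar> < x\<^sup>2 - y\<^sup>2" .
    then have x: "0 < x" using causal_future_q0(1)[OF J] by (cases "x = 0") auto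
    obtain R where R: "R > 0" "x\<^sup>2 - y\<^sup>2 = R\<^sup>2 * f_fun (z / R\<^sup>2)" using f_fun_scaled_surj[OF strict] by blast
    have "R = 1" using sl_dist_eqI(2)[OF R(1) x R(2)] d by (simp add: one_ereal_def)
    then have "x\<^sup>2 = y\<^sup>2 + f_fun z" using R by simp
    then show ?thesis using x by (metis less_imp_le real_sqrt_unique)
  qed
  moreover have "(sqrt (y\<^sup>2 + f_fun z), y, z) \<in> unit_sphere" for y z
  proof -
    have "y\<^sup>2 + f_fun z > 0" using f_fun_ge_1[of z] by (simp add: add_nonneg_pos)
    then have "0 < sqrt (y\<^sup>2 + f_fun z)" "(sqrt (y\<^sup>2 + f_fun z))\<^sup>2 - y\<^sup>2 = 1\<^sup>2 * f_fun (z / 1\<^sup>2)" by auto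
    from sl_dist_eqI[OF _ this] show ?thesis by (simp add: unit_sphere_def one_ereal_def)
  qed
  ultimately show ?thesis by auto
qed

text \<open>This is monotonicity of R^2 f(z / R^2) in R. It follows without derivatives by testing
  with the w that is optimal for \<open>R\<close> in one direction and for 1 in the other.\<close>

lemma unit_ball_interior:
  assumes "x > 0" "4 * \<bar>z\<bar> < x\<^sup>2 - y\<^sup>2"
  shows "(x, y, z) \<in> unit_ball \<longleftrightarrow> x\<^sup>2 - y\<^sup>2 \<le> f_fun z"
proof -
  obtain R where R: "R > 0" "x\<^sup>2 - y\<^sup>2 = R\<^sup>2 * f_fun (z / R\<^sup>2)" using f_fun_scaled_surj[OF assms(2)] by blast
  note d = sl_dist_eqI[OF R(1) assms(1) R(2)]
  have "R \<le> 1 \<longleftrightarrow> x\<^sup>2 - y\<^sup>2 \<le> f_fun z"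
  proof
    assume "R \<le> 1"
    define w where "w = k_fun (z / R\<^sup>2)"
    have "R\<^sup>2 \<le> 1" using \<open>R \<le> 1\<close> R(1) by (simp add: power_le_one)
    then have "R\<^sup>2 * tanhc w \<le> 1 * tanhc w" using tanhc_pos[of w] by (intro mult_right_mono) auto
    then show "x\<^sup>2 - y\<^sup>2 \<le> f_fun z"
      using f_fun_scaled_eq[OF R(1), of z] f_fun_scaled_ge[of 1 z w] R(2) by (simp add: w_def)
  next
    assume le: "x\<^sup>2 - y\<^sup>2 \<le> f_fun z"
    define w where "w = k_fun z"
    have "R\<^sup>2 * tanhc w \<le> 1 * tanhc w"
      using f_fun_scaled_ge[OF R(1), of z w] f_fun_scaled_eq[of 1 z] R(2) le by (simp add: w_def)
    then have "R\<^sup>2 \<le> 1\<^sup>2" using tanhc_pos[of w] by simp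
    then show "R \<le> 1" by (rule power2_le_imp_le) simp
  qed
  then show ?thesis using d by (simp add: unit_ball_def)
qed

section \<open>The sphere and its sections\<close>

lemma real_analytic_at_Pair:
  assumes "real_analytic_at F p" "real_analytic_at G p"
  shows "real_analytic_at (\<lambda>x. (F x, G x)) p"
proof -
  have "real_analytic_at (\<lambda>x. (F x, 0) + (0, G x)) p"
    using assms
    by (intro real_analytic_at_add real_analytic_at_bounded_linear[OF _ bounded_linear_Pair]
        bounded_linear_ident bounded_linear_zero)
  then show ?thesis by simp
qed

lemma real_analytic_at_coordinates:
  fixes p :: "real \<times> real \<times> real"
  shows "real_analytic_at (\<lambda>q. fst q) p" "real_analytic_at (\<lambda>q. fst (snd q)) p"
    "real_analytic_at (\<lambda>q. snd (snd q)) p"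
  by (intro real_analytic_at_linear bounded_linear_intros)+

lemma real_analytic_at_coordinates2:
  fixes p :: "real \<times> real"
  shows "real_analytic_at (\<lambda>q. fst q) p" "real_analytic_at (\<lambda>q. snd q) p"
  by (intro real_analytic_at_linear bounded_linear_intros)+

lemma real_analytic_at_minus:
  fixes F G :: "'a::euclidean_space \<Rightarrow> real"
  assumes "real_analytic_at F p" "real_analytic_at G p"
  shows "real_analytic_at (\<lambda>x. F x - G x) p"
  using real_analytic_at_add[OF assms(1) real_analytic_at_bounded_linear[OF assms(2) bounded_linear_minus[OF bounded_linear_ident]]]
  by simp

lemma real_analytic_at_cmult:
  fixes F :: "'a::euclidean_space \<Rightarrow> real"
  assumes "real_analytic_at F p"
  shows "real_analytic_at (\<lambda>x. c * F x) p"
  by (rule real_analytic_at_bounded_linear[OF assms bounded_linear_mult_right])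

section \<open>The sphere as an analytic submanifold\<close>

definition sphere_x :: "real \<Rightarrow> real \<Rightarrow> real" where
  "sphere_x y z = sqrt (y\<^sup>2 + f_fun z)"

lemma sphere_x_radicand: "y\<^sup>2 + f_fun z > 0"
  using f_fun_ge_1[of z] by (simp add: add_nonneg_pos)

lemma sphere_x_pos: "sphere_x y z > 0"
  using sphere_x_radicand by (simp add: sphere_x_def)

lemma sphere_x_square: "(sphere_x y z)\<^sup>2 = y\<^sup>2 + f_fun z"
  using sphere_x_radicand[of y z] by (simp add: sphere_x_def)

lemma sphere_x_unique: "x > 0 \<Longrightarrow> x\<^sup>2 = y\<^sup>2 + f_fun z \<Longrightarrow> x = sphere_x y z"
  by (simp add: sphere_x_def real_sqrt_unique)

lemma mem_unit_sphere: "(x, y, z) \<in> unit_sphere \<longleftrightarrow> x = sphere_x y z"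
  by (simp add: unit_sphere_eq sphere_x_def)

lemma mem_unit_sphere': "(x, y, z) \<in> unit_sphere \<longleftrightarrow> x > 0 \<and> x\<^sup>2 - y\<^sup>2 = f_fun z"
  using sphere_x_pos[of y z] sphere_x_square[of y z] sphere_x_unique[of x y z]
  by (auto simp: mem_unit_sphere)

lemma real_analytic_at_sphere_x:
  assumes "real_analytic_at Y p" "real_analytic_at Z p"
  shows "real_analytic_at (\<lambda>q. sphere_x (Y q) (Z q)) p"
  unfolding sphere_x_def
  by (intro real_analytic_at_germ_compose[OF _ analytic_germ_sqrt] sphere_x_radicand real_analytic_at_add
      real_analytic_at_power assms real_analytic_at_germ_compose[OF assms(2) analytic_germ_f_fun])

text \<open>One global chart is enough: the shear that subtracts the graph function from x carries
  the graph onto the plane x = 0, and adding the function inverts it.\<close>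

lemma regular_unit_sphere: "regular_analytic_submanifold 2 unit_sphere"
  unfolding regular_analytic_submanifold_def
proof
  fix q
  define \<Phi> \<Psi> where "\<Phi> = (\<lambda>q. (fst q - sphere_x (fst (snd q)) (snd (snd q)), fst (snd q), snd (snd q)))"
    and "\<Psi> = (\<lambda>q. (fst q + sphere_x (fst (snd q)) (snd (snd q)), fst (snd q), snd (snd q)))"
  define L where "L = {q :: real \<times> real \<times> real. (1, 0, 0) \<bullet> q = 0}"
  have \<Phi>: "real_analytic_at \<Phi> p" and \<Psi>: "real_analytic_at \<Psi> p" for p
    unfolding \<Phi>_def \<Psi>_def
    by (intro real_analytic_at_Pair real_analytic_at_minus real_analytic_at_add real_analytic_at_sphere_x
        real_analytic_at_coordinates)+
  have diffeo: "analytic_diffeomorphism UNIV UNIV \<Phi>"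
  proof (rule analytic_diffeomorphismI[where G = \<Psi>])
    show "real_analytic_on \<Phi> UNIV" "real_analytic_on \<Psi> UNIV"
      by (rule real_analytic_onI[of UNIV], use \<Phi> \<Psi> in auto)+
  qed (auto simp: \<Phi>_def \<Psi>_def)
  have dim: "dim L = 2"
    unfolding L_def by (subst dim_hyperplane) (auto simp: zero_prod_def)
  have image: "\<Phi> ` (UNIV \<inter> unit_sphere) = UNIV \<inter> L"
  proof (intro equalityI subsetI)
    fix v assume "v \<in> UNIV \<inter> L"
    then have "v = \<Phi> (\<Psi> v)" "\<Psi> v \<in> unit_sphere"
      by (cases v; simp add: \<Phi>_def \<Psi>_def L_def mem_unit_sphere)+
    then show "v \<in> \<Phi> ` (UNIV \<inter> unit_sphere)" by blast
  qed (auto simp: \<Phi>_def L_def mem_unit_sphere)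
  have sub: "subspace L" unfolding L_def by (rule subspace_hyperplane)
  show "\<exists>U V L. \<exists>\<Phi> :: real \<times> real \<times> real \<Rightarrow> real \<times> real \<times> real. open U \<and> q \<in> U \<and> open V \<and> analytic_diffeomorphism U V \<Phi> \<and>
        subspace L \<and> dim L = 2 \<and> \<Phi> ` (U \<inter> unit_sphere) = V \<inter> L"
    by (rule exI[of _ UNIV], rule exI[of _ UNIV], rule exI[of _ L], rule exI[of _ \<Phi>])
      (intro conjI open_UNIV UNIV_I diffeo sub dim image)
qed

lemma unit_sphere_diffeomorphic_plane: "analytic_diffeomorphic unit_sphere (UNIV :: (real \<times> real) set)"
  unfolding analytic_diffeomorphic_def
proof (intro exI analytic_diffeomorphismI)
  show "real_analytic_on snd unit_sphere"
    by (rule real_analytic_onI[of UNIV _ snd])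
      (auto intro!: real_analytic_at_linear bounded_linear_snd)
  show "real_analytic_on (\<lambda>p. (sphere_x (fst p) (snd p), fst p, snd p)) UNIV"
    by (rule real_analytic_onI[of UNIV _ "\<lambda>p. (sphere_x (fst p) (snd p), fst p, snd p)"],
        simp, simp, intro real_analytic_at_Pair real_analytic_at_sphere_x real_analytic_at_coordinates2, simp)
qed (auto simp: mem_unit_sphere)

lemma Exp_in_unit_sphere: "Exp \<psi> c 1 \<in> unit_sphere"
proof -
  have "(sinh_tail 1 (c / 2) * cosh (\<psi> + c / 2))\<^sup>2 - (sinh_tail 1 (c / 2) * sinh (\<psi> + c / 2))\<^sup>2
      = (sinh_tail 1 (c / 2))\<^sup>2"
    by (simp only: power_mult_distrib cosh_square_eq) (simp add: algebra_simps)
  moreover have "0 < sinh_tail 1 (c / 2) * cosh (\<psi> + c / 2)"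
    using sinh_tail_1_ge[of "c / 2"] by simp
  ultimately show ?thesis
    unfolding Exp_coordinates mem_unit_sphere' f_fun_eq k_fun_alpha by blast
qed

lemma isCont_k_fun: "isCont k_fun z"
  by (rule analytic_germ_imp_continuous_differentiable(2)[OF analytic_germ_k_fun])

section \<open>Tangent planes\<close>

text \<open>One inclusion differentiates x^2 - y^2 - f(z) = 0 along a curve; half of the slope 4
  tanh gives the coefficient 2. The other lifts a straight line of the (y, z)-plane to the graph,
  where the equation determines the x-component.\<close>

lemma tangent_space_unit_sphere:
  assumes "(x, y, z) \<in> unit_sphere"
  shows "tangent_space unit_sphere (x, y, z)
    = {(a, b, c). x * a - y * b - 2 * tanh (k_fun z) * c = 0}"
proof (intro equalityI subsetI)
  fix v assume "v \<in> tangent_space unit_sphere (x, y, z)"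
  then obtain \<gamma> \<epsilon> where \<epsilon>: "\<epsilon> > 0" and sub: "\<gamma> ` {-\<epsilon><..<\<epsilon>} \<subseteq> unit_sphere" and \<gamma>0: "\<gamma> 0 = (x, y, z)"
    and d: "(\<gamma> has_vector_derivative v) (at 0)"
    unfolding tangent_space_def by blast
  obtain a b c where v: "v = (a, b, c)" by (cases v)
  have 1: "((\<lambda>t. fst (\<gamma> t)) has_real_derivative a) (at 0)"
    using bounded_linear.has_vector_derivative[OF bounded_linear_fst d]
    by (simp add: v has_real_derivative_iff_has_vector_derivative)
  note d' = bounded_linear.has_vector_derivative[OF bounded_linear_snd d]
  have 2: "((\<lambda>t. fst (snd (\<gamma> t))) has_real_derivative b) (at 0)"
    using bounded_linear.has_vector_derivative[OF bounded_linear_fst d']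
    by (simp add: v has_real_derivative_iff_has_vector_derivative)
  have 3: "((\<lambda>t. snd (snd (\<gamma> t))) has_real_derivative c) (at 0)"
    using bounded_linear.has_vector_derivative[OF bounded_linear_snd d']
    by (simp add: v has_real_derivative_iff_has_vector_derivative)
  have f': "(f_fun has_real_derivative 4 * tanh (k_fun z)) (at (snd (snd (\<gamma> 0))))"
    using f_fun_deriv[of z] by (simp add: \<gamma>0)
  define h where "h t = (fst (\<gamma> t))\<^sup>2 - (fst (snd (\<gamma> t)))\<^sup>2 - f_fun (snd (snd (\<gamma> t)))" for t
  have "(h has_real_derivative 2 * x * a - 2 * y * b - 4 * tanh (k_fun z) * c) (at 0)"
    unfolding h_def
    by (rule derivative_eq_intros DERIV_chain2[where f = f_fun, OF f' 3] 1 2 refl)+ (simp add: \<gamma>0)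
  moreover have "(h has_real_derivative 0) (at 0)"
  proof -
    have "\<forall>\<^sub>F t in nhds 0. t \<in> {-\<epsilon><..<\<epsilon>}" using \<epsilon> by (intro eventually_nhds_in_open) auto
    then have "\<forall>\<^sub>F t in nhds 0. h t = 0"
    proof eventually_elim
      case (elim t)
      then have "\<gamma> t \<in> unit_sphere" using sub by blast
      then have "(fst (\<gamma> t), fst (snd (\<gamma> t)), snd (snd (\<gamma> t))) \<in> unit_sphere" by simp
      then show ?case unfolding mem_unit_sphere' by (simp add: h_def)
    qed
    then have "(h has_real_derivative 0) (at 0) \<longleftrightarrow> ((\<lambda>_. 0) has_real_derivative 0) (at 0)"
      by (intro DERIV_cong_ev) auto
    then show ?thesis by simp
  qed
  ultimately have "2 * x * a - 2 * y * b - 4 * tanh (k_fun z) * c = 0" by (rule DERIV_unique)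
  then show "v \<in> {(a, b, c). x * a - y * b - 2 * tanh (k_fun z) * c = 0}" by (simp add: v)
next
  fix v assume "v \<in> {(a, b, c). x * a - y * b - 2 * tanh (k_fun z) * c = 0}"
  then obtain a b c where v: "v = (a, b, c)" and eq: "x * a - y * b - 2 * tanh (k_fun z) * c = 0" by auto
  have x: "x = sphere_x y z" using assms by (simp add: mem_unit_sphere)
  define \<gamma> where "\<gamma> t = (sphere_x (y + t * b) (z + t * c), y + t * b, z + t * c)" for t
  define D1 where "D1 t = ((y + t * b) * b + 2 * tanh (k_fun (z + t * c)) * c) / sphere_x (y + t * b) (z + t * c)" for t
  have der: "((\<lambda>t. sphere_x (y + t * b) (z + t * c)) has_real_derivative D1 t) (at t)" for t
  proof -
    have r: "(y + t * b)\<^sup>2 + f_fun (z + t * c) > 0" by (rule sphere_x_radicand)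
    show ?thesis
      unfolding sphere_x_def D1_def using r
      by (auto intro!: derivative_eq_intros DERIV_chain2[OF f_fun_deriv] simp: field_simps)
  qed
  have cont: "isCont (\<lambda>t. sphere_x (y + t * b) (z + t * c)) t" for t
    by (rule DERIV_isCont[OF der])
  have contD: "isCont D1 t" for t
    unfolding D1_def
    by (intro continuous_intros cont isCont_o2[OF _ isCont_k_fun])
      (use sphere_x_pos[of "y + t * b" "z + t * c"] in \<open>auto simp: cosh_real_nonzero\<close>)
  have \<gamma>': "(\<gamma> has_vector_derivative (D1 t, b, c)) (at t)" for t
    unfolding \<gamma>_def
    by (intro has_vector_derivative_Pair)
      (auto intro!: derivative_eq_intros der simp flip: has_real_derivative_iff_has_vector_derivative)
  have "\<gamma> C1_differentiable_on {-1<..<1}"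
    unfolding C1_differentiable_on_def
    by (intro exI[of _ "\<lambda>t. (D1 t, b, c)"] conjI ballI \<gamma>' continuous_intros continuous_at_imp_continuous_on contD)
  moreover have "\<gamma> ` {-1<..<1} \<subseteq> unit_sphere" by (auto simp: \<gamma>_def mem_unit_sphere)
  moreover have "\<gamma> 0 = (x, y, z)" by (simp add: \<gamma>_def x)
  moreover have "D1 0 = a"
    using eq sphere_x_pos[of y z] by (simp add: D1_def x field_simps)
  then have "(\<gamma> has_vector_derivative v) (at 0)" using \<gamma>'[of 0] by (simp add: v)
  ultimately show "v \<in> tangent_space unit_sphere (x, y, z)"
    unfolding tangent_space_def by (auto intro!: exI[of _ \<gamma>] exI[of _ 1])
qed

text \<open>Multiplied by cosh w, the tangent equation becomes -s times the stated one: the addition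
  theorems produce the angle \<psi> + c = \<theta> + w, and 2 sinh w = c s. The passage to the frame
  only changes the third component by the z-part of the first two fields.\<close>

lemma tangent_space_Exp:
  "tangent_space unit_sphere (Exp \<psi> c 1) =
    {v\<^sub>1 *\<^sub>R X\<^sub>1 (Exp \<psi> c 1) + v\<^sub>2 *\<^sub>R X\<^sub>2 (Exp \<psi> c 1) + v\<^sub>3 *\<^sub>R X\<^sub>3 (Exp \<psi> c 1) |v\<^sub>1 v\<^sub>2 v\<^sub>3.
       - v\<^sub>1 * cosh (\<psi> + c) + v\<^sub>2 * sinh (\<psi> + c) + v\<^sub>3 * c = 0}"
proof -
  define w s \<theta> where "w = c / 2" and "s = sinh_tail 1 w" and "\<theta> = \<psi> + w"
  define x y z where "x = s * cosh \<theta>" and "y = s * sinh \<theta>" and "z = alpha w"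
  have q: "Exp \<psi> c 1 = (x, y, z)"
    by (simp only: Exp_coordinates x_def y_def z_def s_def \<theta>_def w_def)
  have s: "s > 0" using sinh_tail_1_ge[of w] by (simp add: s_def)
  have frame: "v\<^sub>1 *\<^sub>R X\<^sub>1 (x, y, z) + v\<^sub>2 *\<^sub>R X\<^sub>2 (x, y, z) + v\<^sub>3 *\<^sub>R X\<^sub>3 (x, y, z) = (v\<^sub>1, v\<^sub>2, (x * v\<^sub>2 - y * v\<^sub>1) / 2 + v\<^sub>3)"
    for v\<^sub>1 v\<^sub>2 v\<^sub>3 by (simp add: horizontal_direction) (simp add: X\<^sub>3_def)
  have key: "x * v\<^sub>1 - y * v\<^sub>2 - 2 * tanh w * ((x * v\<^sub>2 - y * v\<^sub>1) / 2 + v\<^sub>3) = 0 \<longleftrightarrow>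
      - v\<^sub>1 * cosh (\<psi> + c) + v\<^sub>2 * sinh (\<psi> + c) + v\<^sub>3 * c = 0" for v\<^sub>1 v\<^sub>2 v\<^sub>3
  proof -
    have ch: "cosh w > 0" by simp
    have \<psi>: "\<psi> + c = \<theta> + w" by (simp add: \<theta>_def w_def)
    have sw: "2 * sinh w = c * s" using sinh_conv_tail[of w] by (simp only: s_def w_def)
    have "cosh w * (x * v\<^sub>1 - y * v\<^sub>2 - 2 * tanh w * ((x * v\<^sub>2 - y * v\<^sub>1) / 2 + v\<^sub>3))
       = s * (v\<^sub>1 * (cosh \<theta> * cosh w + sinh \<theta> * sinh w) - v\<^sub>2 * (sinh \<theta> * cosh w + cosh \<theta> * sinh w)) - 2 * sinh w * v\<^sub>3"
      using ch by (simp add: x_def y_def tanh_def field_simps)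
    also have "\<dots> = - s * (- v\<^sub>1 * cosh (\<psi> + c) + v\<^sub>2 * sinh (\<psi> + c) + v\<^sub>3 * c)"
      unfolding \<psi> cosh_add sinh_add sw by (simp add: algebra_simps)
    finally show ?thesis using s ch by (metis mult_eq_0_iff neg_equal_0_iff_equal less_irrefl)
  qed
  have kz: "k_fun z = w" by (simp add: z_def)
  have T: "tangent_space unit_sphere (x, y, z) = {(a, b, c). x * a - y * b - 2 * tanh w * c = 0}"
    using tangent_space_unit_sphere[of x y z] Exp_in_unit_sphere[of \<psi> c] unfolding q kz by blast
  show ?thesis
    unfolding q T frame
  proof (intro equalityI subsetI)
    fix v assume "v \<in> {(a, b, c). x * a - y * b - 2 * tanh w * c = 0}"
    then obtain a b d where v: "v = (a, b, d)" "x * a - y * b - 2 * tanh w * d = 0" by auto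
    define v\<^sub>3 where "v\<^sub>3 = d - (x * b - y * a) / 2"
    have "d = (x * b - y * a) / 2 + v\<^sub>3" by (simp add: v\<^sub>3_def)
    with v key[of a b v\<^sub>3] show "v \<in> {(v\<^sub>1, v\<^sub>2, (x * v\<^sub>2 - y * v\<^sub>1) / 2 + v\<^sub>3) |v\<^sub>1 v\<^sub>2 v\<^sub>3.
       - v\<^sub>1 * cosh (\<psi> + c) + v\<^sub>2 * sinh (\<psi> + c) + v\<^sub>3 * c = 0}" by blast
  next
    fix v assume "v \<in> {(v\<^sub>1, v\<^sub>2, (x * v\<^sub>2 - y * v\<^sub>1) / 2 + v\<^sub>3) |v\<^sub>1 v\<^sub>2 v\<^sub>3.
       - v\<^sub>1 * cosh (\<psi> + c) + v\<^sub>2 * sinh (\<psi> + c) + v\<^sub>3 * c = 0}"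
    then show "v \<in> {(a, b, c). x * a - y * b - 2 * tanh w * c = 0}" using key by auto
  qed
qed

section \<open>Plane sections\<close>

lemma section_z_const:
  "unit_sphere \<inter> {(x, y, z). z = z\<^sub>0} = {(x, y, z). z = z\<^sub>0 \<and> x\<^sup>2 - y\<^sup>2 = f_fun z\<^sub>0 \<and> x > 0}"
  by (auto simp: mem_unit_sphere')

lemma section_x_const:
  assumes "x\<^sub>0 > 0"
  shows "unit_sphere \<inter> {(x, y, z). x = x\<^sub>0} = {(x, y, z). x = x\<^sub>0 \<and> y\<^sup>2 + f_fun z = x\<^sub>0\<^sup>2}"
  using assms by (auto simp: mem_unit_sphere')

text \<open>Using \<gamma> = \<open>gamma_root (k_fun z)\<close> in place of z turns y^2 + f(z) =
  x0^2 into y^2 + \<gamma>^2 = x0^2 - 1, a circle of positive radius for x0 > 1. The change of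
  coordinate is analytic with analytic inverse on the whole line.\<close>

lemma section_x_diffeomorphic_circle:
  assumes x0: "x\<^sub>0 > 1"
  shows "analytic_diffeomorphic (unit_sphere \<inter> {(x, y, z). x = x\<^sub>0}) (sphere (0 :: real \<times> real) 1)"
proof -
  define \<rho> where "\<rho> = sqrt (x\<^sub>0\<^sup>2 - 1)"
  have "x\<^sub>0\<^sup>2 > 1" using x0 by (simp add: one_less_power)
  then have \<rho>: "\<rho> > 0" "\<rho>\<^sup>2 = x\<^sub>0\<^sup>2 - 1" by (auto simp: \<rho>_def)
  define F where "F = (\<lambda>q :: real \<times> real \<times> real. (1 / \<rho> * fst (snd q), 1 / \<rho> * gamma_root (k_fun (snd (snd q)))))"
  define G where "G = (\<lambda>p. (x\<^sub>0, \<rho> * fst p, alpha (inv gamma_root (\<rho> * snd p))))"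
  have circle: "(u, v) \<in> sphere (0 :: real \<times> real) 1 \<longleftrightarrow> u\<^sup>2 + v\<^sup>2 = 1" for u v :: real
    by (simp add: norm_Pair)
  have inv1: "inv gamma_root (gamma_root w) = w" for w
    using bij_gamma_root by (simp add: bij_is_inj)
  have inv2: "gamma_root (inv gamma_root w) = w" for w
    using bij_gamma_root by (simp add: bij_is_surj surj_f_inv_f)
  have f: "f_fun (alpha w) = 1 + (gamma_root w)\<^sup>2" for w by (simp add: f_fun_eq_gamma_root)
  have sec: "(x, y, z) \<in> unit_sphere \<inter> {(x, y, z). x = x\<^sub>0} \<longleftrightarrow> x = x\<^sub>0 \<and> y\<^sup>2 + f_fun z = x\<^sub>0\<^sup>2" for x y z
    using section_x_const[of x\<^sub>0] x0 by auto
  have "analytic_diffeomorphism (unit_sphere \<inter> {(x, y, z). x = x\<^sub>0}) (sphere 0 1) F"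
  proof (rule analytic_diffeomorphismI[where G = G])
    have germ: "analytic_germ (\<lambda>z. gamma_root (k_fun z)) z" for z
      by (rule analytic_germ_compose[OF analytic_germ_k_fun analytic_germ_gamma_root])
    have "real_analytic_at F p" for p
      unfolding F_def
      by (intro real_analytic_at_Pair real_analytic_at_cmult real_analytic_at_coordinates
          real_analytic_at_germ_compose[OF real_analytic_at_coordinates(3) germ])
    then show "real_analytic_on F (unit_sphere \<inter> {(x, y, z). x = x\<^sub>0})"
      by (intro real_analytic_onI[of UNIV]) auto
    have germ': "analytic_germ (\<lambda>v. alpha (inv gamma_root v)) v" for v
      by (rule analytic_germ_compose[OF analytic_germ_inv_gamma_root analytic_germ_alpha])
    have "real_analytic_at G p" for p
      unfolding G_def
      by (intro real_analytic_at_Pair real_analytic_at_const real_analytic_at_cmult real_analytic_at_coordinates2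
          real_analytic_at_germ_compose[OF real_analytic_at_cmult[OF real_analytic_at_coordinates2(2)] germ'])
    then show "real_analytic_on G (sphere 0 1)"
      by (intro real_analytic_onI[of UNIV]) auto
  next
    fix q assume "q \<in> unit_sphere \<inter> {(x, y, z). x = x\<^sub>0}"
    then obtain y z where q: "q = (x\<^sub>0, y, z)" and eq: "y\<^sup>2 + f_fun z = x\<^sub>0\<^sup>2"
      using sec by (cases q) auto
    have "y\<^sup>2 + (gamma_root (k_fun z))\<^sup>2 = \<rho>\<^sup>2"
      using eq \<rho>(2) by (simp add: f_fun_eq_gamma_root)
    then have "(y\<^sup>2 + (gamma_root (k_fun z))\<^sup>2) / \<rho>\<^sup>2 = 1" using \<rho>(1) by simp
    then show "F q \<in> sphere 0 1"
      unfolding F_def q fst_conv snd_conv circle by (simp add: power_divide add_divide_distrib)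
    show "G (F q) = q" using \<rho> by (simp add: F_def G_def q inv1)
  next
    fix p :: "real \<times> real" assume "p \<in> sphere 0 1"
    then obtain u v where p: "p = (u, v)" and eq: "u\<^sup>2 + v\<^sup>2 = 1" using circle by (cases p) auto
    have "(\<rho> * u)\<^sup>2 + (1 + (\<rho> * v)\<^sup>2) = \<rho>\<^sup>2 * (u\<^sup>2 + v\<^sup>2) + 1" by (simp add: power_mult_distrib algebra_simps)
    also have "\<dots> = x\<^sub>0\<^sup>2" using eq \<rho> by simp
    finally show "G p \<in> unit_sphere \<inter> {(x, y, z). x = x\<^sub>0}"
      unfolding G_def p fst_conv snd_conv sec f inv2 by simp
    show "F (G p) = p" using \<rho> by (simp add: F_def G_def p inv2)
  qed
  then show ?thesis unfolding analytic_diffeomorphic_def by blast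
qed

lemma strictly_convex_onD:
  "strictly_convex_on A g \<Longrightarrow> x \<in> A \<Longrightarrow> y \<in> A \<Longrightarrow> x \<noteq> y \<Longrightarrow> 0 < t \<Longrightarrow> t < 1 \<Longrightarrow>
     g ((1 - t) *\<^sub>R x + t *\<^sub>R y) < (1 - t) * g x + t * g y"
  unfolding strictly_convex_on_def by blast

lemma strictly_convex_closed_curve_level_set:
  fixes h :: "real \<times> real \<Rightarrow> real"
  assumes conv: "strictly_convex_on UNIV h" and cont: "continuous_on UNIV h"
    and bdd: "bounded {p. h p \<le> r}" and low: "h p0 < r"
  shows "strictly_convex_closed_curve {p. h p = r}"
proof -
  define K where "K = {p. h p \<le> r}"
  have "open {p. h p < r}" using open_Collect_less[OF cont continuous_on_const] .
  then have lt: "{p. h p < r} \<subseteq> interior K" by (intro interior_maximal) (auto simp: K_def)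
  have closed: "closed K" unfolding K_def by (intro closed_Collect_le cont continuous_on_const)
  have int: "interior K = {p. h p < r}"
  proof (intro equalityI lt subsetI)
    fix p assume p: "p \<in> interior K"
    show "p \<in> {p. h p < r}"
    proof (rule ccontr)
      assume "p \<notin> {p. h p < r}"
      moreover have "h p \<le> r" using p interior_subset[of K] by (auto simp: K_def)
      ultimately have hp: "h p = r" by simp
      then have "p \<noteq> p0" using low by auto
      obtain e where e: "e > 0" "ball p e \<subseteq> K" using p mem_interior by blast
      \<comment> \<open>The segment from \<open>p0\<close> to \<open>p\<close> is prolonged beyond
        \<open>p\<close> by half the radius of the ball, so \<open>p\<close> becomes a proper convex
        combination of \<open>p0\<close> and a point of \<open>K\<close>. Strict convexity then
        forces h p < r.\<close>
      define \<delta> where "\<delta> = e / (2 * norm (p - p0))"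
      have \<delta>: "\<delta> > 0" using e \<open>p \<noteq> p0\<close> by (simp add: \<delta>_def)
      define u where "u = p + \<delta> *\<^sub>R (p - p0)"
      have "dist p u = e / 2" using e \<open>p \<noteq> p0\<close> by (simp add: u_def dist_norm \<delta>_def)
      then have "u \<in> K" using e by auto
      define t where "t = \<delta> / (1 + \<delta>)"
      have t: "0 < t" "t < 1" using \<delta> by (auto simp: t_def)
      have "(1 - t) *\<^sub>R u + t *\<^sub>R p0 = p"
      proof -
        have t1: "1 - t = 1 / (1 + \<delta>)" using \<delta> by (simp add: t_def field_simps)
        have "(1 + \<delta>) *\<^sub>R ((1 - t) *\<^sub>R u + t *\<^sub>R p0) = u + \<delta> *\<^sub>R p0"
          using \<delta> by (simp add: t1 scaleR_add_right) (simp add: t_def)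
        also have "\<dots> = (1 + \<delta>) *\<^sub>R p" by (simp add: u_def algebra_simps)
        finally show ?thesis using \<delta> by (simp only: scaleR_cancel_left) auto
      qed
      moreover have "u \<noteq> p0"
      proof
        assume "u = p0"
        then have "(1 + \<delta>) *\<^sub>R (p - p0) = 0" by (simp add: u_def algebra_simps)
        then show False using \<delta> \<open>p \<noteq> p0\<close> by simp
      qed
      ultimately have "h p < (1 - t) * h u + t * h p0"
        using strictly_convex_onD[OF conv, of u p0 t] t by simp
      also have "\<dots> \<le> (1 - t) * r + t * r"
        using \<open>u \<in> K\<close> low t by (intro add_mono mult_left_mono) (auto simp: K_def)
      also have "\<dots> = r" by (simp add: algebra_simps)
      finally show False using hp by simp
    qed
  qed
  have "compact K" using closed bdd by (simp add: compact_eq_bounded_closed K_def)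
  moreover have "p0 \<in> interior K" using low by (simp add: int)
  then have "interior K \<noteq> {}" by blast
  moreover have "strictly_convex_set K"
    unfolding strictly_convex_set_def
  proof (intro ballI impI subsetI)
    fix a b p assume ab: "a \<in> K" "b \<in> K" "a \<noteq> b" "p \<in> open_segment a b"
    then obtain t where t: "0 < t" "t < 1" "p = (1 - t) *\<^sub>R a + t *\<^sub>R b" by (auto simp: in_segment)
    have "h p < (1 - t) * h a + t * h b" using strictly_convex_onD[OF conv, of a b t] ab t by simp
    also have "\<dots> \<le> (1 - t) * r + t * r" using ab t by (intro add_mono mult_left_mono) (auto simp: K_def)
    also have "\<dots> = r" by (simp add: algebra_simps)
    finally show "p \<in> interior K" by (simp add: int)
  qed
  moreover have "{p. h p = r} = frontier K"
    unfolding frontier_def closure_closed[OF closed] int by (auto simp: K_def)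
  ultimately show ?thesis unfolding strictly_convex_closed_curve_def by blast
qed

lemma section_x_strictly_convex:
  assumes "x\<^sub>0 > 1"
  shows "strictly_convex_closed_curve {(y, z). (x\<^sub>0, y, z) \<in> unit_sphere}"
proof -
  define h where "h p = (fst p)\<^sup>2 + f_fun (snd p)" for p :: "real \<times> real"
  have "strictly_convex_closed_curve {p. h p = x\<^sub>0\<^sup>2}"
  proof (rule strictly_convex_closed_curve_level_set)
    show "continuous_on UNIV h"
      unfolding h_def
      by (intro continuous_intros continuous_on_compose2[OF continuous_at_imp_continuous_on[of UNIV f_fun]])
        (auto simp: isCont_f_fun)
    show "h 0 < x\<^sub>0\<^sup>2" using assms by (simp add: h_def one_less_power)
    show "bounded {p. h p \<le> x\<^sub>0\<^sup>2}"
    proof (rule bounded_subset[OF bounded_cbox])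
      show "{p. h p \<le> x\<^sub>0\<^sup>2} \<subseteq> cbox (- x\<^sub>0, - x\<^sub>0\<^sup>2) (x\<^sub>0, x\<^sub>0\<^sup>2)"
      proof
        fix p assume "p \<in> {p. h p \<le> x\<^sub>0\<^sup>2}"
        then obtain y z where p: "p = (y, z)" and le: "y\<^sup>2 + f_fun z \<le> x\<^sub>0\<^sup>2" by (cases p) (auto simp: h_def)
        have "\<bar>z\<bar> \<le> x\<^sub>0\<^sup>2" using le f_fun_greater[of z] zero_le_power2[of y] abs_ge_zero[of z] by linarith
        moreover have "y\<^sup>2 \<le> x\<^sub>0\<^sup>2" using le f_fun_ge_1[of z] by simp
        then have "\<bar>y\<bar> \<le> x\<^sub>0" using assms by (simp add: abs_le_square_iff[symmetric])
        ultimately show "p \<in> cbox (- x\<^sub>0, - x\<^sub>0\<^sup>2) (x\<^sub>0, x\<^sub>0\<^sup>2)" by (auto simp: p cbox_Pair_eq abs_le_iff)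
      qed
    qed
    show "strictly_convex_on UNIV h"
      unfolding strictly_convex_on_def
    proof (intro conjI convex_UNIV ballI allI impI)
      fix p q :: "real \<times> real" and t :: real assume A: "p \<noteq> q \<and> 0 < t \<and> t < 1"
      obtain a b c d where pq: "p = (a, b)" "q = (c, d)" by (cases p, cases q)
      \<comment> \<open>The convexity defect of the square. It is positive when the first
        coordinates differ; otherwise the second ones differ and strictness comes from
        \<open>f_fun\<close>.\<close>
      have id: "(1 - t) * a\<^sup>2 + t * c\<^sup>2 - ((1 - t) * a + t * c)\<^sup>2 = t * (1 - t) * (a - c)\<^sup>2"
        by (simp add: power2_eq_square algebra_simps)
      have "((1 - t) * a + t * c)\<^sup>2 + f_fun ((1 - t) * b + t * d)
          < ((1 - t) * a\<^sup>2 + t * c\<^sup>2) + ((1 - t) * f_fun b + t * f_fun d)"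
      proof (cases "b = d")
        case True
        then have "a \<noteq> c" using A pq by simp
        then have "0 < t * (1 - t) * (a - c)\<^sup>2" using A by simp
        moreover have "(1 - t) * d + t * d = d" "(1 - t) * f_fun d + t * f_fun d = f_fun d"
          by (simp_all add: algebra_simps)
        ultimately show ?thesis using id True by simp
      next
        case False
        have "0 \<le> t * (1 - t) * (a - c)\<^sup>2" using A by simp
        moreover have "f_fun ((1 - t) *\<^sub>R b + t *\<^sub>R d) < (1 - t) * f_fun b + t * f_fun d"
          using strictly_convex_onD[OF strictly_convex_f_fun, of b d t] False A by simp
        ultimately show ?thesis using id by simp
      qed
      then show "h ((1 - t) *\<^sub>R p + t *\<^sub>R q) < (1 - t) * h p + t * h q"
        by (simp add: h_def pq algebra_simps)
    qed
  qed
  moreover have "{p. h p = x\<^sub>0\<^sup>2} = {(y, z). (x\<^sub>0, y, z) \<in> unit_sphere}"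
    using assms by (auto simp: h_def mem_unit_sphere')
  ultimately show ?thesis by simp
qed

section \<open>The volume of the ball\<close>

definition cone_region :: "(real \<times> real \<times> real) set" where
  "cone_region = {(x, y, z). x > 0 \<and> 4 * \<bar>z\<bar> < x\<^sup>2 - y\<^sup>2 \<and> x\<^sup>2 - y\<^sup>2 \<le> f_fun z}"

definition cone_boundary :: "(real \<times> real \<times> real) set" where
  "cone_boundary = {(x, y, z). x = sqrt (y\<^sup>2 + 4 * \<bar>z\<bar>)}"

text \<open>Inside the open cone the ball is explicit. The rest lies on the boundary of the cone,
  which is null, so completeness of Lebesgue measure makes the ball measurable.\<close>

lemma unit_ball_decomposition: "unit_ball = cone_region \<union> (unit_ball \<inter> cone_boundary)"
proof -
  have "(x, y, z) \<in> cone_region \<or> (x, y, z) \<in> cone_boundary" if q: "(x, y, z) \<in> unit_ball" for x y z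
  proof -
    have J: "(x, y, z) \<in> causal_future q\<^sub>0" using q by (simp add: unit_ball_def)
    note le = causal_future_q0[OF J]
    show ?thesis
    proof (cases "4 * \<bar>z\<bar> = x\<^sup>2 - y\<^sup>2")
      case True
      then have "x\<^sup>2 = y\<^sup>2 + 4 * \<bar>z\<bar>" "0 \<le> x" using le by auto
      then show ?thesis by (simp add: cone_boundary_def real_sqrt_unique)
    next
      case False
      then have "4 * \<bar>z\<bar> < x\<^sup>2 - y\<^sup>2" using le by simp
      moreover from this have "x > 0" using le(1) by (cases "x = 0") auto
      ultimately show ?thesis using unit_ball_interior[of x z y] q by (simp add: cone_region_def)
    qed
  qed
  moreover have "(x, y, z) \<in> unit_ball" if "(x, y, z) \<in> cone_region" for x y z
    using that unit_ball_interior[of x z y] by (simp add: cone_region_def)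
  ultimately show ?thesis by auto
qed

text \<open>The set is a graph over the (y, z)-plane, so every slice in the x-direction is a single
  point and Fubini applies.\<close>

lemma null_cone_boundary: "cone_boundary \<in> null_sets lborel"
proof -
  have "cone_boundary = {q. fst q = sqrt ((fst (snd q))\<^sup>2 + 4 * \<bar>snd (snd q)\<bar>)}"
    by (auto simp: cone_boundary_def)
  also have "closed \<dots>" by (intro closed_Collect_eq continuous_intros)
  finally have borel: "cone_boundary \<in> sets borel" by (rule borel_closed)
  then have "cone_boundary \<in> sets (lborel \<Otimes>\<^sub>M lborel)" by (simp only: lborel_prod sets_lborel)
  from lborel_pair.emeasure_pair_measure_alt2[OF this]
  have "emeasure lborel cone_boundary = (\<integral>\<^sup>+p. emeasure lborel ((\<lambda>x. (x, p)) -` cone_boundary) \<partial>lborel)"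
    by (simp add: lborel_prod)
  also have "\<dots> = (\<integral>\<^sup>+p. 0 \<partial>(lborel :: (real \<times> real) measure))"
  proof (rule nn_integral_cong)
    fix p :: "real \<times> real"
    obtain y z where p: "p = (y, z)" by (cases p)
    have "(\<lambda>x. (x, p)) -` cone_boundary = {sqrt (y\<^sup>2 + 4 * \<bar>z\<bar>)}" by (auto simp: p cone_boundary_def)
    then show "emeasure lborel ((\<lambda>x. (x, p)) -` cone_boundary) = 0" by simp
  qed
  finally show ?thesis
    using borel by (intro null_setsI) simp_all
qed

lemma measurable_cone_region: "cone_region \<in> sets borel"
proof -
  have "continuous_on UNIV (\<lambda>q :: real \<times> real \<times> real. f_fun (snd (snd q)))"
    by (intro continuous_on_compose2[OF continuous_at_imp_continuous_on[of UNIV f_fun]] continuous_intros)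
      (auto simp: isCont_f_fun)
  then have "closed {q :: real \<times> real \<times> real. (fst q)\<^sup>2 - (fst (snd q))\<^sup>2 \<le> f_fun (snd (snd q))}"
    by (intro closed_Collect_le continuous_intros)
  moreover have "open {q :: real \<times> real \<times> real. 0 < fst q}" "open {q :: real \<times> real \<times> real. 4 * \<bar>snd (snd q)\<bar> < (fst q)\<^sup>2 - (fst (snd q))\<^sup>2}"
    by (intro open_Collect_less continuous_intros)+
  ultimately have "{q. 0 < fst q} \<inter> {q. 4 * \<bar>snd (snd q)\<bar> < (fst q)\<^sup>2 - (fst (snd q))\<^sup>2} \<inter>
      {q :: real \<times> real \<times> real. (fst q)\<^sup>2 - (fst (snd q))\<^sup>2 \<le> f_fun (snd (snd q))} \<in> sets borel"
    by (intro sets.Int borel_open borel_closed)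
  also have "{q. 0 < fst q} \<inter> {q. 4 * \<bar>snd (snd q)\<bar> < (fst q)\<^sup>2 - (fst (snd q))\<^sup>2} \<inter>
      {q :: real \<times> real \<times> real. (fst q)\<^sup>2 - (fst (snd q))\<^sup>2 \<le> f_fun (snd (snd q))} = cone_region"
    by (auto simp: cone_region_def)
  finally show ?thesis .
qed

text \<open>The \<open>n\<close>-th box lies in \<open>1 / 2 < x\<^sup>2 - y\<^sup>2 < 1\<close> because \<open>x\<^sup>2\<close> ranges over
  \<open>((n + 3) / 4, (n + 4) / 4)\<close> and \<open>y\<^sup>2\<close> over \<open>(n / 4, (n + 1) / 4)\<close>; its volume is of
  order \<open>1 / n\<close>.\<close>

definition ball_box :: "nat \<Rightarrow> (real \<times> real \<times> real) set" where
  "ball_box n = {sqrt (real n + 3) / 2<..<sqrt (real n + 4) / 2} \<times>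
     {sqrt (real n) / 2<..<sqrt (real n + 1) / 2} \<times> {0<..<1 / 8}"

lemma ball_box_subset: "ball_box n \<subseteq> cone_region"
proof
  fix q assume "q \<in> ball_box n"
  then obtain x y z where q: "q = (x, y, z)"
    and x: "sqrt (real n + 3) / 2 < x" "x < sqrt (real n + 4) / 2"
    and y: "sqrt (real n) / 2 < y" "y < sqrt (real n + 1) / 2" and z: "0 < z" "z < 1 / 8"
    by (auto simp: ball_box_def)
  have sq: "a\<^sup>2 < b\<^sup>2" if "0 \<le> a" "a < b" for a b :: real
    using that by (simp add: power_strict_mono)
  have "0 \<le> sqrt (real n + 3)" "0 \<le> sqrt (real n)" by simp_all
  then have "x > 0" "y > 0" using x(1) y(1) by linarith+
  have "(sqrt (real n + 3) / 2)\<^sup>2 < x\<^sup>2" "x\<^sup>2 < (sqrt (real n + 4) / 2)\<^sup>2"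
    "(sqrt (real n) / 2)\<^sup>2 < y\<^sup>2" "y\<^sup>2 < (sqrt (real n + 1) / 2)\<^sup>2"
    using x y \<open>x > 0\<close> \<open>y > 0\<close> by (auto intro!: sq)
  \<comment> \<open>The lower bound 1/2 matches the height 1/8 of the box, which gives 4|z| < 1/2;
    the upper bound 1 is the minimum of the profile.\<close>
  then have "x\<^sup>2 - y\<^sup>2 < 1" "1 / 2 < x\<^sup>2 - y\<^sup>2" by (auto simp: power_divide)
  then show "q \<in> cone_region"
    using f_fun_ge_1[of z] z \<open>x > 0\<close> by (auto simp: cone_region_def q)
qed

lemma sqrt_increment_ge: "0 \<le> a \<Longrightarrow> a + 1 \<le> b \<Longrightarrow> 1 / (2 * sqrt b) \<le> sqrt (a + 1) - sqrt a"
proof -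
  assume a: "0 \<le> a" "a + 1 \<le> b"
  have "(sqrt (a + 1) - sqrt a) * (sqrt (a + 1) + sqrt a) = 1"
    using a by (simp add: algebra_simps)
  moreover have "sqrt (a + 1) + sqrt a > 0" using a by (simp add: add_pos_nonneg)
  ultimately have "sqrt (a + 1) - sqrt a = 1 / (sqrt (a + 1) + sqrt a)" by (simp add: eq_divide_eq)
  moreover have "sqrt (a + 1) + sqrt a \<le> 2 * sqrt b"
  proof -
    have "sqrt (a + 1) \<le> sqrt b" "sqrt a \<le> sqrt b" using a by simp_all
    then show ?thesis by linarith
  qed
  ultimately show ?thesis
    using \<open>sqrt (a + 1) + sqrt a > 0\<close> by (simp add: frac_le)
qed

lemma emeasure_ball_box: "emeasure lborel (ball_box n) \<ge> ennreal (1 / 128 * inverse (real (n + 4)))"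
proof -
  let ?l = "(sqrt (real n + 3) / 2, sqrt (real n) / 2, 0 :: real)"
  let ?u = "(sqrt (real n + 4) / 2, sqrt (real n + 1) / 2, 1 / 8 :: real)"
  let ?A = "sqrt (real n + 4) - sqrt (real n + 3)" and ?B = "sqrt (real n + 1) - sqrt (real n)"
  have box: "ball_box n = box ?l ?u"
    by (auto simp: ball_box_def box_def Basis_prod_def)
  have "emeasure lborel (box ?l ?u) = emeasure lborel (cbox ?l ?u)"
    by (simp add: emeasure_lborel_box_eq emeasure_lborel_cbox_eq)
  also have "\<dots> = ennreal (measure lborel (cbox ?l ?u))"
    by (intro emeasure_eq_ennreal_measure) (simp add: emeasure_lborel_cbox_eq)
  also have "measure lborel (cbox ?l ?u) = ?A / 2 * (?B / 2 * (1 / 8))"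
    unfolding content_Pair by (simp add: content_real diff_divide_distrib)
  finally have em: "emeasure lborel (ball_box n) = ennreal (?A / 2 * (?B / 2 * (1 / 8)))"
    by (simp only: box)
  have "1 / (2 * sqrt (real n + 4)) \<le> ?A"
    using sqrt_increment_ge[of "real n + 3" "real n + 4"] by (simp add: add.commute)
  moreover have "1 / (2 * sqrt (real n + 4)) \<le> ?B"
    using sqrt_increment_ge[of "real n" "real n + 4"] by simp
  ultimately have "1 / (2 * sqrt (real n + 4)) * (1 / (2 * sqrt (real n + 4))) \<le> ?A * ?B"
    by (intro mult_mono) auto
  moreover have "1 / (2 * sqrt (real n + 4)) * (1 / (2 * sqrt (real n + 4))) = 1 / 4 * inverse (real (n + 4))"
    by (simp add: inverse_eq_divide)
  \<comment> \<open>The constant 1/128 is the product of 1/4 from the two root increments, 1/2 and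
    1/2 from the halved sides and 1/8 from the height.\<close>
  ultimately show ?thesis unfolding em by (intro ennreal_leI) simp
qed

text \<open>The x-ranges are already disjoint: for m < n the first ends before the second begins
  because m + 4 <= n + 3.\<close>

lemma disjoint_ball_box: "disjoint_family ball_box"
proof -
  have "ball_box m \<inter> ball_box n = {}" if "m < n" for m n
  proof -
    have le: "sqrt (real m + 4) \<le> sqrt (real n + 3)" using that by simp
    have False if "q \<in> ball_box m" "q \<in> ball_box n" for q
    proof -
      have "fst q < sqrt (real m + 4) / 2" "sqrt (real n + 3) / 2 < fst q"
        using that by (auto simp: ball_box_def)
      with le show False by linarith
    qed
    then show ?thesis by blast
  qed
  then show ?thesis unfolding disjoint_family_on_def by (metis inf_commute linorder_neqE_nat)
qed

lemma emeasure_unit_ball: "emeasure lebesgue unit_ball = \<infinity>"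
proof -
  have "unit_ball \<inter> cone_boundary \<in> sets lebesgue"
    using null_cone_boundary by (meson Int_lower2 null_sets_completion_subset null_setsD2 null_sets_completionI)
  then have meas: "unit_ball \<in> sets lebesgue"
    using measurable_cone_region by (subst unit_ball_decomposition) (auto intro!: sets.Un)
  have open_box: "ball_box n \<in> sets borel" for n
    unfolding ball_box_def by (intro borel_open open_Times open_greaterThanLessThan)
  have "(\<Sum>n. ennreal (1 / 128 * inverse (real (n + 4)))) = \<infinity>"
  proof (rule ccontr)
    assume "(\<Sum>n. ennreal (1 / 128 * inverse (real (n + 4)))) \<noteq> \<infinity>"
    then have "summable (\<lambda>n. 1 / 128 * inverse (real (n + 4)))"
      by (intro summable_suminf_not_top) auto
    then have "summable (\<lambda>n. inverse (real (n + 4)))" by (subst (asm) summable_cmult_iff) simp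
    then have "summable (\<lambda>n. inverse (real n))"
      using summable_iff_shift[of "\<lambda>n. inverse (real n)" 4] by simp
    then show False using not_summable_harmonic[where 'a = real] by simp
  qed
  then have "\<infinity> \<le> (\<Sum>n. emeasure lborel (ball_box n))"
    using suminf_le[of "\<lambda>n. ennreal (1 / 128 * inverse (real (n + 4)))" "\<lambda>n. emeasure lborel (ball_box n)"]
      emeasure_ball_box by (simp add: summableI)
  also have "\<dots> = emeasure lborel (\<Union>n. ball_box n)"
    using open_box disjoint_ball_box by (intro suminf_emeasure) auto
  also have "\<dots> = emeasure lebesgue (\<Union>n. ball_box n)"
    using open_box by (simp add: emeasure_completion)
  also have "\<dots> \<le> emeasure lebesgue unit_ball"
    using ball_box_subset meas unit_ball_decomposition by (intro emeasure_mono) blast+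
  finally show ?thesis by (simp add: top.extremum_unique)
qed

lemma distance_from_profile:
  assumes "(x, y, z) \<in> chronological_future q\<^sub>0"
  shows "\<exists>R>0. x\<^sup>2 - y\<^sup>2 = R\<^sup>2 * f_fun (z / R\<^sup>2)"
    and "R > 0 \<Longrightarrow> x\<^sup>2 - y\<^sup>2 = R\<^sup>2 * f_fun (z / R\<^sup>2) \<Longrightarrow> sl_dist q\<^sub>0 (x, y, z) = ereal R"
  using f_fun_scaled_surj[OF chronological_future_strict(2)[OF assms]]
    sl_dist_eqI(2)[OF _ chronological_future_strict(1)[OF assms]] by auto

lemma real_analytic_f_fun: "real_analytic_on f_fun UNIV"
  by (rule real_analytic_onI[of UNIV _ f_fun])
    (auto intro: real_analytic_at_germ_compose[OF real_analytic_at_linear[OF bounded_linear_ident] analytic_germ_f_fun])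

theorem theorem13:
  shows
    "regular_analytic_submanifold 2 unit_sphere
       \<and> analytic_diffeomorphic unit_sphere (UNIV :: (real \<times> real) set)
   \<and> (\<forall>\<psi> c. Exp \<psi> c 1 \<in> unit_sphere
       \<and> tangent_space unit_sphere (Exp \<psi> c 1) =
           {v\<^sub>1 *\<^sub>R X\<^sub>1 (Exp \<psi> c 1) + v\<^sub>2 *\<^sub>R X\<^sub>2 (Exp \<psi> c 1) + v\<^sub>3 *\<^sub>R X\<^sub>3 (Exp \<psi> c 1) |v\<^sub>1 v\<^sub>2 v\<^sub>3.
              - v\<^sub>1 * cosh (\<psi> + c) + v\<^sub>2 * sinh (\<psi> + c) + v\<^sub>3 * c = 0})
   \<and> unit_sphere = {(x, y, z). x = sqrt (y\<^sup>2 + f_fun z)}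
   \<and> (real_analytic_on f_fun UNIV
       \<and> (\<forall>z. f_fun (- z) = f_fun z)
       \<and> strictly_convex_on UNIV f_fun
       \<and> strict_mono_on {0..} f_fun
       \<and> \<not> bdd_above (f_fun ` {0..})
       \<and> (\<lambda>z. f_fun z - (1 + 12 * z\<^sup>2)) \<in> O[at 0](\<lambda>z. z ^ 4)
       \<and> ((\<lambda>z. f_fun z - 4 * \<bar>z\<bar>) \<longlongrightarrow> 0) at_infinity)
   \<and> (\<forall>z. z \<noteq> 0 \<longrightarrow> 4 * \<bar>z\<bar> < f_fun z \<and> f_fun z < 4 * \<bar>z\<bar> + 1)
   \<and> (\<forall>z\<^sub>0. f_fun z\<^sub>0 > 0
       \<and> unit_sphere \<inter> {(x, y, z). z = z\<^sub>0} =
           {(x, y, z). z = z\<^sub>0 \<and> x\<^sup>2 - y\<^sup>2 = f_fun z\<^sub>0 \<and> x > 0})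
   \<and> (\<forall>x\<^sub>0>1.
         unit_sphere \<inter> {(x, y, z). x = x\<^sub>0} = {(x, y, z). x = x\<^sub>0 \<and> y\<^sup>2 + f_fun z = x\<^sub>0\<^sup>2}
       \<and> strictly_convex_closed_curve {(y, z). (x\<^sub>0, y, z) \<in> unit_sphere}
       \<and> analytic_diffeomorphic (unit_sphere \<inter> {(x, y, z). x = x\<^sub>0}) (sphere (0 :: real \<times> real) 1))
   \<and> (\<forall>x y z. (x, y, z) \<in> chronological_future q\<^sub>0 \<longrightarrow>
         (\<exists>R>0. x\<^sup>2 - y\<^sup>2 = R\<^sup>2 * f_fun (z / R\<^sup>2))
       \<and> (\<forall>R>0. x\<^sup>2 - y\<^sup>2 = R\<^sup>2 * f_fun (z / R\<^sup>2) \<longrightarrow> sl_dist q\<^sub>0 (x, y, z) = ereal R))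
   \<and> emeasure lebesgue unit_ball = \<infinity>"
proof (intro conjI allI impI)
  show "f_fun z > 0" for z using f_fun_ge_1[of z] by simp
  show "unit_sphere \<inter> {(x, y, z). x = x\<^sub>0} = {(x, y, z). x = x\<^sub>0 \<and> y\<^sup>2 + f_fun z = x\<^sub>0\<^sup>2}" if "x\<^sub>0 > 1" for x\<^sub>0
    using section_x_const[of x\<^sub>0] that by simp
qed (rule regular_unit_sphere unit_sphere_diffeomorphic_plane Exp_in_unit_sphere tangent_space_Exp
    unit_sphere_eq real_analytic_f_fun f_fun_minus strictly_convex_f_fun strict_mono_f_fun f_fun_unbounded
    f_fun_taylor f_fun_asymptote f_fun_bounds section_z_const section_x_strictly_convex
    section_x_diffeomorphic_circle distance_from_profile emeasure_unit_ball; assumption)+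

end
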